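(* Let $\theta$ be an inner function on $\mathbb{D}^2$, $\mathcal{K}_\theta=H^2(\mathbb{D}^2)\ominus\theta H^2(\mathbb{D}^2)$ and $S_z=P_{\mathcal{K}_\theta}T_z|_{\mathcal{K}_\theta}$. If $\theta$ is not a function depending only on the variable $z$, then $$\overline{\pi_1\big(\{(z,w)\in\mathbb{D}^2:\theta(z,w)=0\}\big)}\cup\mathbb{T}\subseteq\sigma(S_z).$$ Moreover, if $\theta$ is a rational inner function, then $$\sigma(S_z)=\pi_1\big(Z_\theta\cap\overline{\mathbb{D}^2}\big).$$
   Context: $H^2(\mathbb{D}^2)$ is the Hardy space over the bidisk, with coordinates $(z,w)$; $T_z$ is multiplication by $z$; $P_{\mathcal{K}}$ is the orthogonal projection onto $\mathcal{K}$; $\mathbb{T}$ is the unit circle; $\sigma$ denotes the spectrum; $\pi_1(z,w)=z$. An inner function on $\mathbb{D}^2$ is $\theta\in H^2(\mathbb{D}^2)$ with $|\theta|=1$ a.e. on $\mathbb{T}^2$; it is rational inner if it is also a rational function. For a rational inner function $\theta=q/p$ with $p,q$ coprime polynomials, $Z_\theta$ denotes the zero set of the numerator $q$ in $\mathbb{C}^2$. *)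

theory Defs
  imports "HOL-Analysis.Analysis" "HOL-Computational_Algebra.Computational_Algebra"
begin

definition bidisk :: "(complex \<times> complex) set" where
  "bidisk = ball 0 1 \<times> ball 0 1"


section \<open>The Hardy space over the bidisk\<close>

text \<open>
  The elements of \<open>H\<^sup>2\<close> are the functions on the bidisk given by power series with
  square-summable coefficients. Since functions are total, each is represented by its
  extension by zero outside the bidisk, so that equality in \<open>H\<^sup>2\<close> is equality of functions.
\<close>

definition square_summable :: "(nat \<times> nat \<Rightarrow> complex) \<Rightarrow> bool" where
  "square_summable a \<longleftrightarrow> (\<lambda>k. (cmod (a k))\<^sup>2) summable_on UNIV"

definition power_series2 :: "(nat \<times> nat \<Rightarrow> complex) \<Rightarrow> complex \<times> complex \<Rightarrow> complex" where
  "power_series2 a = (\<lambda>(z, w).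
     if (z, w) \<in> bidisk then \<Sum>\<^sub>\<infinity>(m, n)\<in>UNIV. a (m, n) * z ^ m * w ^ n else 0)"

definition hardy2 :: "(complex \<times> complex \<Rightarrow> complex) set" where
  "hardy2 = power_series2 ` {a. square_summable a}"

definition hardy_coeff :: "(complex \<times> complex \<Rightarrow> complex) \<Rightarrow> nat \<times> nat \<Rightarrow> complex" where
  "hardy_coeff f = (THE a. square_summable a \<and> f = power_series2 a)"

definition hinner ::
  "(complex \<times> complex \<Rightarrow> complex) \<Rightarrow> (complex \<times> complex \<Rightarrow> complex) \<Rightarrow> complex" where
  "hinner f g = (\<Sum>\<^sub>\<infinity>k\<in>UNIV. hardy_coeff f k * cnj (hardy_coeff g k))"

definition hnorm :: "(complex \<times> complex \<Rightarrow> complex) \<Rightarrow> real" where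
  "hnorm f = sqrt (Re (hinner f f))"

text \<open>\<open>hardy_ominus M\<close> is \<open>H\<^sup>2 \<ominus> M\<close>.\<close>

definition hardy_ominus ::
  "(complex \<times> complex \<Rightarrow> complex) set \<Rightarrow> (complex \<times> complex \<Rightarrow> complex) set" where
  "hardy_ominus M = {f \<in> hardy2. \<forall>g\<in>M. hinner f g = 0}"

text \<open>The orthogonal projection onto \<open>K\<close>, meaningful for closed subspaces \<open>K\<close> of \<open>H\<^sup>2\<close>.\<close>

definition hardy_proj ::
  "(complex \<times> complex \<Rightarrow> complex) set \<Rightarrow>
   (complex \<times> complex \<Rightarrow> complex) \<Rightarrow> complex \<times> complex \<Rightarrow> complex" where
  "hardy_proj K f = (THE g. g \<in> K \<and> (\<forall>h\<in>K. hinner (\<lambda>x. f x - g x) h = 0))"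


section \<open>Bounded operators on a subspace and their spectrum\<close>

definition bounded_operator_on ::
  "(complex \<times> complex \<Rightarrow> complex) set \<Rightarrow>
   ((complex \<times> complex \<Rightarrow> complex) \<Rightarrow> complex \<times> complex \<Rightarrow> complex) \<Rightarrow> bool" where
  "bounded_operator_on K R \<longleftrightarrow>
     (\<forall>f\<in>K. R f \<in> K) \<and>
     (\<forall>f\<in>K. \<forall>g\<in>K. R (\<lambda>x. f x + g x) = (\<lambda>x. R f x + R g x)) \<and>
     (\<forall>c. \<forall>f\<in>K. R (\<lambda>x. c * f x) = (\<lambda>x. c * R f x)) \<and>
     (\<exists>C. \<forall>f\<in>K. hnorm (R f) \<le> C * hnorm f)"

text \<open>The set of all \<open>\<mu>\<close> for which \<open>T - \<mu> I\<close> has no bounded two-sided inverse on \<open>K\<close>.\<close>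

definition op_spectrum ::
  "(complex \<times> complex \<Rightarrow> complex) set \<Rightarrow>
   ((complex \<times> complex \<Rightarrow> complex) \<Rightarrow> complex \<times> complex \<Rightarrow> complex) \<Rightarrow> complex set" where
  "op_spectrum K T = {\<mu>. \<not> (\<exists>R. bounded_operator_on K R \<and>
     (\<forall>f\<in>K. R (\<lambda>x. T f x - \<mu> * f x) = f \<and> (\<lambda>x. T (R f) x - \<mu> * R f x) = f))}"


section \<open>Inner functions, model spaces and compressed shifts\<close>

text \<open>
  Boundary values on the torus are radial limits. The torus is parametrized by
  \<open>(s, t) \<mapsto> (cis s, cis t)\<close>, so that its null sets correspond to the Lebesgue null sets
  of the square of side \<open>2\<pi>\<close>.
\<close>

definition inner_function :: "(complex \<times> complex \<Rightarrow> complex) \<Rightarrow> bool" where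
  "inner_function \<theta> \<longleftrightarrow> \<theta> \<in> hardy2 \<and>
     (AE (s, t) in lborel. s \<in> {0..2 * pi} \<and> t \<in> {0..2 * pi} \<longrightarrow>
        (\<exists>l. ((\<lambda>r. \<theta> (of_real r * cis s, of_real r * cis t)) \<longlongrightarrow> l) (at_left (1::real)) \<and>
             cmod l = 1))"

definition model_space ::
  "(complex \<times> complex \<Rightarrow> complex) \<Rightarrow> (complex \<times> complex \<Rightarrow> complex) set" where
  "model_space \<theta> = hardy_ominus ((\<lambda>g x. \<theta> x * g x) ` hardy2)"

definition mult_z ::
  "(complex \<times> complex \<Rightarrow> complex) \<Rightarrow> complex \<times> complex \<Rightarrow> complex" where
  "mult_z f = (\<lambda>x. fst x * f x)"

definition compressed_shift_z ::
  "(complex \<times> complex \<Rightarrow> complex) \<Rightarrow>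
   (complex \<times> complex \<Rightarrow> complex) \<Rightarrow> complex \<times> complex \<Rightarrow> complex" where
  "compressed_shift_z \<theta> f = hardy_proj (model_space \<theta>) (mult_z f)"

definition depends_only_on_z :: "(complex \<times> complex \<Rightarrow> complex) \<Rightarrow> bool" where
  "depends_only_on_z \<theta> \<longleftrightarrow> (\<exists>g. \<forall>z w. (z, w) \<in> bidisk \<longrightarrow> \<theta> (z, w) = g z)"


section \<open>Rational functions of two variables\<close>

text \<open>
  Polynomials in \<open>(z, w)\<close> are elements of \<open>\<complex>[z][w]\<close>: the outer variable is \<open>w\<close>, and the
  coefficients are polynomials in \<open>z\<close>.
\<close>

definition poly2 :: "complex poly poly \<Rightarrow> complex \<times> complex \<Rightarrow> complex" where
  "poly2 p = (\<lambda>(z, w). poly (poly p [:w:]) z)"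

definition zero_set2 :: "complex poly poly \<Rightarrow> (complex \<times> complex) set" where
  "zero_set2 p = {x. poly2 p x = 0}"

text \<open>
  \<open>\<theta>\<close> equals the rational function \<open>q / p\<close> in lowest terms. No non-vanishing of \<open>p\<close> on the
  bidisk is assumed, hence the guard against division by zero.
\<close>

definition reduced_fraction ::
  "(complex \<times> complex \<Rightarrow> complex) \<Rightarrow> complex poly poly \<Rightarrow> complex poly poly \<Rightarrow> bool" where
  "reduced_fraction \<theta> q p \<longleftrightarrow> p \<noteq> 0 \<and> coprime p q \<and>
     (\<forall>x\<in>bidisk. poly2 p x \<noteq> 0 \<longrightarrow> \<theta> x = poly2 q x / poly2 p x)"

end

theory Submission
  imports Defs "HOL-Complex_Analysis.Complex_Analysis" "HOL-Computational_Algebra.Field_as_Ring"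
begin

text \<open>
  Write \<open>K\<close> for the model space and \<open>S\<close> for the compressed shift. At a zero \<open>(\<mu>, w)\<close> of \<open>\<theta>\<close> the
  reproducing kernel lies in \<open>K\<close> and is annihilated by the adjoint of \<open>S - \<mu>\<close>.

  If \<open>\<theta>\<close> depends on \<open>w\<close>, the backward shift \<open>f = (\<theta> - \<theta>(z, 0)) / w\<close> is nonzero and all \<open>z\<^sup>m f\<close> lie
  in \<open>K\<close>. A bounded inverse of \<open>S - \<zeta>\<close> with \<open>\<bar>\<zeta>\<bar> = 1\<close> would bound the norms of \<open>f / (z - \<zeta>)\<^sup>k\<close>
  (more precisely, of polynomial approximations to it) geometrically in \<open>k\<close>, so point evaluations
  force \<open>f\<close> to vanish near \<open>z = \<zeta>\<close>, hence everywhere.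

  An identity \<open>(z - \<nu>) A + \<theta> B = 1\<close> with bounded multipliers \<open>A\<close>, \<open>B\<close> makes \<open>f \<mapsto> P (A f)\<close> the
  inverse of \<open>S - \<nu>\<close>. For \<open>\<theta> = q / p\<close> and \<open>q(\<nu>, w)\<close> without zeros in the closed disk one takes
  \<open>B = p(\<nu>, w) / q(\<nu>, w)\<close>; \<open>A\<close> is bounded because \<open>\<bar>q\<bar> \<le> \<bar>p\<bar>\<close> on the bidisk. Conversely, Hurwitz's
  theorem approximates zeros of \<open>q\<close> on the boundary by zeros of \<open>\<theta>\<close> in the bidisk.
\<close>

section \<open>Square-summable coefficient families\<close>

text \<open>The definition of an inner function provides no bounded function and no boundary
  function, only membership in the Hardy space and unimodular radial limits almost everywhere. That
  multiplication by \<theta> is isometric, and hence that the projection onto \<open>K\<close>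
  exists, is therefore proved by integrating over tori of radius r < 1, where all series converge
  absolutely, and letting r tend to 1. The bound of \<theta> by 1 is a consequence. Multipliers
  likewise only need bounds on tori of radius close to 1, so that a point \<nu> inside the disk is
  avoided.

  A fraction in lowest terms may a priori have a denominator with zeros in the bidisk or on its
  boundary. The arguments therefore rest on the product identity \<open>\<theta> p = q\<close>, on
  its consequence |p| = |q| on the torus, and on coprimality.

  The circle argument gives nothing when \<theta> depends on z alone. In that case lowest terms
  force p and q to be polynomials in z, and |p| = |q| on the torus then excludes zeros of q over the
  circle.\<close>

definition l2_inner :: "(nat \<times> nat \<Rightarrow> complex) \<Rightarrow> (nat \<times> nat \<Rightarrow> complex) \<Rightarrow> complex" where
  "l2_inner a b = (\<Sum>\<^sub>\<infinity>k. a k * cnj (b k))"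

definition l2_norm :: "(nat \<times> nat \<Rightarrow> complex) \<Rightarrow> real" where
  "l2_norm a = sqrt (\<Sum>\<^sub>\<infinity>k. (cmod (a k))\<^sup>2)"

lemma l2_norm_nonneg: "0 \<le> l2_norm a"
  unfolding l2_norm_def by (intro real_sqrt_ge_zero infsum_nonneg) auto

lemma l2_norm_sq: "(l2_norm a)\<^sup>2 = (\<Sum>\<^sub>\<infinity>k. (cmod (a k))\<^sup>2)"
  unfolding l2_norm_def by (intro real_sqrt_pow2 infsum_nonneg) auto

lemma L2_set_le_l2_norm:
  assumes "square_summable a"
  shows "L2_set (\<lambda>k. cmod (a k)) F \<le> l2_norm a"
proof (cases "finite F")
  case True
  then show ?thesis
    using assms unfolding L2_set_def l2_norm_def square_summable_def
    by (intro real_sqrt_le_mono finite_sum_le_infsum) auto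
qed (simp add: L2_set_infinite l2_norm_nonneg)

text \<open>Membership and norm estimates are obtained from finite index sets, where the triangle
  and Cauchy-Schwarz inequalities for \<open>L2_set\<close> are available. The empty set shows that
  the bound is nonnegative.\<close>

lemma square_summableI:
  assumes "\<And>F. finite F \<Longrightarrow> L2_set (\<lambda>k. cmod (a k)) F \<le> C"
  shows "square_summable a" and "l2_norm a \<le> C"
proof -
  have C: "0 \<le> C" using assms[of "{}"] by simp
  have b: "(\<Sum>k\<in>F. (cmod (a k))\<^sup>2) \<le> C\<^sup>2" if "finite F" for F
    using power_mono[OF assms[OF that] L2_set_nonneg, of 2]
    by (simp add: L2_set_def sum_nonneg)
  show s: "square_summable a" unfolding square_summable_def
    by (rule nonneg_bdd_above_summable_on) (auto intro!: bdd_aboveI[of _ "C\<^sup>2"] b)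
  have "(\<Sum>\<^sub>\<infinity>k. (cmod (a k))\<^sup>2) \<le> C\<^sup>2"
    using s b unfolding square_summable_def by (intro infsum_le_finite_sums) auto
  then show "l2_norm a \<le> C"
    unfolding l2_norm_def by (intro real_le_lsqrt C)
qed

lemma square_summable_add:
  assumes "square_summable a" "square_summable b"
  shows "square_summable (\<lambda>k. a k + b k)" and "l2_norm (\<lambda>k. a k + b k) \<le> l2_norm a + l2_norm b"
proof -
  have "L2_set (\<lambda>k. cmod (a k + b k)) F \<le> l2_norm a + l2_norm b" if "finite F" for F
  proof -
    have "L2_set (\<lambda>k. cmod (a k + b k)) F \<le> L2_set (\<lambda>k. cmod (a k) + cmod (b k)) F"
      by (intro L2_set_mono) (auto simp: norm_triangle_ineq)
    also have "\<dots> \<le> L2_set (\<lambda>k. cmod (a k)) F + L2_set (\<lambda>k. cmod (b k)) F"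
      by (rule L2_set_triangle_ineq)
    also have "\<dots> \<le> l2_norm a + l2_norm b"
      by (intro add_mono L2_set_le_l2_norm assms)
    finally show ?thesis .
  qed
  then show "square_summable (\<lambda>k. a k + b k)" "l2_norm (\<lambda>k. a k + b k) \<le> l2_norm a + l2_norm b"
    by (auto intro: square_summableI)
qed

lemma square_summable_cmult:
  assumes "square_summable a"
  shows "square_summable (\<lambda>k. c * a k)"
  using assms unfolding square_summable_def
  by (auto simp: norm_mult power_mult_distrib intro!: summable_on_cmult_right)

lemma l2_norm_cmult: "l2_norm (\<lambda>k. c * a k) = cmod c * l2_norm a"
  unfolding l2_norm_def
  by (simp add: norm_mult power_mult_distrib infsum_cmult_right' real_sqrt_mult)

lemma square_summable_uminus: "square_summable a \<Longrightarrow> square_summable (\<lambda>k. - a k)"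
  by (simp add: square_summable_def)

lemma square_summable_diff:
  assumes "square_summable a" "square_summable b"
  shows "square_summable (\<lambda>k. a k - b k)" 
  using square_summable_add(1)[OF assms(1) square_summable_uminus[OF assms(2)]] by simp

lemma l2_inner_summable_norm:
  assumes "square_summable a" "square_summable b"
  shows "(\<lambda>k. cmod (a k) * cmod (b k)) summable_on UNIV"
    and "(\<Sum>\<^sub>\<infinity>k. cmod (a k) * cmod (b k)) \<le> l2_norm a * l2_norm b"
proof -
  have b: "(\<Sum>k\<in>F. cmod (a k) * cmod (b k)) \<le> l2_norm a * l2_norm b" if "finite F" for F
  proof -
    have "(\<Sum>k\<in>F. cmod (a k) * cmod (b k)) \<le> L2_set (\<lambda>k. cmod (a k)) F * L2_set (\<lambda>k. cmod (b k)) F"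
      using L2_set_mult_ineq[of "\<lambda>k. cmod (a k)" "\<lambda>k. cmod (b k)" F] by simp
    also have "\<dots> \<le> l2_norm a * l2_norm b"
      by (intro mult_mono L2_set_le_l2_norm assms l2_norm_nonneg L2_set_nonneg)
    finally show ?thesis .
  qed
  show s: "(\<lambda>k. cmod (a k) * cmod (b k)) summable_on UNIV"
    by (rule nonneg_bdd_above_summable_on) (auto intro!: bdd_aboveI[of _ "l2_norm a * l2_norm b"] b)
  show "(\<Sum>\<^sub>\<infinity>k. cmod (a k) * cmod (b k)) \<le> l2_norm a * l2_norm b"
    using s b by (intro infsum_le_finite_sums) auto
qed

lemma l2_inner_summable:
  assumes "square_summable a" "square_summable b"
  shows "(\<lambda>k. a k * cnj (b k)) summable_on UNIV"
  using l2_inner_summable_norm(1)[OF assms]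
  by - (rule abs_summable_summable, simp add: norm_mult)

lemma l2_inner_bound:
  assumes "square_summable a" "square_summable b"
  shows "cmod (l2_inner a b) \<le> l2_norm a * l2_norm b"
proof -
  have "cmod (l2_inner a b) \<le> (\<Sum>\<^sub>\<infinity>k. cmod (a k * cnj (b k)))"
    unfolding l2_inner_def using l2_inner_summable_norm(1)[OF assms]
    by (intro norm_infsum_bound) (simp add: norm_mult)
  then show ?thesis using l2_inner_summable_norm(2)[OF assms] by (simp add: norm_mult)
qed

lemma l2_inner_add_left:
  assumes "square_summable a" "square_summable b" "square_summable c"
  shows "l2_inner (\<lambda>k. a k + b k) c = l2_inner a c + l2_inner b c"
  unfolding l2_inner_def
  using infsum_add[OF l2_inner_summable[OF assms(1,3)] l2_inner_summable[OF assms(2,3)]]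
  by (simp add: algebra_simps)

lemma l2_inner_cmult_left: "l2_inner (\<lambda>k. c * a k) b = c * l2_inner a b"
  unfolding l2_inner_def by (simp add: mult.assoc infsum_cmult_right')

lemma l2_inner_cnj: "l2_inner a b = cnj (l2_inner b a)"
  unfolding l2_inner_def by (simp add: mult.commute flip: infsum_cnj)

lemma l2_inner_self: "l2_inner a a = of_real ((l2_norm a)\<^sup>2)"
proof -
  have "l2_inner a a = (\<Sum>\<^sub>\<infinity>k. of_real ((cmod (a k))\<^sup>2))"
    unfolding l2_inner_def by (simp only: complex_norm_square)
  also have "\<dots> = of_real ((l2_norm a)\<^sup>2)"
    unfolding l2_norm_sq
    by (rule infsum_bounded_linear_strong[OF _ bounded_linear_of_real])
      (rule summable_on_bounded_linear_iff[OF bounded_linear_of_real bounded_linear_Re], simp)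
  finally show ?thesis .
qed

lemma cmod_le_l2_norm: "square_summable a \<Longrightarrow> cmod (a k) \<le> l2_norm a"
  using L2_set_le_l2_norm[of a "{k}"] by simp

lemma l2_norm_eq_0: "square_summable a \<Longrightarrow> l2_norm a = 0 \<Longrightarrow> a k = 0"
  using cmod_le_l2_norm[of a k] by simp

section \<open>Absolutely convergent power series on the bidisk\<close>

text \<open>Absolute convergence on the open bidisk. The class is closed under Cauchy products and
  contains multipliers such as 1 / (z - \<nu>) with |\<nu>| = 1, whose coefficients are bounded but
  not square-summable.\<close>

definition disk_summable :: "(nat \<times> nat \<Rightarrow> complex) \<Rightarrow> bool" where
  "disk_summable a \<longleftrightarrow> (\<forall>r. 0 \<le> r \<and> r < 1 \<longrightarrow> (\<lambda>(m, n). cmod (a (m, n)) * r ^ (m + n)) summable_on UNIV)"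

definition cauchy_prod ::
  "(nat \<times> nat \<Rightarrow> complex) \<Rightarrow> (nat \<times> nat \<Rightarrow> complex) \<Rightarrow> nat \<times> nat \<Rightarrow> complex" where
  "cauchy_prod a b = (\<lambda>(m, n). \<Sum>i\<le>m. \<Sum>j\<le>n. a (i, j) * b (m - i, n - j))"

lemma summable_on_norm_product:
  fixes f :: "'a \<Rightarrow> complex" and g :: "'b \<Rightarrow> complex"
  assumes "(\<lambda>x. cmod (f x)) summable_on A" "(\<lambda>x. cmod (g x)) summable_on B"
  shows "(\<lambda>(x, y). cmod (f x * g y)) summable_on A \<times> B"
proof (rule summable_on_SigmaI)
  show "((\<lambda>y. case (x, y) of (x, y) \<Rightarrow> cmod (f x * g y)) has_sum cmod (f x) * (\<Sum>\<^sub>\<infinity>y\<in>B. cmod (g y))) B" for x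
    using has_sum_cmult_right[OF has_sum_infsum[OF assms(2)]] by (simp add: norm_mult)
  show "(\<lambda>x. cmod (f x) * (\<Sum>\<^sub>\<infinity>y\<in>B. cmod (g y))) summable_on A"
    using assms(1) by (rule summable_on_cmult_left)
qed auto

lemma geometric2_summable:
  fixes x y :: complex
  assumes "cmod x < 1" "cmod y < 1"
  shows "(\<lambda>(m, n). cmod (x ^ m * y ^ n)) summable_on UNIV"
proof -
  have "(\<lambda>n. cmod (x ^ n)) summable_on UNIV" if "cmod x < 1" for x :: complex
    using that by (intro summable_nonneg_imp_summable_on) (simp_all add: norm_power summable_geometric)
  then have "(\<lambda>(m, n). cmod (x ^ m * y ^ n)) summable_on UNIV \<times> UNIV"
    using assms by (intro summable_on_norm_product) auto
  then show ?thesis by (simp add: case_prod_unfold)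
qed

lemma disk_summable_of_bounded:
  assumes "\<And>k. cmod (a k) \<le> M"
  shows "disk_summable a"
  unfolding disk_summable_def
proof (intro allI impI)
  fix r :: real assume r: "0 \<le> r \<and> r < 1"
  have "(\<lambda>(m, n). M * cmod (of_real r ^ m * of_real r ^ n :: complex)) summable_on UNIV"
    using summable_on_cmult_right[OF geometric2_summable[of "of_real r" "of_real r"], of M] r
    by (simp add: case_prod_unfold)
  then show "(\<lambda>(m, n). cmod (a (m, n)) * r ^ (m + n)) summable_on UNIV"
  proof (rule summable_on_comparison_test)
    fix k :: "nat \<times> nat"
    obtain m n where k: "k = (m, n)" by force
    show "(case k of (m, n) \<Rightarrow> cmod (a (m, n)) * r ^ (m + n))
      \<le> (case k of (m, n) \<Rightarrow> M * cmod (of_real r ^ m * of_real r ^ n :: complex))"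
      using assms[of "(m, n)"] r
      by (simp add: k norm_mult norm_power power_add mult_right_mono)
    show "0 \<le> (case k of (m, n) \<Rightarrow> cmod (a (m, n)) * r ^ (m + n))" using r by (simp add: k)
  qed
qed

lemma disk_summable_l2: "square_summable a \<Longrightarrow> disk_summable a"
  using disk_summable_of_bounded cmod_le_l2_norm by blast

lemma disk_summableD:
  assumes "disk_summable a" "cmod z < 1" "cmod w < 1"
  shows "(\<lambda>(m, n). cmod (a (m, n) * z ^ m * w ^ n)) summable_on UNIV"
proof -
  define r where "r = max (cmod z) (cmod w)"
  have r: "0 \<le> r" "r < 1" "cmod z \<le> r" "cmod w \<le> r" using assms by (auto simp: r_def le_max_iff_disj)
  have "(\<lambda>(m, n). cmod (a (m, n)) * r ^ (m + n)) summable_on UNIV"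
    using assms(1) r by (auto simp: disk_summable_def)
  then show ?thesis
  proof (rule summable_on_comparison_test)
    fix k :: "nat \<times> nat"
    obtain m n where k: "k = (m, n)" by force
    have "cmod z ^ m * cmod w ^ n \<le> r ^ m * r ^ n"
      using r by (intro mult_mono power_mono) auto
    then show "(case k of (m, n) \<Rightarrow> cmod (a (m, n) * z ^ m * w ^ n))
       \<le> (case k of (m, n) \<Rightarrow> cmod (a (m, n)) * r ^ (m + n))"
      by (simp add: k norm_mult norm_power power_add mult.assoc mult_left_mono)
  qed (auto simp: case_prod_unfold)
qed

lemma power_series2_eq:
  assumes "(z, w) \<in> bidisk"
  shows "power_series2 a (z, w) = (\<Sum>\<^sub>\<infinity>(m, n)\<in>UNIV. a (m, n) * z ^ m * w ^ n)"
  using assms by (simp add: power_series2_def)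

lemma mem_bidisk [simp]: "(z, w) \<in> bidisk \<longleftrightarrow> cmod z < 1 \<and> cmod w < 1"
  by (simp add: bidisk_def)

lemma power_series2_outside: "x \<notin> bidisk \<Longrightarrow> power_series2 a x = 0"
  by (auto simp: power_series2_def split: prod.splits simp del: mem_bidisk)

lemma power_series2_has_sum:
  assumes "disk_summable a" "cmod z < 1" "cmod w < 1"
  shows "((\<lambda>(m, n). a (m, n) * z ^ m * w ^ n) has_sum power_series2 a (z, w)) UNIV"
proof -
  have "(\<lambda>(m, n). a (m, n) * z ^ m * w ^ n) summable_on UNIV"
    using disk_summableD[OF assms] by - (rule abs_summable_summable, simp add: case_prod_unfold)
  then show ?thesis using assms by (simp add: power_series2_eq)
qed

lemma power_series2I:
  assumes "cmod z < 1" "cmod w < 1" "((\<lambda>(m, n). a (m, n) * z ^ m * w ^ n) has_sum s) UNIV"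
  shows "power_series2 a (z, w) = s"
  using assms infsumI by (simp add: power_series2_eq)

lemma disk_summable_add:
  assumes "disk_summable a" "disk_summable b"
  shows "disk_summable (\<lambda>k. a k + b k)"
  unfolding disk_summable_def
proof (intro allI impI)
  fix r :: real assume r: "0 \<le> r \<and> r < 1"
  have "(\<lambda>k. (case k of (m, n) \<Rightarrow> cmod (a (m, n)) * r ^ (m + n)) + (case k of (m, n) \<Rightarrow> cmod (b (m, n)) * r ^ (m + n))) summable_on UNIV"
    using assms r by (intro summable_on_add) (auto simp: disk_summable_def)
  then show "(\<lambda>(m, n). cmod (a (m, n) + b (m, n)) * r ^ (m + n)) summable_on UNIV"
  proof (rule summable_on_comparison_test)
    fix k :: "nat \<times> nat" obtain m n where k: "k = (m, n)" by force
    have "cmod (a k + b k) * r ^ (m + n) \<le> (cmod (a k) + cmod (b k)) * r ^ (m + n)"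
      using r by (intro mult_right_mono norm_triangle_ineq) auto
    then show "(case k of (m, n) \<Rightarrow> cmod (a (m, n) + b (m, n)) * r ^ (m + n))
      \<le> (case k of (m, n) \<Rightarrow> cmod (a (m, n)) * r ^ (m + n)) + (case k of (m, n) \<Rightarrow> cmod (b (m, n)) * r ^ (m + n))"
      by (simp add: k distrib_right)
  qed (use r in \<open>auto simp: case_prod_unfold\<close>)
qed

lemma disk_summable_cmult:
  assumes "disk_summable a"
  shows "disk_summable (\<lambda>k. c * a k)"
  unfolding disk_summable_def
proof (intro allI impI)
  fix r :: real assume "0 \<le> r \<and> r < 1"
  then have "(\<lambda>x. cmod c * (case x of (m, n) \<Rightarrow> cmod (a (m, n)) * r ^ (m + n))) summable_on UNIV"
    using assms by (intro summable_on_cmult_right) (auto simp: disk_summable_def)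
  then show "(\<lambda>(m, n). cmod (c * a (m, n)) * r ^ (m + n)) summable_on UNIV"
    by (simp add: norm_mult mult.assoc case_prod_unfold)
qed

lemma bidisk_ext:
  assumes "\<And>x. x \<notin> bidisk \<Longrightarrow> f x = g x" "\<And>z w. cmod z < 1 \<Longrightarrow> cmod w < 1 \<Longrightarrow> f (z, w) = g (z, w)"
  shows "f = g"
proof
  fix x show "f x = g x"
    using assms by (cases "x \<in> bidisk"; cases x) auto
qed

lemma power_series2_add:
  assumes "disk_summable a" "disk_summable b"
  shows "power_series2 (\<lambda>k. a k + b k) = (\<lambda>x. power_series2 a x + power_series2 b x)"
proof (rule bidisk_ext)
  fix z w :: complex assume zw: "cmod z < 1" "cmod w < 1"
  show "power_series2 (\<lambda>k. a k + b k) (z, w) = power_series2 a (z, w) + power_series2 b (z, w)"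
    using has_sum_add[OF power_series2_has_sum[OF assms(1) zw] power_series2_has_sum[OF assms(2) zw]]
    by (intro power_series2I zw) (auto simp: case_prod_unfold algebra_simps)
qed (simp add: power_series2_outside)

lemma power_series2_cmult:
  "power_series2 (\<lambda>k. c * a k) = (\<lambda>x. c * power_series2 a x)"
  by (auto simp: power_series2_def fun_eq_iff case_prod_unfold mult.assoc infsum_cmult_right')

text \<open>The map sending (k, l) to (k + l, k) carries the set of all pairs of indices to a family
  of finite blocks, one for each total index. Absolute convergence of the double sum permits summing
  block by block, and each block is one term of the product series.\<close>

lemma cauchy_prod_has_sum:
  fixes z w :: complex
  assumes "disk_summable a" "disk_summable b" and zw: "cmod z < 1" "cmod w < 1"
  defines "A \<equiv> (\<lambda>(m, n). a (m, n) * z ^ m * w ^ n)" and "B \<equiv> (\<lambda>(m, n). b (m, n) * z ^ m * w ^ n)"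
  shows "(\<lambda>k. \<Sum>l\<in>{..fst k}\<times>{..snd k}. cmod (A l * B (fst k - fst l, snd k - snd l))) summable_on UNIV"
    and "((\<lambda>k. \<Sum>l\<in>{..fst k}\<times>{..snd k}. A l * B (fst k - fst l, snd k - snd l))
           has_sum power_series2 a (z, w) * power_series2 b (z, w)) UNIV"
proof -
  let ?S = "SIGMA k:(UNIV :: (nat \<times> nat) set). {..fst k}\<times>{..snd k}"
  let ?g = "\<lambda>(k, l). A l * B (fst k - fst l, snd k - snd l)"
  have AB: "(\<lambda>x. norm (case x of (k, l) \<Rightarrow> A k * B l)) summable_on UNIV \<times> UNIV"
    using disk_summableD[OF assms(1) zw] disk_summableD[OF assms(2) zw]
    using summable_on_norm_product[of A UNIV B UNIV] by (simp add: A_def B_def case_prod_unfold)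
  have bij: "bij_betw (\<lambda>(k, l). ((fst k + fst l, snd k + snd l), k)) (UNIV \<times> UNIV) ?S"
    by (rule bij_betwI[where g = "\<lambda>(k, l). (l, (fst k - fst l, snd k - snd l))"]) auto
  have re: "(\<lambda>x. ?g ((\<lambda>(k, l). ((fst k + fst l, snd k + snd l), k)) x)) = (\<lambda>(k, l). A k * B l)"
    by auto
  have abs: "(\<lambda>x. cmod (?g x)) summable_on ?S"
    using summable_on_reindex_bij_betw[OF bij, of "\<lambda>x. cmod (?g x)"] AB
    by (simp only: re[THEN fun_cong])
  show "(\<lambda>k. \<Sum>l\<in>{..fst k}\<times>{..snd k}. cmod (A l * B (fst k - fst l, snd k - snd l))) summable_on UNIV"
    using summable_on_Sigma_banach[of "\<lambda>k l. cmod (A l * B (fst k - fst l, snd k - snd l))" UNIV "\<lambda>k. {..fst k}\<times>{..snd k}"] abs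
    by (simp add: case_prod_unfold)
  have "((\<lambda>(k, l). A k * B l) has_sum power_series2 a (z, w) * power_series2 b (z, w)) (UNIV \<times> UNIV)"
  proof -
    have hA: "(A has_sum power_series2 a (z, w)) UNIV" unfolding A_def
      by (rule power_series2_has_sum[OF assms(1) zw])
    have hB: "(B has_sum power_series2 b (z, w)) UNIV" unfolding B_def
      by (rule power_series2_has_sum[OF assms(2) zw])
    show ?thesis
    proof (rule has_sum_SigmaI[where g = "\<lambda>k. A k * power_series2 b (z, w)"])
      show "((\<lambda>l. case (k, l) of (k, l) \<Rightarrow> A k * B l) has_sum A k * power_series2 b (z, w)) UNIV" for k
        using has_sum_cmult_right[OF hB] by simp
      show "((\<lambda>k. A k * power_series2 b (z, w)) has_sum power_series2 a (z, w) * power_series2 b (z, w)) UNIV"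
        by (rule has_sum_cmult_left[OF hA])
      show "(\<lambda>(k, l). A k * B l) summable_on UNIV \<times> UNIV"
        using AB by (rule abs_summable_summable)
    qed
  qed
  then have "(?g has_sum power_series2 a (z, w) * power_series2 b (z, w)) ?S"
    using has_sum_reindex_bij_betw[OF bij, of ?g] by (simp only: re[THEN fun_cong])
  then show "((\<lambda>k. \<Sum>l\<in>{..fst k}\<times>{..snd k}. A l * B (fst k - fst l, snd k - snd l))
           has_sum power_series2 a (z, w) * power_series2 b (z, w)) UNIV"
    by (rule has_sum_SigmaD) (auto intro!: has_sum_finiteI)
qed

lemma cauchy_prod_term:
  fixes z w :: complex
  shows "cauchy_prod a b (m, n) * z ^ m * w ^ n =
    (\<Sum>l\<in>{..m}\<times>{..n}. (a l * z ^ fst l * w ^ snd l) *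
       (b (m - fst l, n - snd l) * z ^ (m - fst l) * w ^ (n - snd l)))"
proof -
  have e: "z ^ fst l * z ^ (m - fst l) = z ^ m" "w ^ snd l * w ^ (n - snd l) = w ^ n" 
    if "l \<in> {..m}\<times>{..n}" for l
    using that by (auto simp flip: power_add)
  have "cauchy_prod a b (m, n) * z ^ m * w ^ n 
    = (\<Sum>l\<in>{..m}\<times>{..n}. a l * b (m - fst l, n - snd l) * z ^ m * w ^ n)"
    by (simp add: cauchy_prod_def sum.cartesian_product case_prod_unfold sum_distrib_right)
  also have "\<dots> = (\<Sum>l\<in>{..m}\<times>{..n}. (a l * z ^ fst l * w ^ snd l) *
       (b (m - fst l, n - snd l) * z ^ (m - fst l) * w ^ (n - snd l)))"
    by (intro sum.cong refl, subst e(1)[symmetric], assumption, subst e(2)[symmetric], assumption)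
      (simp add: mult_ac)
  finally show ?thesis .
qed

lemma disk_summable_cauchy_prod:
  assumes "disk_summable a" "disk_summable b"
  shows "disk_summable (cauchy_prod a b)"
  unfolding disk_summable_def
proof (intro allI impI)
  fix r :: real assume r: "0 \<le> r \<and> r < 1"
  then have "cmod (of_real r) < 1" by simp
  from cauchy_prod_has_sum(1)[OF assms this this]
  show "(\<lambda>(m, n). cmod (cauchy_prod a b (m, n)) * r ^ (m + n)) summable_on UNIV"
  proof (rule summable_on_comparison_test)
    fix k :: "nat \<times> nat" obtain m n where k: "k = (m, n)" by force
    have "cmod (cauchy_prod a b (m, n)) * r ^ (m + n) = cmod (cauchy_prod a b (m, n) * of_real r ^ m * of_real r ^ n)"
      using r by (simp add: norm_mult norm_power power_add)
    then show "(case k of (m, n) \<Rightarrow> cmod (cauchy_prod a b (m, n)) * r ^ (m + n)) \<le> 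
       (\<Sum>l\<in>{..fst k}\<times>{..snd k}. cmod ((case l of (m, n) \<Rightarrow> a (m, n) * complex_of_real r ^ m * complex_of_real r ^ n) *
          (case (fst k - fst l, snd k - snd l) of (m, n) \<Rightarrow> b (m, n) * complex_of_real r ^ m * complex_of_real r ^ n)))"
      unfolding k cauchy_prod_term by (simp add: case_prod_unfold sum_norm_le)
    show "0 \<le> (case k of (m, n) \<Rightarrow> cmod (cauchy_prod a b (m, n)) * r ^ (m + n))"
      using r by (simp add: k)
  qed
qed

lemma power_series2_cauchy_prod:
  assumes "disk_summable a" "disk_summable b"
  shows "power_series2 (cauchy_prod a b) = (\<lambda>x. power_series2 a x * power_series2 b x)"
proof (rule bidisk_ext)
  fix z w :: complex assume zw: "cmod z < 1" "cmod w < 1"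
  show "power_series2 (cauchy_prod a b) (z, w) = power_series2 a (z, w) * power_series2 b (z, w)"
    by (rule power_series2I[OF zw], rule has_sum_cong[THEN iffD1, OF _ cauchy_prod_has_sum(2)[OF assms zw]])
      (auto simp: cauchy_prod_term case_prod_unfold)
qed (simp add: power_series2_outside)

section \<open>Fourier series on the torus\<close>

text \<open>Lebesgue measure is left unnormalised, in accordance with the null sets in
  \<open>inner_function\<close>; this is the origin of the factor \<open>4 * pi\<^sup>2\<close> in
  the Parseval identities.\<close>

definition torus :: "(real \<times> real) measure" where
  "torus = restrict_space lborel ({0..2 * pi} \<times> {0..2 * pi})"

definition character :: "nat \<times> nat \<Rightarrow> real \<times> real \<Rightarrow> complex" where
  "character k x = cis (real (fst k) * fst x + real (snd k) * snd x)"

definition trig_sum :: "(nat \<times> nat \<Rightarrow> complex) \<Rightarrow> real \<times> real \<Rightarrow> complex" where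
  "trig_sum c x = (\<Sum>\<^sub>\<infinity>k. c k * character k x)"

text \<open>Replaces the net of finite index sets by a sequence, as the limit theorems for integrals
  and for measurable functions are sequential. A box contains with each index all smaller ones, so
  it is compatible with Cauchy products.\<close>

definition nat_box :: "nat \<Rightarrow> (nat \<times> nat) set" where
  "nat_box N = {..N} \<times> {..N}"

lemma finite_nat_box [simp]: "finite (nat_box N)"
  by (simp add: nat_box_def)

lemma subset_nat_box: "finite F \<Longrightarrow> \<exists>N. F \<subseteq> nat_box N"
proof -
  assume F: "finite F"
  obtain N where "\<forall>k\<in>F. fst k + snd k \<le> N"
    using F finite_nat_set_iff_bounded_le[of "(\<lambda>k. fst k + snd k) ` F"] by auto
  then have "F \<subseteq> nat_box N" by (force simp: nat_box_def)
  then show ?thesis ..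
qed

lemma nat_box_mono: "M \<le> N \<Longrightarrow> nat_box M \<subseteq> nat_box N"
  by (auto simp: nat_box_def)

lemma sum_nat_box_tendsto:
  assumes "(f has_sum s) UNIV"
  shows "(\<lambda>N. sum f (nat_box N)) \<longlonglongrightarrow> s"
proof -
  have "filterlim nat_box (finite_subsets_at_top UNIV) sequentially"
    unfolding filterlim_finite_subsets_at_top
  proof (intro allI impI)
    fix X :: "(nat \<times> nat) set" assume "finite X \<and> X \<subseteq> UNIV"
    then obtain M where "X \<subseteq> nat_box M" using subset_nat_box by blast
    then show "\<forall>\<^sub>F N in sequentially. finite (nat_box N) \<and> X \<subseteq> nat_box N \<and> nat_box N \<subseteq> UNIV"
      using nat_box_mono by (intro eventually_sequentiallyI[of M]) (auto dest: subset_trans)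
  qed
  then show ?thesis using assms unfolding has_sum_def by (rule filterlim_compose[rotated])
qed

lemma space_torus: "space torus = {0..2 * pi} \<times> {0..2 * pi}"
  by (simp add: torus_def space_restrict_space)

lemma closed_square: "closed ({0..2 * pi} \<times> {0..2 * pi} :: (real \<times> real) set)"
  by (intro closed_Times) auto

lemma sets_square [measurable]: "{0..2 * pi} \<times> {0..2 * pi} \<in> sets (borel :: (real \<times> real) measure)"
  using closed_square by (rule borel_closed)

lemma finite_measure_torus: "finite_measure torus"
proof
  have "emeasure lborel ({0..2 * pi} \<times> {0..2 * pi} :: (real \<times> real) set) < \<infinity>"
    by (intro emeasure_bounded_finite bounded_Times) auto
  then show "emeasure torus (space torus) \<noteq> \<infinity>"
    unfolding space_torus by (simp add: torus_def emeasure_restrict_space)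
qed

lemma measurable_torusI: "f \<in> borel_measurable borel \<Longrightarrow> f \<in> borel_measurable torus"
  unfolding torus_def by (rule measurable_restrict_space1) simp

lemma continuous_measurable_torus: "continuous_on UNIV f \<Longrightarrow> f \<in> borel_measurable torus"
  by (intro measurable_torusI borel_measurable_continuous_onI)

lemma integrable_torusI:
  fixes f :: "real \<times> real \<Rightarrow> 'b :: {banach, second_countable_topology}"
  assumes "f \<in> borel_measurable torus" "\<And>x. norm (f x) \<le> B"
  shows "integrable torus f"
  using finite_measure.integrable_const_bound[OF finite_measure_torus, of f B] assms by auto

lemma continuous_character: "continuous_on UNIV (character k)"
  unfolding character_def[abs_def] by (intro continuous_intros)

lemma norm_character [simp]: "cmod (character k x) = 1"
  by (simp add: character_def)

lemma integral_cis_period: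
  fixes k :: int
  shows "(LINT x|lborel. indicator {0..2 * pi} x *\<^sub>R cis (of_int k * x)) = (if k = 0 then 2 * of_real pi else 0)"
proof (cases "k = 0")
  case True
  then show ?thesis by (simp add: scaleR_conv_of_real)
next
  case False
  have "(LINT x|lborel. indicator {0..2 * pi} x *\<^sub>R cis (of_int k * x))
    = cis (of_int k * (2 * pi)) / (\<i> * of_int k) - cis (of_int k * 0) / (\<i> * of_int k)"
  proof (rule integral_FTC_atLeastAtMost)
    show "((\<lambda>x. cis (of_int k * x) / (\<i> * of_int k)) has_vector_derivative cis (of_int k * x)) (at x within {0..2 * pi})" for x
    proof -
      have "((\<lambda>z. exp (\<i> * of_int k * z) / (\<i> * of_int k)) has_field_derivative exp (\<i> * of_int k * of_real x)) (at (of_real x))"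
        using False by (auto intro!: derivative_eq_intros)
      from has_vector_derivative_real_field[OF this] show ?thesis
        by (simp add: cis_conv_exp mult_ac)
    qed
  qed (auto intro!: continuous_intros)
  also have "cis (of_int k * (2 * pi)) = 1"
    by (metis Ints_of_int cis_multiple_2pi mult.commute)
  finally show ?thesis using False by simp
qed

lemma integral_torus_prod:
  fixes f g :: "real \<Rightarrow> complex"
  assumes c: "continuous_on UNIV f" "continuous_on UNIV g"
  shows "(LINT x|torus. f (fst x) * g (snd x)) =
    (LINT x|lborel. indicator {0..2 * pi} x *\<^sub>R f x) * (LINT x|lborel. indicator {0..2 * pi} x *\<^sub>R g x)"
proof -
  let ?h = "\<lambda>x::real\<times>real. indicator ({0..2 * pi} \<times> {0..2 * pi}) x *\<^sub>R (f (fst x) * g (snd x))"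
  have cont: "continuous_on UNIV (\<lambda>x::real\<times>real. f (fst x) * g (snd x))"
    using c by (intro continuous_intros continuous_on_compose2[OF c(1)] continuous_on_compose2[OF c(2)]) auto
  have "integrable lborel ?h"
    by (intro borel_integrable_compact compact_Times continuous_on_subset[OF cont]) auto
  then have int: "integrable (lborel \<Otimes>\<^sub>M lborel) ?h" by (simp add: lborel_prod)
  have "(LINT x|torus. f (fst x) * g (snd x)) = (LINT x|lborel. ?h x)"
    unfolding torus_def by (subst integral_restrict_space) auto
  also have "\<dots> = (LINT x|(lborel \<Otimes>\<^sub>M lborel). ?h x)" by (simp add: lborel_prod)
  also have "\<dots> = (LINT s|lborel. (LINT t|lborel. ?h (s, t)))"
    by (rule lborel_pair.integral_fst'[OF int, symmetric])
  also have "\<dots> = (LINT s|lborel. (LINT t|lborel. (indicator {0..2 * pi} s *\<^sub>R f s) * (indicator {0..2 * pi} t *\<^sub>R g t)))"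
    by (intro Bochner_Integration.integral_cong refl) (auto simp: indicator_def)
  also have "\<dots> = (LINT s|lborel. (indicator {0..2 * pi} s *\<^sub>R f s) * (LINT t|lborel. indicator {0..2 * pi} t *\<^sub>R g t))"
    by (simp only: integral_mult_right_zero)
  finally show ?thesis by (simp only: integral_mult_left_zero)
qed

lemma character_orthogonal:
  "(LINT x|torus. character k x * cnj (character l x)) = (if k = l then 4 * of_real pi ^ 2 else 0)"
proof -
  have "(LINT x|torus. character k x * cnj (character l x)) =
    (LINT x|torus. cis (of_int (int (fst k) - int (fst l)) * fst x) * cis (of_int (int (snd k) - int (snd l)) * snd x))"
    by (intro Bochner_Integration.integral_cong refl)
      (simp add: character_def cis_cnj cis_mult algebra_simps)
  also have "\<dots> = (if k = l then 4 * of_real pi ^ 2 else 0)"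
    by (subst integral_torus_prod)
      (auto intro!: continuous_intros simp: integral_cis_period[of "int (fst k) - int (fst l)", simplified] integral_cis_period[of "int (snd k) - int (snd l)", simplified] prod_eq_iff power2_eq_square)
  finally show ?thesis .
qed

lemma parseval_finite:
  assumes F: "finite F"
  shows "(LINT x|torus. (cmod (\<Sum>k\<in>F. c k * character k x))\<^sup>2) = 4 * pi\<^sup>2 * (\<Sum>k\<in>F. (cmod (c k))\<^sup>2)"
proof -
  have int: "integrable torus (\<lambda>x. c k * cnj (c l) * (character k x * cnj (character l x)))" for k l
    by (rule integrable_torusI[where B = "cmod (c k) * cmod (c l)"])
      (auto intro!: continuous_measurable_torus continuous_intros continuous_character simp: norm_mult)
  have "of_real (LINT x|torus. (cmod (\<Sum>k\<in>F. c k * character k x))\<^sup>2)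
     = (LINT x|torus. (\<Sum>k\<in>F. c k * character k x) * cnj (\<Sum>k\<in>F. c k * character k x))"
    unfolding complex_norm_square[symmetric] by (rule integral_complex_of_real[symmetric])
  also have "\<dots> = (LINT x|torus. (\<Sum>k\<in>F. \<Sum>l\<in>F. c k * cnj (c l) * (character k x * cnj (character l x))))"
    by (simp add: sum_product mult_ac)
  also have "\<dots> = (\<Sum>k\<in>F. \<Sum>l\<in>F. c k * cnj (c l) * (LINT x|torus. character k x * cnj (character l x)))"
    using int by (simp add: Bochner_Integration.integral_sum)
  also have "\<dots> = (\<Sum>k\<in>F. c k * cnj (c k) * (4 * of_real pi ^ 2))"
    using F by (simp add: character_orthogonal if_distrib sum.delta cong: if_cong)
  also have "\<dots> = of_real (4 * pi\<^sup>2 * (\<Sum>k\<in>F. (cmod (c k))\<^sup>2))"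
    by (simp add: sum_distrib_left mult_ac flip: complex_norm_square)
  finally show ?thesis by (simp only: of_real_eq_iff)
qed

section \<open>Parseval's identity for absolutely convergent Fourier series\<close>

lemma trig_sum_has_sum:
  assumes "(\<lambda>k. cmod (c k)) summable_on UNIV"
  shows "((\<lambda>k. c k * character k x) has_sum trig_sum c x) UNIV"
  unfolding trig_sum_def 
proof (rule has_sum_infsum, rule abs_summable_summable)
  show "(\<lambda>k. cmod (c k * character k x)) summable_on UNIV" using assms by (simp add: norm_mult)
qed

lemma sum_nat_box_bound:
  assumes "(\<lambda>k. cmod (c k)) summable_on UNIV"
  shows "cmod (\<Sum>k\<in>nat_box N. c k * character k x) \<le> (\<Sum>\<^sub>\<infinity>k. cmod (c k))"
proof -
  have "cmod (\<Sum>k\<in>nat_box N. c k * character k x) \<le> (\<Sum>k\<in>nat_box N. cmod (c k))"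
    by (rule order_trans[OF norm_sum]) (simp add: norm_mult)
  also have "\<dots> \<le> (\<Sum>\<^sub>\<infinity>k. cmod (c k))"
    using assms by (intro finite_sum_le_infsum) auto
  finally show ?thesis .
qed

lemma trig_sum_bound:
  assumes "(\<lambda>k. cmod (c k)) summable_on UNIV"
  shows "cmod (trig_sum c x) \<le> (\<Sum>\<^sub>\<infinity>k. cmod (c k))"
  by (rule LIMSEQ_le_const2[OF tendsto_norm[OF sum_nat_box_tendsto[OF trig_sum_has_sum[OF assms]]]])
    (use sum_nat_box_bound[OF assms] in auto)

lemma trig_sum_measurable [measurable]:
  assumes "(\<lambda>k. cmod (c k)) summable_on UNIV"
  shows "trig_sum c \<in> borel_measurable torus"
proof (rule borel_measurable_LIMSEQ_metric)
  show "(\<lambda>N. \<Sum>k\<in>nat_box N. c k * character k x) \<longlonglongrightarrow> trig_sum c x" for x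
    by (rule sum_nat_box_tendsto[OF trig_sum_has_sum[OF assms]])
qed (auto intro!: continuous_measurable_torus continuous_intros continuous_character)

lemma square_summable_l1:
  assumes "(\<lambda>k. cmod (c k)) summable_on UNIV"
  shows "square_summable c"
proof (rule square_summableI[of c "\<Sum>\<^sub>\<infinity>k. cmod (c k)"])
  fix F :: "(nat \<times> nat) set" assume F: "finite F"
  have "L2_set (\<lambda>k. cmod (c k)) F \<le> (\<Sum>k\<in>F. cmod (c k))"
    by (rule L2_set_le_sum) simp
  also have "\<dots> \<le> (\<Sum>\<^sub>\<infinity>k. cmod (c k))"
    using assms F by (intro finite_sum_le_infsum) auto
  finally show "L2_set (\<lambda>k. cmod (c k)) F \<le> (\<Sum>\<^sub>\<infinity>k. cmod (c k))" .
qed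

lemma integrable_trig_sum_sq:
  assumes "(\<lambda>k. cmod (c k)) summable_on UNIV"
  shows "integrable torus (\<lambda>x. (cmod (trig_sum c x))\<^sup>2)"
  using trig_sum_measurable[OF assms] trig_sum_bound[OF assms]
  by (intro integrable_torusI[where B = "(\<Sum>\<^sub>\<infinity>k. cmod (c k))\<^sup>2"]) (auto intro!: power_mono)

text \<open>Dominated convergence: the partial sums over boxes are bounded by the sum of the moduli
  of the coefficients, a constant, which is integrable because the torus has finite measure.\<close>

lemma parseval:
  assumes "(\<lambda>k. cmod (c k)) summable_on UNIV"
  shows "(LINT x|torus. (cmod (trig_sum c x))\<^sup>2) = 4 * pi\<^sup>2 * (l2_norm c)\<^sup>2"
proof -
  let ?U = "\<lambda>N x. \<Sum>k\<in>nat_box N. c k * character k x"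
  let ?S = "\<Sum>\<^sub>\<infinity>k. cmod (c k)"
  have "(\<lambda>N. LINT x|torus. (cmod (?U N x))\<^sup>2) \<longlonglongrightarrow> (LINT x|torus. (cmod (trig_sum c x))\<^sup>2)"
  proof (rule integral_dominated_convergence[where w = "\<lambda>_. ?S\<^sup>2"])
    show "AE x in torus. (\<lambda>N. (cmod (?U N x))\<^sup>2) \<longlonglongrightarrow> (cmod (trig_sum c x))\<^sup>2"
      by (intro AE_I2 tendsto_intros sum_nat_box_tendsto trig_sum_has_sum assms)
    show "AE x in torus. norm ((cmod (?U N x))\<^sup>2) \<le> ?S\<^sup>2" for N
      using sum_nat_box_bound[OF assms] by (intro AE_I2) (auto intro!: power_mono)
    show "integrable torus (\<lambda>_. ?S\<^sup>2)" by (rule integrable_torusI[where B = "?S\<^sup>2"]) auto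
  qed (use trig_sum_measurable[OF assms] in \<open>auto intro!: continuous_measurable_torus continuous_intros continuous_character\<close>)
  moreover have "(\<lambda>N. 4 * pi\<^sup>2 * (\<Sum>k\<in>nat_box N. (cmod (c k))\<^sup>2)) \<longlonglongrightarrow> 4 * pi\<^sup>2 * (l2_norm c)\<^sup>2"
    unfolding l2_norm_sq
    using square_summable_l1[OF assms]
    by (intro tendsto_intros sum_nat_box_tendsto has_sum_infsum) (simp add: square_summable_def)
  ultimately show ?thesis unfolding parseval_finite[OF finite_nat_box]
    by (rule LIMSEQ_unique)
qed

lemma measure_torus: "measure torus (space torus) = 4 * pi\<^sup>2"
  using parseval_finite[of "{(0, 0)}" "\<lambda>_. 1"] by simp

section \<open>Dilations\<close>

text \<open>The coefficients of f(rz, rw). For r < 1 they are absolutely summable, so the values of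
  f on the torus of radius r form a Fourier series to which \<open>parseval\<close> applies.\<close>

definition dilate :: "real \<Rightarrow> (nat \<times> nat \<Rightarrow> complex) \<Rightarrow> nat \<times> nat \<Rightarrow> complex" where
  "dilate r a = (\<lambda>(m, n). a (m, n) * of_real r ^ (m + n))"

lemma cmod_dilate: "0 \<le> r \<Longrightarrow> cmod (dilate r a k) = cmod (a k) * r ^ (fst k + snd k)"
  by (simp add: dilate_def case_prod_unfold norm_mult norm_power)

lemma dilate_summable:
  assumes "disk_summable a" "0 \<le> r" "r < 1"
  shows "(\<lambda>k. cmod (dilate r a k)) summable_on UNIV"
  using assms by (simp add: cmod_dilate disk_summable_def case_prod_unfold)

lemma trig_sum_dilate:
  assumes "0 \<le> r" "r < 1"
  shows "trig_sum (dilate r a) x = power_series2 a (of_real r * cis (fst x), of_real r * cis (snd x))"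
proof -
  have "power_series2 a (of_real r * cis (fst x), of_real r * cis (snd x))
    = (\<Sum>\<^sub>\<infinity>(m, n)\<in>UNIV. a (m, n) * (of_real r * cis (fst x)) ^ m * (of_real r * cis (snd x)) ^ n)"
    using assms by (intro power_series2_eq) (simp add: norm_mult)
  also have "\<dots> = (\<Sum>\<^sub>\<infinity>k. dilate r a k * character k x)"
  proof (rule infsum_cong)
    fix k :: "nat \<times> nat"
    have "character k x = cis (fst x) ^ fst k * cis (snd x) ^ snd k"
      by (simp only: character_def Complex.DeMoivre cis_mult)
    then show "(case k of (m, n) \<Rightarrow> a (m, n) * (of_real r * cis (fst x)) ^ m * (of_real r * cis (snd x)) ^ n)
      = dilate r a k * character k x"
      by (simp add: dilate_def case_prod_unfold power_mult_distrib power_add mult_ac)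
  qed
  finally show ?thesis by (simp add: trig_sum_def)
qed

lemma parseval_dilate:
  assumes "disk_summable a" "0 \<le> r" "r < 1"
  shows "(LINT x|torus. (cmod (power_series2 a (of_real r * cis (fst x), of_real r * cis (snd x))))\<^sup>2)
    = 4 * pi\<^sup>2 * (l2_norm (dilate r a))\<^sup>2"
    and "integrable torus (\<lambda>x. (cmod (power_series2 a (of_real r * cis (fst x), of_real r * cis (snd x))))\<^sup>2)"
  using parseval[OF dilate_summable[OF assms]] integrable_trig_sum_sq[OF dilate_summable[OF assms]] assms
  by (simp_all add: trig_sum_dilate)

text \<open>Uniqueness of coefficients is read off from Parseval's identity on a single torus, here
  of radius 1/2: the integral vanishes, hence so does every dilated coefficient.\<close>

lemma power_series2_zero_imp:
  assumes "disk_summable a" "\<And>x. x \<in> bidisk \<Longrightarrow> power_series2 a x = 0"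
  shows "a k = 0"
proof -
  have s: "square_summable (dilate (1/2) a)"
    using assms by (intro square_summable_l1 dilate_summable) auto
  have "4 * pi\<^sup>2 * (l2_norm (dilate (1/2) a))\<^sup>2 = 0"
    by (subst parseval_dilate(1)[symmetric, OF assms(1)]) (auto simp: assms(2) norm_mult)
  then have "l2_norm (dilate (1/2) a) = 0" by simp
  from l2_norm_eq_0[OF s this, of k] show ?thesis
    by (simp add: dilate_def case_prod_unfold)
qed

lemma power_series2_inj:
  assumes "disk_summable a" "disk_summable b" "power_series2 a = power_series2 b"
  shows "a = b"
proof
  fix k
  have d: "disk_summable (\<lambda>k. -1 * b k)" by (rule disk_summable_cmult[OF assms(2)])
  have "power_series2 (\<lambda>k. a k + -1 * b k) x = 0" for x
    unfolding power_series2_add[OF assms(1) d] power_series2_cmult assms(3) by simp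
  then have "a k + -1 * b k = 0"
    by (rule power_series2_zero_imp[OF disk_summable_add[OF assms(1) d]])
  then show "a k = b k" by simp
qed

text \<open>For a finite index set the norm of the dilated coefficients converges to that of the
  original ones as r tends to 1, so a bound that is uniform for r close to 1 survives the
  limit.\<close>

lemma square_summable_of_dilate_bound:
  assumes C: "0 \<le> C" and r0: "r0 < 1"
    and b: "\<And>r. \<lbrakk>r0 < r; 0 \<le> r; r < 1\<rbrakk> \<Longrightarrow> l2_norm (dilate r a) \<le> C" and a: "disk_summable a"
  shows "square_summable a" "l2_norm a \<le> C"
proof -
  have "L2_set (\<lambda>k. cmod (a k)) F \<le> C" if F: "finite F" for F
  proof -
    have lim: "((\<lambda>r. L2_set (\<lambda>k. cmod (a k) * r ^ (fst k + snd k)) F) \<longlongrightarrow> L2_set (\<lambda>k. cmod (a k) * 1 ^ (fst k + snd k)) F) (at_left 1)"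
      unfolding L2_set_def by (intro tendsto_intros)
    have "\<forall>\<^sub>F r in at_left 1. L2_set (\<lambda>k. cmod (a k) * r ^ (fst k + snd k)) F \<le> C"
    proof (rule eventually_at_leftI[of "max r0 0"])
      fix r assume r: "r \<in> {max r0 0<..<1}"
      then have r': "0 \<le> r" "r < 1" "r0 < r" by auto
      have "L2_set (\<lambda>k. cmod (dilate r a k)) F \<le> l2_norm (dilate r a)"
        using a r' by (intro L2_set_le_l2_norm square_summable_l1 dilate_summable) auto
      then show "L2_set (\<lambda>k. cmod (a k) * r ^ (fst k + snd k)) F \<le> C"
        using b[OF r'(3,1,2)] r' by (simp add: cmod_dilate)
    qed (use r0 in auto)
    from tendsto_upperbound[OF lim this] show ?thesis by simp
  qed
  then show "square_summable a" "l2_norm a \<le> C" by (auto intro: square_summableI)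
qed

lemma l2_norm_dilate_le:
  assumes "square_summable a" "0 \<le> r" "r < 1"
  shows "l2_norm (dilate r a) \<le> l2_norm a"
proof (rule square_summableI(2))
  fix F :: "(nat \<times> nat) set"
  have "L2_set (\<lambda>k. cmod (dilate r a k)) F \<le> L2_set (\<lambda>k. cmod (a k)) F"
    using assms by (intro L2_set_mono) (auto simp: cmod_dilate mult_left_le power_le_one)
  also have "\<dots> \<le> l2_norm a" by (rule L2_set_le_l2_norm[OF assms(1)])
  finally show "L2_set (\<lambda>k. cmod (dilate r a k)) F \<le> l2_norm a" .
qed

text \<open>Pointwise domination on each torus of radius r, integrated by Parseval. The bound is
  demanded only for r above \<open>r0\<close> because the resolvent multipliers are defined through
  a division by z - \<nu>, and large radii stay away from |z| = |\<nu>| when \<nu> lies in the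
  disk.\<close>

lemma multiplier_of_bounded:
  assumes A: "disk_summable A" and g: "square_summable g" and r0: "r0 < 1"
    and b: "\<And>z w r. \<lbrakk>r0 < r; r < 1; cmod z = r; cmod w = r\<rbrakk> \<Longrightarrow> cmod (power_series2 A (z, w)) \<le> C"
    and C: "0 \<le> C"
  shows "square_summable (cauchy_prod A g)" "l2_norm (cauchy_prod A g) \<le> C * l2_norm g"
proof -
  have g': "disk_summable g" by (rule disk_summable_l2[OF g])
  have "l2_norm (dilate r (cauchy_prod A g)) \<le> C * l2_norm g" if r: "r0 < r" "0 \<le> r" "r < 1" for r
  proof -
    let ?p = "\<lambda>x. (of_real r * cis (fst x), of_real r * cis (snd x))"
    have "4 * pi\<^sup>2 * (l2_norm (dilate r (cauchy_prod A g)))\<^sup>2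
      = (LINT x|torus. (cmod (power_series2 (cauchy_prod A g) (?p x)))\<^sup>2)"
      by (rule parseval_dilate(1)[OF disk_summable_cauchy_prod[OF A g'] r(2,3), symmetric])
    also have "\<dots> \<le> (LINT x|torus. C\<^sup>2 * (cmod (power_series2 g (?p x)))\<^sup>2)"
    proof (rule integral_mono)
      fix x
      have "cmod (power_series2 A (?p x)) \<le> C"
        using r by (intro b[of r]) (auto simp: norm_mult)
      then show "(cmod (power_series2 (cauchy_prod A g) (?p x)))\<^sup>2 \<le> C\<^sup>2 * (cmod (power_series2 g (?p x)))\<^sup>2"
        unfolding power_series2_cauchy_prod[OF A g'] norm_mult power_mult_distrib
        by (intro mult_right_mono power_mono) auto
    qed (use parseval_dilate(2)[OF disk_summable_cauchy_prod[OF A g'] r(2,3)] parseval_dilate(2)[OF g' r(2,3)] in auto)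
    also have "\<dots> = C\<^sup>2 * (4 * pi\<^sup>2 * (l2_norm (dilate r g))\<^sup>2)"
      by (simp add: parseval_dilate(1)[OF g' r(2,3)])
    also have "\<dots> \<le> C\<^sup>2 * (4 * pi\<^sup>2 * (l2_norm g)\<^sup>2)"
      using l2_norm_dilate_le[OF g r(2,3)] l2_norm_nonneg by (intro mult_left_mono power_mono) auto
    finally have "(l2_norm (dilate r (cauchy_prod A g)))\<^sup>2 \<le> (C * l2_norm g)\<^sup>2"
      by (simp add: power_mult_distrib mult_ac)
    then show ?thesis
      by (rule power2_le_imp_le) (simp add: C l2_norm_nonneg)
  qed
  from square_summable_of_dilate_bound[OF _ r0 this disk_summable_cauchy_prod[OF A g']]
  show "square_summable (cauchy_prod A g)" "l2_norm (cauchy_prod A g) \<le> C * l2_norm g"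
    by (simp_all add: C l2_norm_nonneg)
qed

section \<open>Truncations and dilations in the square-summable norm\<close>

lemma l2_norm_mono:
  assumes "square_summable b" "\<And>k. cmod (a k) \<le> cmod (b k)"
  shows "square_summable a" "l2_norm a \<le> l2_norm b"
proof -
  have "L2_set (\<lambda>k. cmod (a k)) F \<le> l2_norm b" for F
    by (rule order_trans[OF L2_set_mono L2_set_le_l2_norm[OF assms(1)]]) (use assms(2) in auto)
  then show "square_summable a" "l2_norm a \<le> l2_norm b" by (auto intro: square_summableI)
qed

lemma l2_norm_triangle_diff:
  assumes "square_summable a" "square_summable b"
  shows "\<bar>l2_norm a - l2_norm b\<bar> \<le> l2_norm (\<lambda>k. a k - b k)"
proof -
  have d: "square_summable (\<lambda>k. a k - b k)" "square_summable (\<lambda>k. b k - a k)"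
    by (intro square_summable_diff assms)+
  have "l2_norm (\<lambda>k. b k - a k) = l2_norm (\<lambda>k. a k - b k)"
    by (simp add: l2_norm_def norm_minus_commute)
  then show ?thesis
    using square_summable_add(2)[OF assms(2) d(1)] square_summable_add(2)[OF assms(1) d(2)] by simp
qed

definition trunc :: "nat \<Rightarrow> (nat \<times> nat \<Rightarrow> complex) \<Rightarrow> nat \<times> nat \<Rightarrow> complex" where
  "trunc N a k = (if k \<in> nat_box N then a k else 0)"

lemma l2_norm_trunc_le:
  assumes "square_summable a"
  shows "square_summable (trunc N a)" "l2_norm (trunc N a) \<le> l2_norm a"
  by (rule l2_norm_mono[OF assms]; simp add: trunc_def)+

lemma trunc_tendsto:
  assumes a: "square_summable a"
  shows "(\<lambda>N. l2_norm (\<lambda>k. a k - trunc N a k)) \<longlonglongrightarrow> 0"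
proof -
  have "(l2_norm (\<lambda>k. a k - trunc N a k))\<^sup>2 = (l2_norm a)\<^sup>2 - (\<Sum>k\<in>nat_box N. (cmod (a k))\<^sup>2)" for N
  proof -
    have "((\<lambda>k. (cmod (trunc N a k))\<^sup>2) has_sum (\<Sum>k\<in>nat_box N. (cmod (a k))\<^sup>2)) UNIV"
      by (rule has_sum_finite_neutralI[where B = "nat_box N"]) (auto simp: trunc_def)
    moreover have "((\<lambda>k. (cmod (a k))\<^sup>2) has_sum (l2_norm a)\<^sup>2) UNIV"
      using a unfolding l2_norm_sq square_summable_def by (rule has_sum_infsum)
    ultimately have "((\<lambda>k. (cmod (a k))\<^sup>2 + - (cmod (trunc N a k))\<^sup>2) has_sum (l2_norm a)\<^sup>2 + - (\<Sum>k\<in>nat_box N. (cmod (a k))\<^sup>2)) UNIV"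
      by (intro has_sum_add has_sum_uminusI)
    moreover have "(\<lambda>k. (cmod (a k))\<^sup>2 + - (cmod (trunc N a k))\<^sup>2) = (\<lambda>k. (cmod (a k - trunc N a k))\<^sup>2)"
      by (auto simp: trunc_def)
    ultimately show ?thesis unfolding l2_norm_sq by (simp add: infsumI)
  qed
  moreover have "(\<lambda>N. (l2_norm a)\<^sup>2 - (\<Sum>k\<in>nat_box N. (cmod (a k))\<^sup>2)) \<longlonglongrightarrow> (l2_norm a)\<^sup>2 - (l2_norm a)\<^sup>2"
    unfolding l2_norm_sq using a
    by (intro tendsto_intros sum_nat_box_tendsto has_sum_infsum) (simp add: square_summable_def)
  ultimately have "(\<lambda>N. (l2_norm (\<lambda>k. a k - trunc N a k))\<^sup>2) \<longlonglongrightarrow> 0" by simp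
  from tendsto_real_sqrt[OF this] show ?thesis by (simp add: l2_norm_nonneg)
qed

text \<open>A fixed sequence increasing to 1 stands in for the limit r to 1, since Fatou's lemma is
  applied to sequences.\<close>

definition radius :: "nat \<Rightarrow> real" where
  "radius N = 1 - 1 / (real N + 2)"

lemma radius: "0 \<le> radius N" "radius N < 1" "M \<le> N \<Longrightarrow> radius M \<le> radius N"
  by (auto simp: radius_def field_simps)

lemma radius_tendsto: "radius \<longlonglongrightarrow> 1"
  unfolding radius_def[abs_def] by real_asymp

lemma filterlim_radius: "filterlim radius (at_left 1) sequentially"
  using radius_tendsto radius(2) by (auto simp: filterlim_at intro!: eventuallyI less_imp_neq)

lemma dilate_tendsto:
  assumes a: "square_summable a"
  shows "(\<lambda>N. l2_norm (\<lambda>k. a k - dilate (radius N) a k)) \<longlonglongrightarrow> 0"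
proof (rule LIMSEQ_I)
  fix e :: real assume e: "0 < e"
  have "\<forall>\<^sub>F M in sequentially. l2_norm (\<lambda>k. a k - trunc M a k) < e / 2"
    by (rule order_tendstoD(2)[OF trunc_tendsto[OF a]]) (use e in simp)
  then obtain M where M: "l2_norm (\<lambda>k. a k - trunc M a k) < e / 2"
    using eventually_happens'[OF sequentially_bot] by blast
  define B where "B = nat_box M"
  have "(\<lambda>N. L2_set (\<lambda>k. cmod (a k) * (1 - radius N ^ (fst k + snd k))) B) \<longlonglongrightarrow> L2_set (\<lambda>k. cmod (a k) * (1 - 1 ^ (fst k + snd k))) B"
    unfolding L2_set_def by (intro tendsto_intros radius_tendsto)
  then have "\<forall>\<^sub>F N in sequentially. L2_set (\<lambda>k. cmod (a k) * (1 - radius N ^ (fst k + snd k))) B < e / 2"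
    using e by (intro order_tendstoD(2)) (auto simp: L2_set_def)
  then obtain N0 where N0: "\<And>N. N \<ge> N0 \<Longrightarrow> L2_set (\<lambda>k. cmod (a k) * (1 - radius N ^ (fst k + snd k))) B < e / 2"
    by (auto simp: eventually_sequentially)
  have "l2_norm (\<lambda>k. a k - dilate (radius N) a k) < e" if N: "N \<ge> N0" for N
  proof -
    have cm: "cmod (a k - dilate (radius N) a k) = cmod (a k) * (1 - radius N ^ (fst k + snd k))" for k
    proof -
      have "a k - dilate (radius N) a k = a k * of_real (1 - radius N ^ (fst k + snd k))"
        by (simp add: dilate_def case_prod_unfold algebra_simps)
      moreover have "0 \<le> 1 - radius N ^ (fst k + snd k)"
        using radius[of N] by (simp add: power_le_one)
      ultimately show ?thesis by (simp add: norm_mult del: of_real_diff of_real_power)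
    qed
    \<comment> \<open>The difference is split at the box: on the finite box the factors 1 - r^j
      become small, and outside it they are at most 1, so that \<open>?v\<close> is dominated by the
      tail of \<open>a\<close>.\<close>
    let ?u = "\<lambda>k. trunc M (\<lambda>k. a k - dilate (radius N) a k) k" and ?v = "\<lambda>k. (if k \<in> B then 0 else a k - dilate (radius N) a k)"
    have v: "square_summable ?v" "l2_norm ?v \<le> l2_norm (\<lambda>k. a k - trunc M a k)"
      by (rule l2_norm_mono[OF square_summable_diff[OF a l2_norm_trunc_le(1)[OF a, of M]]];
         use radius[of N] in \<open>simp add: trunc_def B_def cm mult_left_le\<close>)+
    have "finite B" by (simp add: B_def)
    then have u: "(l2_norm ?u)\<^sup>2 = (\<Sum>k\<in>B. (cmod (a k) * (1 - radius N ^ (fst k + snd k)))\<^sup>2)"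
      unfolding l2_norm_sq
      by (intro infsumI has_sum_finite_neutralI[where B = B]) (auto simp: trunc_def B_def cm)
    have u': "square_summable ?u"
      unfolding square_summable_def
      by (rule finite_nonzero_values_imp_summable_on, rule finite_subset[OF _ finite_nat_box[of M]]) (auto simp: trunc_def)
    have "l2_norm ?u = L2_set (\<lambda>k. cmod (a k) * (1 - radius N ^ (fst k + snd k))) B"
      using u l2_norm_nonneg unfolding L2_set_def by (metis real_sqrt_unique)
    moreover have "(\<lambda>k. ?u k + ?v k) = (\<lambda>k. a k - dilate (radius N) a k)"
      by (auto simp: trunc_def B_def)
    ultimately show ?thesis
      using square_summable_add(2)[OF u' v(1)] v(2) M N0[OF N] by simp
  qed
  then show "\<exists>no. \<forall>n\<ge>no. norm (l2_norm (\<lambda>k. a k - dilate (radius n) a k) - 0) < e"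
    by (auto simp: l2_norm_nonneg)
qed

lemma square_summable_dilate: "square_summable a \<Longrightarrow> 0 \<le> r \<Longrightarrow> r < 1 \<Longrightarrow> square_summable (dilate r a)"
  by (rule square_summable_l1[OF dilate_summable[OF disk_summable_l2]])

lemma l2_norm_dilate_tendsto:
  assumes a: "square_summable a"
  shows "(\<lambda>N. l2_norm (dilate (radius N) a)) \<longlonglongrightarrow> l2_norm a"
proof (rule Lim_transform2[OF tendsto_const])
  show "(\<lambda>N. l2_norm a - l2_norm (dilate (radius N) a)) \<longlonglongrightarrow> 0"
    using l2_norm_triangle_diff[OF a square_summable_dilate[OF a]] radius
    by (intro Lim_null_comparison[OF _ dilate_tendsto[OF a]] always_eventually) auto
qed

section \<open>Multiplication by an inner function is isometric\<close>

lemma trig_sum_diff: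
  assumes "(\<lambda>k. cmod (c k)) summable_on UNIV" "(\<lambda>k. cmod (d k)) summable_on UNIV"
  shows "trig_sum (\<lambda>k. c k - d k) x = trig_sum c x - trig_sum d x"
  unfolding trig_sum_def[of "\<lambda>k. c k - d k"]
  using has_sum_add[OF trig_sum_has_sum[OF assms(1)] has_sum_uminusI[OF trig_sum_has_sum[OF assms(2)]]]
  by (intro infsumI) (simp add: algebra_simps)

lemma integrable_trig_deviation:
  assumes s: "(\<lambda>k. cmod (c k)) summable_on UNIV"
  shows "integrable torus (\<lambda>x. (1 - cmod (trig_sum c x))\<^sup>2)"
proof (rule integrable_torusI[where B = "(1 + (\<Sum>\<^sub>\<infinity>k. cmod (c k)))\<^sup>2"])
  show "(\<lambda>x. (1 - cmod (trig_sum c x))\<^sup>2) \<in> borel_measurable torus"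
    using trig_sum_measurable[OF s] by measurable
  show "norm ((1 - cmod (trig_sum c x))\<^sup>2) \<le> (1 + (\<Sum>\<^sub>\<infinity>k. cmod (c k)))\<^sup>2" for x
  proof -
    have "\<bar>1 - cmod (trig_sum c x)\<bar> \<le> \<bar>1 + (\<Sum>\<^sub>\<infinity>k. cmod (c k))\<bar>"
      using trig_sum_bound[OF s, of x] norm_ge_zero[of "trig_sum c x"] by linarith
    then show ?thesis by (simp only: abs_le_square_iff real_norm_def abs_power2)
  qed
qed

lemma inner_function_radial_limit:
  assumes "inner_function \<theta>"
  shows "AE x in torus. \<exists>l. ((\<lambda>r. \<theta> (of_real r * cis (fst x), of_real r * cis (snd x))) \<longlongrightarrow> l) (at_left (1::real)) \<and> cmod l = 1"
  using assms unfolding torus_def inner_function_def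
  by (subst AE_restrict_space_iff) (auto simp: case_prod_unfold mem_Times_iff)

text \<open>Fatou's lemma: the dilations of an inner function are close to unimodular in the mean.\<close>

lemma inner_function_mean_deviation:
  assumes \<theta>: "inner_function (power_series2 a)" and a: "square_summable a"
  shows "(LINT x|torus. (1 - cmod (trig_sum (dilate (radius N) a) x))\<^sup>2)
      \<le> 4 * pi\<^sup>2 * (l2_norm (\<lambda>k. a k - dilate (radius N) a k))\<^sup>2"
proof -
  let ?T = "\<lambda>N. trig_sum (dilate (radius N) a)"
  let ?d = "4 * pi\<^sup>2 * (l2_norm (\<lambda>k. a k - dilate (radius N) a k))\<^sup>2"
  have s: "(\<lambda>k. cmod (dilate (radius N) a k)) summable_on UNIV" for N
    using radius[of N] by (intro dilate_summable disk_summable_l2 a)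
  have m: "?T N \<in> borel_measurable torus" for N by (rule trig_sum_measurable[OF s])
  have "AE x in torus. \<exists>l. (\<lambda>M. ?T M x) \<longlonglongrightarrow> l \<and> cmod l = 1"
    using inner_function_radial_limit[OF \<theta>]
  proof eventually_elim
    case (elim x)
    then obtain l where l: "((\<lambda>r. power_series2 a (of_real r * cis (fst x), of_real r * cis (snd x))) \<longlongrightarrow> l) (at_left (1::real))" "cmod l = 1"
      by blast
    from filterlim_compose[OF l(1) filterlim_radius] have "(\<lambda>M. ?T M x) \<longlonglongrightarrow> l"
      using radius by (simp add: trig_sum_dilate)
    then show ?case using l(2) by blast
  qed
  \<comment> \<open>With l the radial limit, |1 - |T_N|| is at most |l - T_N| because |l| = 1, and l
    is the limit of T_M as M grows. This brings the boundary value into a form suited to Fatou's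
    lemma.\<close>
  then have lim: "AE x in torus. ennreal ((1 - cmod (?T N x))\<^sup>2) \<le> liminf (\<lambda>M. ennreal ((cmod (?T M x - ?T N x))\<^sup>2))"
  proof (rule AE_mp, intro AE_I2 impI)
    fix x assume "\<exists>l. (\<lambda>M. ?T M x) \<longlonglongrightarrow> l \<and> cmod l = 1"
    then obtain l where l: "(\<lambda>M. ?T M x) \<longlonglongrightarrow> l" "cmod l = 1" by blast
    have "(\<lambda>M. ennreal ((cmod (?T M x - ?T N x))\<^sup>2)) \<longlonglongrightarrow> ennreal ((cmod (l - ?T N x))\<^sup>2)"
      by (intro tendsto_ennrealI tendsto_intros l)
    then have "liminf (\<lambda>M. ennreal ((cmod (?T M x - ?T N x))\<^sup>2)) = ennreal ((cmod (l - ?T N x))\<^sup>2)"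
      by (rule lim_imp_Liminf[OF sequentially_bot])
    moreover have "\<bar>1 - cmod (?T N x)\<bar> \<le> \<bar>cmod (l - ?T N x)\<bar>"
      using norm_triangle_ineq3[of l "?T N x"] l(2) by simp
    then have "(1 - cmod (?T N x))\<^sup>2 \<le> (cmod (l - ?T N x))\<^sup>2"
      by (simp only: abs_le_square_iff)
    ultimately show "ennreal ((1 - cmod (?T N x))\<^sup>2) \<le> liminf (\<lambda>M. ennreal ((cmod (?T M x - ?T N x))\<^sup>2))"
      by (simp add: ennreal_leI)
  qed
  have nn: "(\<integral>\<^sup>+x. ennreal ((cmod (?T M x - ?T N x))\<^sup>2) \<partial>torus) \<le> ennreal ?d" if "N \<le> M" for M
  proof -
    have sd: "(\<lambda>k. cmod (dilate (radius M) a k - dilate (radius N) a k)) summable_on UNIV"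
      by (rule summable_on_comparison_test[OF summable_on_add[OF s[of M] s[of N]]])
        (auto simp: norm_triangle_ineq4)
    have "(\<integral>\<^sup>+x. ennreal ((cmod (?T M x - ?T N x))\<^sup>2) \<partial>torus) = ennreal (LINT x|torus. (cmod (?T M x - ?T N x))\<^sup>2)"
      using integrable_trig_sum_sq[OF sd] by (intro nn_integral_eq_integral) (auto simp: trig_sum_diff s)
    also have "(LINT x|torus. (cmod (?T M x - ?T N x))\<^sup>2) = 4 * pi\<^sup>2 * (l2_norm (\<lambda>k. dilate (radius M) a k - dilate (radius N) a k))\<^sup>2"
      using parseval[OF sd] by (simp add: trig_sum_diff s)
    also have "\<dots> \<le> ?d"
    proof -
      \<comment> \<open>Since r_N \<le> r_M \<le> 1, the factor r_M^j - r_N^j is at most 1 - r_N^j;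
        this makes the estimate uniform in M.\<close>
      have "cmod (dilate (radius M) a k - dilate (radius N) a k) \<le> cmod (a k - dilate (radius N) a k)" for k
      proof -
        let ?j = "fst k + snd k"
        have "dilate (radius M) a k - dilate (radius N) a k = a k * of_real (radius M ^ ?j - radius N ^ ?j)"
          "a k - dilate (radius N) a k = a k * of_real (1 - radius N ^ ?j)"
          by (auto simp: dilate_def case_prod_unfold algebra_simps)
        moreover have "\<bar>radius M ^ ?j - radius N ^ ?j\<bar> \<le> \<bar>1 - radius N ^ ?j\<bar>"
          using power_mono[OF radius(3)[OF that] radius(1), of ?j] power_le_one[of "radius M" ?j] radius[of M] by simp
        ultimately show ?thesis
          by (simp only: norm_mult norm_of_real mult_left_mono norm_ge_zero)
      qed
      from l2_norm_mono(2)[OF square_summable_diff[OF a square_summable_dilate[OF a]] this] radius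
      show ?thesis by (intro mult_left_mono power_mono l2_norm_nonneg) auto
    qed
    finally show ?thesis by (simp add: ennreal_leI)
  qed
  have "(\<integral>\<^sup>+x. ennreal ((1 - cmod (?T N x))\<^sup>2) \<partial>torus) \<le> (\<integral>\<^sup>+x. liminf (\<lambda>M. ennreal ((cmod (?T M x - ?T N x))\<^sup>2)) \<partial>torus)"
    by (rule nn_integral_mono_AE[OF lim])
  also have "\<dots> \<le> liminf (\<lambda>M. \<integral>\<^sup>+x. ennreal ((cmod (?T M x - ?T N x))\<^sup>2) \<partial>torus)"
  proof (rule nn_integral_liminf)
    fix i
    have "(\<lambda>x. ?T i x - ?T N x) \<in> borel_measurable torus" by (intro borel_measurable_diff m)
    then show "(\<lambda>x. ennreal ((cmod (?T i x - ?T N x))\<^sup>2)) \<in> borel_measurable torus" by measurable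
  qed
  also have "\<dots> \<le> ennreal ?d"
  proof -
    have "\<forall>\<^sub>F M in sequentially. (\<integral>\<^sup>+x. ennreal ((cmod (?T M x - ?T N x))\<^sup>2) \<partial>torus) \<le> ennreal ?d"
      using nn by (intro eventually_sequentiallyI[of N])
    from Liminf_mono[OF this] show ?thesis by (simp add: Liminf_const)
  qed
  finally have le: "(\<integral>\<^sup>+x. ennreal ((1 - cmod (?T N x))\<^sup>2) \<partial>torus) \<le> ennreal ?d" .
  have "(\<integral>\<^sup>+x. ennreal ((1 - cmod (?T N x))\<^sup>2) \<partial>torus) = ennreal (LINT x|torus. (1 - cmod (?T N x))\<^sup>2)"
    by (rule nn_integral_eq_integral[OF integrable_trig_deviation[OF s]]) simp
  with le show ?thesis by (simp add: ennreal_le_iff)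
qed

lemma cauchy_prod_commute:
  assumes "disk_summable a" "disk_summable b"
  shows "cauchy_prod a b = cauchy_prod b a"
  by (intro power_series2_inj disk_summable_cauchy_prod assms)
    (simp add: power_series2_cauchy_prod assms mult.commute)

lemma finite_support_summable:
  assumes "\<And>k. k \<notin> nat_box M \<Longrightarrow> g k = (0::complex)"
  shows "(\<lambda>k. cmod (g k)) summable_on UNIV"
  by (rule finite_nonzero_values_imp_summable_on, rule finite_subset[OF _ finite_nat_box[of M]]) (use assms in auto)

definition unit_coeffs :: "nat \<times> nat \<Rightarrow> complex" where
  "unit_coeffs k = (if k = (0, 0) then 1 else 0)"

lemma square_summable_unit: "square_summable unit_coeffs"
  by (intro square_summable_l1 finite_support_summable[of 0])
    (auto simp: unit_coeffs_def nat_box_def)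

lemma power_series2_unit: "x \<in> bidisk \<Longrightarrow> power_series2 unit_coeffs x = 1"
  by (cases x, simp only:, intro power_series2I has_sum_finite_neutralI[where B = "{(0, 0)}"])
    (auto simp: unit_coeffs_def split: if_splits)

lemma power_series2_bound:
  assumes g: "(\<lambda>k. cmod (g k)) summable_on UNIV" and zw: "cmod z < 1" "cmod w < 1"
  shows "cmod (power_series2 g (z, w)) \<le> (\<Sum>\<^sub>\<infinity>k. cmod (g k))"
proof -
  have d: "disk_summable g"
    by (rule disk_summable_l2[OF square_summable_l1[OF g]])
  note s = disk_summableD[OF d zw]
  have "cmod (power_series2 g (z, w)) \<le> (\<Sum>\<^sub>\<infinity>(m, n). cmod (g (m, n) * z ^ m * w ^ n))"
    using zw s norm_infsum_bound[of "\<lambda>(m, n). g (m, n) * z ^ m * w ^ n" UNIV]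
    by (simp add: power_series2_eq case_prod_unfold)
  also have "\<dots> \<le> (\<Sum>\<^sub>\<infinity>k. cmod (g k))"
  proof (rule infsum_mono[OF s g])
    fix k :: "nat \<times> nat"
    obtain m n where k: "k = (m, n)" by force
    have "cmod (g k) * (cmod z ^ m * cmod w ^ n) \<le> cmod (g k)"
      using zw by (intro mult_left_le mult_le_one power_le_one) auto
    then show "(case k of (m, n) \<Rightarrow> cmod (g (m, n) * z ^ m * w ^ n)) \<le> cmod (g k)"
      by (simp add: k norm_mult norm_power mult.assoc)
  qed
  finally show ?thesis .
qed

text \<open>Takes the place of the Cauchy-Schwarz inequality for integrals: the linear term in |1 -
  t| is traded by the inequality 2ab \<le> a^2/\<eta> + \<eta> b^2 (with b = 1) for the quadratic
  deviation, which is controlled in the mean, plus a small constant.\<close>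

lemma square_deviation_bound:
  fixes t \<eta> :: real
  assumes "0 < \<eta>" "0 \<le> t"
  shows "\<bar>t\<^sup>2 - 1\<bar> \<le> (1 + 1 / \<eta>) * (1 - t)\<^sup>2 + \<eta>"
proof -
  have "\<bar>t\<^sup>2 - 1\<bar> = \<bar>1 - t\<bar> * (t + 1)"
  proof -
    have "t\<^sup>2 - 1 = - ((1 - t) * (t + 1))" by (simp add: algebra_simps power2_eq_square)
    then show ?thesis using assms by (simp add: abs_mult)
  qed
  also have "\<dots> \<le> \<bar>1 - t\<bar> * (\<bar>1 - t\<bar> + 2)" by (intro mult_left_mono) auto
  also have "\<dots> = (1 - t)\<^sup>2 + 2 * \<bar>1 - t\<bar>"
    by (simp add: distrib_left power2_eq_square)
  also have "2 * \<bar>1 - t\<bar> \<le> (1 - t)\<^sup>2 / \<eta> + \<eta>"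
  proof -
    have "0 \<le> (\<bar>1 - t\<bar> - \<eta>)\<^sup>2 / \<eta>" using assms by simp
    also have "\<dots> = (1 - t)\<^sup>2 / \<eta> + \<eta> - 2 * \<bar>1 - t\<bar>"
      using assms by (simp add: power2_diff field_simps power2_eq_square[of \<eta>])
    finally show ?thesis by simp
  qed
  finally show ?thesis by (simp add: algebra_simps)
qed

text \<open>On the torus of radius r the squared norms of \<theta> g and g differ by the integral of
  |g|^2 (|\<theta>|^2 - 1), which tends to 0 because g is bounded and |\<theta>| is close to 1 in
  the mean. Finite support of g supplies the boundedness; at this stage \<theta> is not known to be
  bounded, so the product of \<theta> with a general element of the Hardy space is not yet under
  control.\<close>

lemma inner_function_isometry_finite:
  assumes \<theta>: "inner_function (power_series2 a)" and a: "square_summable a"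
    and g: "\<And>k. k \<notin> nat_box M \<Longrightarrow> g k = 0"
  shows "square_summable (cauchy_prod a g)" "l2_norm (cauchy_prod a g) = l2_norm g"
proof -
  note gs = finite_support_summable[OF g, of M "\<lambda>k. k", simplified]
  have gq: "square_summable g" by (rule square_summable_l1[OF gs])
  have gd: "disk_summable g" by (rule disk_summable_l2[OF gq])
  have ad: "disk_summable a" by (rule disk_summable_l2[OF a])
  let ?G = "\<Sum>\<^sub>\<infinity>k. cmod (g k)"
  have G: "0 \<le> ?G" by (intro infsum_nonneg) auto
  \<comment> \<open>The roles are exchanged here: g is the bounded multiplier and \<theta> the
    square-summable factor.\<close>
  have "square_summable (cauchy_prod g a)"
    by (rule multiplier_of_bounded(1)[OF gd a, of 0 ?G]) (use power_series2_bound[OF gs] G in auto)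
  then show cq: "square_summable (cauchy_prod a g)" by (simp only: cauchy_prod_commute[OF ad gd])
  define \<delta> where "\<delta> N = l2_norm (\<lambda>k. a k - dilate (radius N) a k)" for N
  have \<delta>0: "0 \<le> \<delta> N" for N by (simp add: \<delta>_def l2_norm_nonneg)
  let ?e = "\<lambda>N. ?G\<^sup>2 * ((\<delta> N)\<^sup>2 + \<delta> N + (\<delta> N + 1 / (real N + 1)))"
  have bound: "\<bar>(l2_norm (dilate (radius N) (cauchy_prod a g)))\<^sup>2 - (l2_norm (dilate (radius N) g))\<^sup>2\<bar> \<le> ?e N" for N
  proof -
    note r = radius(1,2)[of N]
    let ?p = "\<lambda>x. (of_real (radius N) * cis (fst x), of_real (radius N) * cis (snd x))"
    define t where "t x = cmod (power_series2 a (?p x))" for x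
    define h where "h x = cmod (power_series2 g (?p x))" for x
    \<comment> \<open>Balances the two terms of \<open>square_deviation_bound\<close>: with \<eta>
      at least \<delta>, the quotient \<delta>^2 / \<eta> is at most \<delta>. The summand 1 / (N +
      1) keeps \<eta> positive when \<delta> is zero. The three summands of \<open>?e\<close> arise
      in this way.\<close>
    define \<eta> where "\<eta> = \<delta> N + 1 / (real N + 1)"
    have \<eta>: "0 < \<eta>" "\<delta> N \<le> \<eta>" using \<delta>0[of N] by (auto simp: \<eta>_def intro!: add_nonneg_pos)
    have tT: "t x = cmod (trig_sum (dilate (radius N) a) x)" for x
      using r by (simp add: t_def trig_sum_dilate)
    have hG: "h x \<le> ?G" for x unfolding h_def
      using r by (intro power_series2_bound gs) (auto simp: norm_mult)
    have ic: "integrable torus (\<lambda>x. (t x * h x)\<^sup>2)"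
      using parseval_dilate(2)[OF disk_summable_cauchy_prod[OF ad gd] r]
      by (simp add: t_def h_def power_series2_cauchy_prod[OF ad gd] norm_mult)
    have ig: "integrable torus (\<lambda>x. (h x)\<^sup>2)"
      using parseval_dilate(2)[OF gd r] by (simp add: h_def)
    have it: "integrable torus (\<lambda>x. (1 - t x)\<^sup>2)"
      unfolding tT by (rule integrable_trig_deviation[OF dilate_summable[OF ad r]])
    have "4 * pi\<^sup>2 * \<bar>(l2_norm (dilate (radius N) (cauchy_prod a g)))\<^sup>2 - (l2_norm (dilate (radius N) g))\<^sup>2\<bar>
      = \<bar>4 * pi\<^sup>2 * (l2_norm (dilate (radius N) (cauchy_prod a g)))\<^sup>2 - 4 * pi\<^sup>2 * (l2_norm (dilate (radius N) g))\<^sup>2\<bar>"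
      by (simp add: abs_mult flip: right_diff_distrib)
    also have "\<dots> = \<bar>(LINT x|torus. (t x * h x)\<^sup>2) - (LINT x|torus. (h x)\<^sup>2)\<bar>"
      unfolding parseval_dilate(1)[OF gd r, symmetric] parseval_dilate(1)[OF disk_summable_cauchy_prod[OF ad gd] r, symmetric]
      by (simp add: t_def h_def power_series2_cauchy_prod[OF ad gd] norm_mult)
    also have "\<dots> = \<bar>LINT x|torus. (t x * h x)\<^sup>2 - (h x)\<^sup>2\<bar>"
      using ic ig by simp
    also have "\<dots> \<le> (LINT x|torus. \<bar>(t x * h x)\<^sup>2 - (h x)\<^sup>2\<bar>)"
      by (rule integral_abs_bound)
    also have "\<dots> \<le> (LINT x|torus. ?G\<^sup>2 * ((1 + 1 / \<eta>) * (1 - t x)\<^sup>2 + \<eta>))"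
    proof (rule integral_mono)
      show "integrable torus (\<lambda>x. \<bar>(t x * h x)\<^sup>2 - (h x)\<^sup>2\<bar>)" using ic ig by auto
      show "integrable torus (\<lambda>x. ?G\<^sup>2 * ((1 + 1 / \<eta>) * (1 - t x)\<^sup>2 + \<eta>))"
        by (intro Bochner_Integration.integrable_add integrable_mult_right it finite_measure.integrable_const[OF finite_measure_torus])
      fix x
      have "\<bar>(t x * h x)\<^sup>2 - (h x)\<^sup>2\<bar> = (h x)\<^sup>2 * \<bar>(t x)\<^sup>2 - 1\<bar>"
      proof -
        have "(t x * h x)\<^sup>2 - (h x)\<^sup>2 = (h x)\<^sup>2 * ((t x)\<^sup>2 - 1)"
          by (simp add: power_mult_distrib algebra_simps)
        then show ?thesis by (simp add: abs_mult)
      qed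
      also have "\<dots> \<le> ?G\<^sup>2 * ((1 + 1 / \<eta>) * (1 - t x)\<^sup>2 + \<eta>)"
        using hG[of x] square_deviation_bound[OF \<eta>(1), of "t x"]
        by (intro mult_mono power_mono) (auto simp: h_def t_def)
      finally show "\<bar>(t x * h x)\<^sup>2 - (h x)\<^sup>2\<bar> \<le> ?G\<^sup>2 * ((1 + 1 / \<eta>) * (1 - t x)\<^sup>2 + \<eta>)" .
    qed
    also have "\<dots> = ?G\<^sup>2 * ((1 + 1 / \<eta>) * (LINT x|torus. (1 - t x)\<^sup>2) + 4 * pi\<^sup>2 * \<eta>)"
      by (simp add: measure_torus Bochner_Integration.integral_add[OF integrable_mult_right[OF it] finite_measure.integrable_const[OF finite_measure_torus]])
    also have "\<dots> \<le> ?G\<^sup>2 * ((1 + 1 / \<eta>) * (4 * pi\<^sup>2 * (\<delta> N)\<^sup>2) + 4 * pi\<^sup>2 * \<eta>)"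
      using inner_function_mean_deviation[OF \<theta> a, of N] \<eta>(1)
      by (intro mult_left_mono add_mono) (auto simp: tT \<delta>_def)
    also have "\<dots> = 4 * pi\<^sup>2 * (?G\<^sup>2 * ((\<delta> N)\<^sup>2 + (\<delta> N)\<^sup>2 / \<eta> + \<eta>))"
      by (simp add: algebra_simps)
    also have "\<dots> \<le> 4 * pi\<^sup>2 * ?e N"
    proof -
      have "\<delta> N * \<delta> N \<le> \<delta> N * \<eta>" using \<delta>0[of N] \<eta> by (intro mult_left_mono)
      then have "(\<delta> N)\<^sup>2 / \<eta> \<le> \<delta> N" using \<eta> by (simp add: field_simps power2_eq_square)
      then show ?thesis by (intro mult_left_mono) (auto simp: \<eta>_def)
    qed
    finally show ?thesis by simp
  qed
  have \<delta>lim: "\<delta> \<longlonglongrightarrow> 0" unfolding \<delta>_def[abs_def] by (rule dilate_tendsto[OF a])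
  have "(\<lambda>N. 1 / (real N + 1)) \<longlonglongrightarrow> 0" by real_asymp
  then have "?e \<longlonglongrightarrow> ?G\<^sup>2 * (0\<^sup>2 + 0 + (0 + 0))" by (intro tendsto_intros \<delta>lim)
  then have elim: "?e \<longlonglongrightarrow> 0" by simp
  have "(\<lambda>N. (l2_norm (dilate (radius N) (cauchy_prod a g)))\<^sup>2 - (l2_norm (dilate (radius N) g))\<^sup>2) \<longlonglongrightarrow> 0"
  proof (rule Lim_null_comparison[OF _ elim])
    show "\<forall>\<^sub>F N in sequentially. norm ((l2_norm (dilate (radius N) (cauchy_prod a g)))\<^sup>2 - (l2_norm (dilate (radius N) g))\<^sup>2) \<le> ?e N"
      unfolding real_norm_def by (intro always_eventually allI bound)
  qed
  moreover have "(\<lambda>N. (l2_norm (dilate (radius N) (cauchy_prod a g)))\<^sup>2 - (l2_norm (dilate (radius N) g))\<^sup>2)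
     \<longlonglongrightarrow> (l2_norm (cauchy_prod a g))\<^sup>2 - (l2_norm g)\<^sup>2"
    by (intro tendsto_intros l2_norm_dilate_tendsto cq gq)
  ultimately have "(l2_norm (cauchy_prod a g))\<^sup>2 - (l2_norm g)\<^sup>2 = 0"
    by (rule LIMSEQ_unique[symmetric])
  then show "l2_norm (cauchy_prod a g) = l2_norm g"
    using power2_eq_iff_nonneg[OF l2_norm_nonneg l2_norm_nonneg, of "cauchy_prod a g" g] by simp
qed

lemma cauchy_prod_diff_right: "cauchy_prod a (\<lambda>k. g k - h k) = (\<lambda>k. cauchy_prod a g k - cauchy_prod a h k)"
  by (auto simp: cauchy_prod_def fun_eq_iff right_diff_distrib sum_subtractf)

lemma cauchy_prod_add_right: "cauchy_prod a (\<lambda>k. g k + h k) = (\<lambda>k. cauchy_prod a g k + cauchy_prod a h k)"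
  by (auto simp: cauchy_prod_def fun_eq_iff distrib_left sum.distrib)

lemma cauchy_prod_cmult_right: "cauchy_prod a (\<lambda>k. c * g k) = (\<lambda>k. c * cauchy_prod a g k)"
  by (auto simp: cauchy_prod_def fun_eq_iff sum_distrib_left mult_ac)

text \<open>A coefficient of \<theta> g with index in a box involves only coefficients of g in that
  box. On every finite set g may thus be replaced by a truncation, for which the norm is already
  known to be preserved.\<close>

lemma inner_function_contraction:
  assumes \<theta>: "inner_function (power_series2 a)" and a: "square_summable a" and g: "square_summable g"
  shows "square_summable (cauchy_prod a g)" "l2_norm (cauchy_prod a g) \<le> l2_norm g"
proof -
  have "L2_set (\<lambda>k. cmod (cauchy_prod a g k)) F \<le> l2_norm g" if F: "finite F" for F
  proof -
    obtain N where N: "F \<subseteq> nat_box N" using subset_nat_box[OF F] by blast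
    have e: "cauchy_prod a g k = cauchy_prod a (trunc N g) k" if "k \<in> F" for k
    proof -
      have "fst k \<le> N" "snd k \<le> N" using that N by (auto simp: nat_box_def)
      then show ?thesis
        by (auto simp: cauchy_prod_def trunc_def nat_box_def case_prod_unfold intro!: sum.cong)
    qed
    have f: "k \<notin> nat_box N \<Longrightarrow> trunc N g k = 0" for k by (simp add: trunc_def)
    have "L2_set (\<lambda>k. cmod (cauchy_prod a g k)) F = L2_set (\<lambda>k. cmod (cauchy_prod a (trunc N g) k)) F"
      by (intro L2_set_cong) (auto simp: e)
    also have "\<dots> \<le> l2_norm (cauchy_prod a (trunc N g))"
      by (intro L2_set_le_l2_norm inner_function_isometry_finite(1)[OF \<theta> a f])
    also have "\<dots> = l2_norm (trunc N g)" by (rule inner_function_isometry_finite(2)[OF \<theta> a f])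
    also have "\<dots> \<le> l2_norm g" by (rule l2_norm_trunc_le[OF g])
    finally show ?thesis .
  qed
  then show "square_summable (cauchy_prod a g)" "l2_norm (cauchy_prod a g) \<le> l2_norm g"
    by (auto intro: square_summableI)
qed

lemma inner_function_isometry:
  assumes \<theta>: "inner_function (power_series2 a)" and a: "square_summable a" and g: "square_summable g"
  shows "l2_norm (cauchy_prod a g) = l2_norm g"
proof (rule antisym)
  show "l2_norm (cauchy_prod a g) \<le> l2_norm g" by (rule inner_function_contraction(2)[OF assms])
  \<comment> \<open>The truncation error is lost twice: once when comparing g with its truncation,
    once when comparing their products with \<theta>.\<close>
  have "l2_norm g - 2 * l2_norm (\<lambda>k. g k - trunc N g k) \<le> l2_norm (cauchy_prod a g)" for N
  proof -
    have f: "k \<notin> nat_box N \<Longrightarrow> trunc N g k = 0" for k by (simp add: trunc_def)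
    have t: "square_summable (trunc N g)" by (rule l2_norm_trunc_le[OF g])
    have "l2_norm (trunc N g) - l2_norm (cauchy_prod a g) \<le> l2_norm (\<lambda>k. cauchy_prod a g k - cauchy_prod a (trunc N g) k)"
      using l2_norm_triangle_diff[OF inner_function_contraction(1)[OF \<theta> a g] inner_function_contraction(1)[OF \<theta> a t]]
        inner_function_isometry_finite(2)[OF \<theta> a f] by simp
    also have "\<dots> \<le> l2_norm (\<lambda>k. g k - trunc N g k)"
      unfolding cauchy_prod_diff_right[symmetric]
      by (intro inner_function_contraction(2)[OF \<theta> a] square_summable_diff g t)
    finally show ?thesis
      using l2_norm_triangle_diff[OF g t] by linarith
  qed
  moreover have "(\<lambda>N. l2_norm g - 2 * l2_norm (\<lambda>k. g k - trunc N g k)) \<longlonglongrightarrow> l2_norm g - 2 * 0"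
    by (intro tendsto_intros trunc_tendsto g)
  ultimately show "l2_norm g \<le> l2_norm (cauchy_prod a g)"
    by (intro LIMSEQ_le_const2[of _ "l2_norm g"]) auto
qed

lemma l2_norm_add_sq:
  assumes "square_summable f" "square_summable g"
  shows "(l2_norm (\<lambda>k. f k + g k))\<^sup>2 = (l2_norm f)\<^sup>2 + (l2_norm g)\<^sup>2 + 2 * Re (l2_inner f g)"
proof -
  note fg = square_summable_add(1)[OF assms]
  have right: "l2_inner h (\<lambda>k. f k + g k) = l2_inner h f + l2_inner h g" if "square_summable h" for h
    using l2_inner_add_left[OF assms that] by (metis complex_cnj_add l2_inner_cnj)
  have "l2_inner (\<lambda>k. f k + g k) (\<lambda>k. f k + g k) = l2_inner f f + l2_inner f g + (cnj (l2_inner f g) + l2_inner g g)"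
    using l2_inner_cnj[of g f] by (simp add: l2_inner_add_left[OF assms fg] right assms)
  from arg_cong[OF this, of Re] show ?thesis by (simp only: l2_inner_self) simp
qed

text \<open>Polarisation: preserved norms of f, g and f + g give equality of the real parts, and
  replacing f by \<open>\<i>\<close> f gives equality of the imaginary parts.\<close>

lemma l2_inner_cauchy_prod:
  assumes \<theta>: "inner_function (power_series2 a)" and a: "square_summable a"
    and f: "square_summable f" and g: "square_summable g"
  shows "l2_inner (cauchy_prod a f) (cauchy_prod a g) = l2_inner f g"
proof -
  have re: "Re (l2_inner (cauchy_prod a f) (cauchy_prod a g)) = Re (l2_inner f g)" 
    if f: "square_summable f" for f
    using l2_norm_add_sq[OF inner_function_contraction(1)[OF \<theta> a f] inner_function_contraction(1)[OF \<theta> a g]]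
      l2_norm_add_sq[OF f g] inner_function_isometry[OF \<theta> a f] inner_function_isometry[OF \<theta> a g] 
      inner_function_isometry[OF \<theta> a square_summable_add(1)[OF f g]]
    by (simp add: cauchy_prod_add_right)
  from re[OF f] re[OF square_summable_cmult[OF f, of "\<i>"]] show ?thesis
    by (simp add: cauchy_prod_cmult_right l2_inner_cmult_left complex_eq_iff)
qed

section \<open>Point evaluations\<close>

text \<open>The coefficients of the Szego kernel at (z, w). They are conjugated because
  \<open>l2_inner\<close> conjugates its second argument.\<close>

definition kernel :: "complex \<Rightarrow> complex \<Rightarrow> nat \<times> nat \<Rightarrow> complex" where
  "kernel z w = (\<lambda>(m, n). cnj (z ^ m * w ^ n))"

lemma kernel_square_summable:
  assumes "cmod z < 1" "cmod w < 1"
  shows "square_summable (kernel z w)"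
  using geometric2_summable[OF assms]
  by (intro square_summable_l1) (simp add: kernel_def case_prod_unfold norm_mult norm_power)

lemma l2_inner_kernel:
  assumes "cmod z < 1" "cmod w < 1"
  shows "l2_inner a (kernel z w) = power_series2 a (z, w)"
  using assms by (simp add: l2_inner_def power_series2_eq kernel_def case_prod_unfold mult.assoc)

text \<open>All powers of \<theta> have the same norm as the constant 1, and point evaluation is
  bounded. Hence the numbers |\<theta>(x)|^n are bounded in n, which rules out |\<theta>(x)| > 1
  without any maximum principle.\<close>

lemma inner_function_le_1:
  assumes \<theta>: "inner_function (power_series2 a)" and a: "square_summable a"
  shows "cmod (power_series2 a x) \<le> 1"
proof (cases "x \<in> bidisk")
  case True
  then obtain z w where x: "x = (z, w)" and zw: "cmod z < 1" "cmod w < 1" by (cases x) auto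
  have ad: "disk_summable a" by (rule disk_summable_l2[OF a])
  let ?u = unit_coeffs
  have p: "square_summable ((cauchy_prod a ^^ n) ?u) \<and> l2_norm ((cauchy_prod a ^^ n) ?u) = l2_norm ?u
     \<and> power_series2 ((cauchy_prod a ^^ n) ?u) (z, w) = power_series2 a (z, w) ^ n" for n
  proof (induction n)
    case (Suc n)
    then show ?case
      using inner_function_contraction(1)[OF \<theta> a] inner_function_isometry[OF \<theta> a]
        power_series2_cauchy_prod[OF ad disk_summable_l2] by auto
  qed (simp add: square_summable_unit power_series2_unit zw)
  have "cmod (power_series2 a (z, w)) ^ n \<le> l2_norm ?u * l2_norm (kernel z w)" for n
    using l2_inner_bound[OF _ kernel_square_summable[OF zw], of "(cauchy_prod a ^^ n) ?u"] p[of n]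
    by (simp add: l2_inner_kernel zw norm_power)
  then show ?thesis unfolding x
    using real_arch_pow[of "cmod (power_series2 a (z, w))"] by (meson not_le)
qed (simp add: power_series2_outside)

section \<open>Hardy space arithmetic\<close>

definition shift :: "nat \<Rightarrow> nat \<Rightarrow> (nat \<times> nat \<Rightarrow> complex) \<Rightarrow> nat \<times> nat \<Rightarrow> complex" where
  "shift i j a = (\<lambda>(m, n). if i \<le> m \<and> j \<le> n then a (m - i, n - j) else 0)"

lemma has_sum_shift:
  fixes f :: "nat \<times> nat \<Rightarrow> 'b :: {comm_monoid_add, t2_space}"
  assumes "(f has_sum s) UNIV" "\<And>m n. g (m + i, n + j) = f (m, n)"
    and "\<And>m n. \<not> (i \<le> m \<and> j \<le> n) \<Longrightarrow> g (m, n) = 0"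
  shows "(g has_sum s) UNIV"
proof -
  have bij: "bij_betw (\<lambda>(m, n). (m + i, n + j)) UNIV ({i..} \<times> {j..})"
    by (rule bij_betwI[where g = "\<lambda>(m, n). (m - i, n - j)"]) auto
  have "(g has_sum s) ({i..} \<times> {j..})"
    using has_sum_reindex_bij_betw[OF bij, of g s] assms(1,2) by (simp add: case_prod_unfold)
  then show ?thesis
    by (rule has_sum_cong_neutral[THEN iffD1, rotated -1]) (use assms(3) in auto)
qed

lemma power_series2_shift:
  assumes "disk_summable a" "cmod z < 1" "cmod w < 1"
  shows "power_series2 (shift i j a) (z, w) = z ^ i * w ^ j * power_series2 a (z, w)"
  by (rule power_series2I[OF assms(2,3)], rule has_sum_shift[OF has_sum_cmult_right[OF power_series2_has_sum[OF assms]]])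
    (auto simp: shift_def power_add mult_ac)

lemma l2_inner_shift:
  assumes "square_summable a" "square_summable b"
  shows "l2_inner (shift i j a) (shift i j b) = l2_inner a b"
  unfolding l2_inner_def
  by (rule infsumI, rule has_sum_shift[OF has_sum_infsum[OF l2_inner_summable[OF assms]]]) (auto simp: shift_def)

lemma square_summable_shift:
  assumes "square_summable a"
  shows "square_summable (shift i j a)" "l2_norm (shift i j a) = l2_norm a"
proof -
  have h: "((\<lambda>k. (cmod (shift i j a k))\<^sup>2) has_sum (\<Sum>\<^sub>\<infinity>k. (cmod (a k))\<^sup>2)) UNIV"
    using assms unfolding square_summable_def
    by (intro has_sum_shift[OF has_sum_infsum]) (auto simp: shift_def)
  then show "square_summable (shift i j a)"
    unfolding square_summable_def by (rule has_sum_imp_summable)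
  show "l2_norm (shift i j a) = l2_norm a"
    unfolding l2_norm_def by (simp only: infsumI[OF h])
qed

lemma hardy2I: "square_summable a \<Longrightarrow> power_series2 a \<in> hardy2"
  by (simp add: hardy2_def)

lemma hardy2E:
  assumes "f \<in> hardy2"
  obtains a where "square_summable a" "f = power_series2 a"
  using assms by (auto simp: hardy2_def)

lemma hardy2_outside: "f \<in> hardy2 \<Longrightarrow> x \<notin> bidisk \<Longrightarrow> f x = 0"
  by (auto elim!: hardy2E simp: power_series2_outside)

lemma hardy_coeff_power_series2 [simp]:
  assumes "square_summable a"
  shows "hardy_coeff (power_series2 a) = a"
  unfolding hardy_coeff_def
  using assms by (auto intro!: the_equality power_series2_inj disk_summable_l2)

lemma hinner_power_series2 [simp]:
  assumes "square_summable a" "square_summable b"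
  shows "hinner (power_series2 a) (power_series2 b) = l2_inner a b"
  using assms by (simp add: hinner_def l2_inner_def)

lemma hnorm_power_series2 [simp]:
  assumes "square_summable a"
  shows "hnorm (power_series2 a) = l2_norm a"
  using assms by (simp add: hnorm_def l2_inner_self l2_norm_nonneg del: of_real_power)

lemma hardy2_add:
  assumes "f \<in> hardy2" "g \<in> hardy2"
  shows "(\<lambda>x. f x + g x) \<in> hardy2"
  using assms
  by (elim hardy2E)
    (simp add: hardy2I square_summable_add disk_summable_l2 flip: power_series2_add)

lemma hardy2_cmult:
  assumes "f \<in> hardy2"
  shows "(\<lambda>x. c * f x) \<in> hardy2"
  using assms
  by (elim hardy2E) (simp add: hardy2I square_summable_cmult flip: power_series2_cmult)

lemma hardy2_diff:
  assumes "f \<in> hardy2" "g \<in> hardy2"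
  shows "(\<lambda>x. f x - g x) \<in> hardy2"
  using hardy2_add[OF assms(1) hardy2_cmult[OF assms(2), of "-1"]] by simp

lemma hinner_add_left:
  assumes "f \<in> hardy2" "g \<in> hardy2" "h \<in> hardy2"
  shows "hinner (\<lambda>x. f x + g x) h = hinner f h + hinner g h"
  using assms
  by (elim hardy2E)
    (simp add: square_summable_add l2_inner_add_left disk_summable_l2 flip: power_series2_add)

lemma hinner_cmult_left:
  assumes "f \<in> hardy2" "g \<in> hardy2"
  shows "hinner (\<lambda>x. c * f x) g = c * hinner f g"
  using assms
  by (elim hardy2E) (simp add: square_summable_cmult l2_inner_cmult_left flip: power_series2_cmult)

lemma hinner_diff_left:
  assumes "f \<in> hardy2" "g \<in> hardy2" "h \<in> hardy2"
  shows "hinner (\<lambda>x. f x - g x) h = hinner f h - hinner g h"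
proof -
  have "(\<lambda>x. f x - g x) = (\<lambda>x. f x + - 1 * g x)" by simp
  then show ?thesis
    by (simp only: hinner_add_left[OF assms(1) hardy2_cmult[OF assms(2)] assms(3)] hinner_cmult_left[OF assms(2,3)]) simp
qed

lemma hinner_cnj: "f \<in> hardy2 \<Longrightarrow> g \<in> hardy2 \<Longrightarrow> hinner f g = cnj (hinner g f)"
  by (elim hardy2E) (simp, rule l2_inner_cnj)

lemma hnorm_nonneg: "f \<in> hardy2 \<Longrightarrow> 0 \<le> hnorm f"
  by (elim hardy2E) (simp add: l2_norm_nonneg)

lemma hinner_self: "f \<in> hardy2 \<Longrightarrow> hinner f f = of_real ((hnorm f)\<^sup>2)"
  by (elim hardy2E) (simp add: l2_inner_self)

lemma hinner_bound: "f \<in> hardy2 \<Longrightarrow> g \<in> hardy2 \<Longrightarrow> cmod (hinner f g) \<le> hnorm f * hnorm g"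
  by (elim hardy2E) (simp add: l2_inner_bound)

lemma hnorm_add_le: "f \<in> hardy2 \<Longrightarrow> g \<in> hardy2 \<Longrightarrow> hnorm (\<lambda>x. f x + g x) \<le> hnorm f + hnorm g"
  by (elim hardy2E)
    (simp add: square_summable_add disk_summable_l2 flip: power_series2_add)

lemma hnorm_cmult: "f \<in> hardy2 \<Longrightarrow> hnorm (\<lambda>x. c * f x) = cmod c * hnorm f"
  by (elim hardy2E) (simp add: square_summable_cmult l2_norm_cmult flip: power_series2_cmult)

lemma hnorm_eq_0:
  assumes "f \<in> hardy2" "hnorm f = 0"
  shows "f x = 0"
  using assms
proof (elim hardy2E)
  fix a assume a: "square_summable a" "f = power_series2 a"
  then have "a k = 0" for k using assms by (intro l2_norm_eq_0) auto
  then show ?thesis unfolding a by (simp add: power_series2_def case_prod_unfold)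
qed

lemma mult_monomial:
  assumes "f \<in> hardy2"
  shows "(\<lambda>x. fst x ^ i * f x) \<in> hardy2" "hnorm (\<lambda>x. fst x ^ i * f x) = hnorm f"
proof -
  obtain a where a: "square_summable a" "f = power_series2 a" using assms by (rule hardy2E)
  have "(\<lambda>x. fst x ^ i * f x) = power_series2 (shift i 0 a)"
    by (rule bidisk_ext)
      (simp_all add: a power_series2_shift disk_summable_l2 power_series2_outside)
  then show "(\<lambda>x. fst x ^ i * f x) \<in> hardy2" "hnorm (\<lambda>x. fst x ^ i * f x) = hnorm f"
    using a square_summable_shift[of a i 0] by (simp_all add: hardy2I)
qed

lemma mult_z_hardy2: "f \<in> hardy2 \<Longrightarrow> (\<lambda>x. fst x * f x) \<in> hardy2"
  using mult_monomial(1)[of f 1] by simp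

lemma hardy2_kernel:
  assumes "cmod z < 1" "cmod w < 1"
  obtains k where "k \<in> hardy2" "0 < hnorm k" "\<And>f. f \<in> hardy2 \<Longrightarrow> hinner f k = f (z, w)"
proof
  let ?k = "power_series2 (kernel z w)"
  note k = kernel_square_summable[OF assms]
  show "?k \<in> hardy2" by (rule hardy2I[OF k])
  have "1 = cmod (kernel z w (0, 0))" by (simp add: kernel_def)
  also have "\<dots> \<le> l2_norm (kernel z w)" by (rule cmod_le_l2_norm[OF k])
  finally show "0 < hnorm ?k" using k by simp
  show "hinner f ?k = f (z, w)" if "f \<in> hardy2" for f
    using that by (elim hardy2E) (simp add: k l2_inner_kernel assms)
qed

lemma hardy2_multiplier:
  assumes A: "disk_summable A" and r0: "r0 < 1"
    and b: "\<And>z w r. \<lbrakk>r0 < r; r < 1; cmod z = r; cmod w = r\<rbrakk> \<Longrightarrow> cmod (power_series2 A (z, w)) \<le> C"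
    and C: "0 \<le> C" and f: "f \<in> hardy2"
  shows "(\<lambda>x. power_series2 A x * f x) \<in> hardy2" "hnorm (\<lambda>x. power_series2 A x * f x) \<le> C * hnorm f"
proof -
  obtain g where g: "square_summable g" "f = power_series2 g" using f by (rule hardy2E)
  note m = multiplier_of_bounded[OF A g(1) r0 b C]
  show "(\<lambda>x. power_series2 A x * f x) \<in> hardy2" "hnorm (\<lambda>x. power_series2 A x * f x) \<le> C * hnorm f"
    using m hardy2I[OF m(1)] g
    unfolding g(2) power_series2_cauchy_prod[OF A disk_summable_l2[OF g(1)], symmetric]
    by simp_all
qed

text \<open>Grouping the absolutely convergent double series by powers of z exhibits a power series
  in one variable. Analytic continuation and Hurwitz's theorem are only ever applied to such
  sections.\<close>

lemma holomorphic_section_z: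
  assumes "disk_summable a" "cmod w < 1"
  shows "(\<lambda>z. power_series2 a (z, w)) holomorphic_on ball 0 1"
proof (rule power_series_holomorphic[where a = "\<lambda>m. \<Sum>\<^sub>\<infinity>n. a (m, n) * w ^ n"])
  fix z :: complex assume "z \<in> ball 0 1"
  then have z: "cmod z < 1" by simp
  have h: "((\<lambda>(m, n). a (m, n) * z ^ m * w ^ n) has_sum power_series2 a (z, w)) (SIGMA m:UNIV. UNIV)"
    using power_series2_has_sum[OF assms(1) z assms(2)] by simp
  have "(\<lambda>m. \<Sum>\<^sub>\<infinity>n. a (m, n) * z ^ m * w ^ n) summable_on UNIV"
    using summable_on_Sigma_banach[of "\<lambda>m n. a (m, n) * z ^ m * w ^ n"] has_sum_imp_summable[OF h] by simp
  moreover have "(\<Sum>\<^sub>\<infinity>m. \<Sum>\<^sub>\<infinity>n. a (m, n) * z ^ m * w ^ n) = power_series2 a (z, w)"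
    using infsum_Sigma'_banach[of "\<lambda>m n. a (m, n) * z ^ m * w ^ n" UNIV "\<lambda>_. UNIV"] has_sum_imp_summable[OF h] infsumI[OF h]
    by simp
  ultimately have "((\<lambda>m. \<Sum>\<^sub>\<infinity>n. a (m, n) * z ^ m * w ^ n) has_sum power_series2 a (z, w)) UNIV"
    by (simp add: has_sum_iff)
  from has_sum_imp_sums[OF this]
  show "(\<lambda>m. (\<Sum>\<^sub>\<infinity>n. a (m, n) * w ^ n) * (z - 0) ^ m) sums power_series2 a (z, w)"
    by (simp add: mult.commute[of _ "z ^ _"] mult.left_commute[of _ "z ^ _"] mult.assoc infsum_cmult_right')
qed

lemma holomorphic_section_w:
  assumes "disk_summable a" "cmod z < 1"
  shows "(\<lambda>w. power_series2 a (z, w)) holomorphic_on ball 0 1"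
proof -
  define b where "b = (\<lambda>(m, n). a (n, m))"
  have bij: "bij_betw prod.swap UNIV (UNIV :: (nat \<times> nat) set)" by simp
  have "disk_summable b"
    unfolding disk_summable_def
  proof (intro allI impI)
    fix r :: real assume "0 \<le> r \<and> r < 1"
    then have "(\<lambda>(m, n). cmod (a (m, n)) * r ^ (m + n)) summable_on UNIV"
      using assms(1) by (simp add: disk_summable_def)
    then show "(\<lambda>(m, n). cmod (b (m, n)) * r ^ (m + n)) summable_on UNIV"
      by (subst (asm) summable_on_reindex_bij_betw[OF bij, symmetric])
        (simp add: b_def case_prod_unfold add.commute prod.swap_def)
  qed
  moreover have "power_series2 b (w, z) = power_series2 a (z, w)" if "w \<in> ball 0 1" for w
  proof (rule power_series2I)
    have "((\<lambda>(m, n). a (m, n) * z ^ m * w ^ n) has_sum power_series2 a (z, w)) UNIV"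
      using assms that by (intro power_series2_has_sum) auto
    then show "((\<lambda>(m, n). b (m, n) * w ^ m * z ^ n) has_sum power_series2 a (z, w)) UNIV"
      by (subst (asm) has_sum_reindex_bij_betw[OF bij, symmetric])
        (simp add: b_def case_prod_unfold mult_ac prod.swap_def)
  qed (use assms that in auto)
  ultimately show ?thesis
    using assms(2) by (intro holomorphic_transform[OF holomorphic_section_z[of b z]]) auto
qed

section \<open>The model space\<close>

locale inner_fun =
  fixes \<theta> :: "complex \<times> complex \<Rightarrow> complex"
  assumes inner: "inner_function \<theta>"
begin

definition coeffs_\<theta> :: "nat \<times> nat \<Rightarrow> complex" where
  "coeffs_\<theta> = hardy_coeff \<theta>"

abbreviation K :: "(complex \<times> complex \<Rightarrow> complex) set" where "K \<equiv> model_space \<theta>"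

abbreviation P :: "(complex \<times> complex \<Rightarrow> complex) \<Rightarrow> complex \<times> complex \<Rightarrow> complex" where "P \<equiv> hardy_proj K"

lemma \<theta>_hardy2: "\<theta> \<in> hardy2"
  using inner by (simp add: inner_function_def)

lemma coeffs_\<theta>: "square_summable coeffs_\<theta>" "power_series2 coeffs_\<theta> = \<theta>"
  using \<theta>_hardy2 by (auto elim!: hardy2E simp: coeffs_\<theta>_def)

lemma disk_coeffs: "disk_summable coeffs_\<theta>"
  by (rule disk_summable_l2[OF coeffs_\<theta>(1)])

lemma inner': "inner_function (power_series2 coeffs_\<theta>)"
  by (simp add: coeffs_\<theta>(2) inner)

lemma \<theta>_le_1: "cmod (\<theta> x) \<le> 1"
  using inner_function_le_1[OF inner' coeffs_\<theta>(1)] by (simp add: coeffs_\<theta>(2))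

lemma \<theta>_mult_power_series2:
  "square_summable a \<Longrightarrow> (\<lambda>x. \<theta> x * power_series2 a x) = power_series2 (cauchy_prod coeffs_\<theta> a)"
  by (simp add: power_series2_cauchy_prod disk_coeffs disk_summable_l2 coeffs_\<theta>(2))

lemma \<theta>_mult: "f \<in> hardy2 \<Longrightarrow> (\<lambda>x. \<theta> x * f x) \<in> hardy2"
  by (elim hardy2E) (simp add: \<theta>_mult_power_series2 hardy2I inner_function_contraction(1)[OF inner' coeffs_\<theta>(1)])

lemma hinner_\<theta>: "f \<in> hardy2 \<Longrightarrow> g \<in> hardy2 \<Longrightarrow> hinner (\<lambda>x. \<theta> x * f x) (\<lambda>x. \<theta> x * g x) = hinner f g"
  by (elim hardy2E) (simp add: \<theta>_mult_power_series2 inner_function_contraction(1)[OF inner' coeffs_\<theta>(1)] l2_inner_cauchy_prod[OF inner' coeffs_\<theta>(1)])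

lemma mem_K: "f \<in> K \<longleftrightarrow> f \<in> hardy2 \<and> (\<forall>g\<in>hardy2. hinner f (\<lambda>x. \<theta> x * g x) = 0)"
  by (auto simp: model_space_def hardy_ominus_def)

lemma K_hardy2: "f \<in> K \<Longrightarrow> f \<in> hardy2" by (simp add: mem_K)

lemma K_add: "f \<in> K \<Longrightarrow> g \<in> K \<Longrightarrow> (\<lambda>x. f x + g x) \<in> K"
  by (auto simp: mem_K hardy2_add hinner_add_left \<theta>_mult)

lemma K_cmult: "f \<in> K \<Longrightarrow> (\<lambda>x. c * f x) \<in> K"
  by (auto simp: mem_K hardy2_cmult hinner_cmult_left \<theta>_mult)

lemma K_diff: "f \<in> K \<Longrightarrow> g \<in> K \<Longrightarrow> (\<lambda>x. f x - g x) \<in> K"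
  by (auto simp: mem_K hardy2_diff hinner_diff_left \<theta>_mult)

lemma K_orthogonal: "f \<in> K \<Longrightarrow> g \<in> hardy2 \<Longrightarrow> hinner (\<lambda>x. \<theta> x * g x) f = 0"
  using hinner_cnj[OF \<theta>_mult K_hardy2] by (simp add: mem_K)

text \<open>The range of multiplication by \<open>\<theta>\<close> is closed: the coefficients of the orthogonal projection
  onto it, divided by \<open>\<theta>\<close>, are the Fourier coefficients with respect to the orthonormal family
  \<open>z\<^sup>m w\<^sup>n \<theta>\<close>.\<close>

lemma orthogonal_decomposition:
  assumes "f \<in> hardy2"
  obtains g b where "g \<in> K" "b \<in> hardy2" "f = (\<lambda>x. g x + \<theta> x * b x)"
proof -
  obtain a where a: "square_summable a" "f = power_series2 a" using assms by (rule hardy2E)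
  let ?m = "cauchy_prod coeffs_\<theta>"
  note m = inner_function_contraction[OF inner' coeffs_\<theta>(1)]
  define \<delta> where "\<delta> k = (\<lambda>l :: nat \<times> nat. if l = k then 1 else 0 :: complex)" for k
  define \<beta> where "\<beta> k = l2_inner a (?m (\<delta> k))" for k
  have fs: "square_summable g" if "finite F" "\<And>k. k \<notin> F \<Longrightarrow> g k = 0" for g F
    unfolding square_summable_def
    by (rule finite_nonzero_values_imp_summable_on, rule finite_subset[OF _ that(1)]) (use that in auto)
  have \<delta>: "square_summable (\<delta> k)" for k by (rule fs[of "{k}"]) (auto simp: \<delta>_def)
  have fin: "l2_inner a (?m g) = (\<Sum>k\<in>F. \<beta> k * cnj (g k))" if F: "finite F" and g: "\<And>k. k \<notin> F \<Longrightarrow> g k = 0" for F g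
    using that
  proof (induction F arbitrary: g rule: finite_induct)
    case empty
    then have "?m g = (\<lambda>_. 0)" by (auto simp: cauchy_prod_def)
    then show ?case by (simp add: l2_inner_def)
  next
    case (insert k F)
    define h where "h = (\<lambda>l. if l = k then 0 else g l)"
    have h0: "l \<notin> F \<Longrightarrow> h l = 0" for l using insert.prems by (auto simp: h_def)
    have hs: "square_summable h" using insert.hyps h0 by (intro fs) auto
    have e: "g = (\<lambda>l. g k * \<delta> k l + h l)" by (auto simp: h_def \<delta>_def)
    have "l2_inner (?m g) a = l2_inner (\<lambda>l. g k * ?m (\<delta> k) l + ?m h l) a"
      by (subst e) (simp only: cauchy_prod_add_right cauchy_prod_cmult_right)
    also have "\<dots> = g k * l2_inner (?m (\<delta> k)) a + l2_inner (?m h) a"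
      by (subst l2_inner_add_left) (auto intro!: square_summable_cmult m \<delta> hs a simp: l2_inner_cmult_left)
    finally have "l2_inner a (?m g) = cnj (g k) * \<beta> k + l2_inner a (?m h)"
      by (subst (1 2) l2_inner_cnj) (simp add: \<beta>_def l2_inner_cnj[of a])
    also have "l2_inner a (?m h) = (\<Sum>l\<in>F. \<beta> l * cnj (h l))" by (rule insert.IH[OF h0])
    also have "\<dots> = (\<Sum>l\<in>F. \<beta> l * cnj (g l))"
      using insert.hyps by (intro sum.cong) (auto simp: h_def)
    finally show ?case using insert.hyps by (simp add: mult.commute)
  qed
  have "L2_set (\<lambda>k. cmod (\<beta> k)) F \<le> l2_norm a" if F: "finite F" for F
  proof -
    \<comment> \<open>Bessel's inequality by duality: testing against \<beta> restricted to F gives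
      ||g||^2 \<le> ||a|| ||g||, because multiplication by \<theta> does not increase norms.\<close>
    define g where "g = (\<lambda>k. if k \<in> F then \<beta> k else 0)"
    have g: "square_summable g" by (rule fs[OF F]) (auto simp: g_def)
    let ?s = "\<Sum>k\<in>F. (cmod (\<beta> k))\<^sup>2"
    have s0: "0 \<le> ?s" by (intro sum_nonneg) auto
    have "(l2_norm g)\<^sup>2 = ?s"
      unfolding l2_norm_sq
      by (intro infsumI has_sum_finite_neutralI[where B = F]) (auto simp: g_def F)
    then have ng: "l2_norm g = L2_set (\<lambda>k. cmod (\<beta> k)) F"
      unfolding L2_set_def using l2_norm_nonneg by (metis real_sqrt_unique)
    have "l2_inner a (?m g) = (\<Sum>k\<in>F. \<beta> k * cnj (g k))"
      by (rule fin[OF F]) (simp add: g_def)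
    also have "\<dots> = of_real ?s"
      unfolding of_real_sum by (intro sum.cong) (auto simp: g_def complex_norm_square simp del: of_real_power)
    finally have "?s \<le> l2_norm a * l2_norm (?m g)"
      using l2_inner_bound[OF a(1) m(1)[OF g]] s0 by (metis abs_of_nonneg norm_of_real)
    also have "\<dots> \<le> l2_norm a * l2_norm g"
      by (intro mult_left_mono m g l2_norm_nonneg)
    finally have "(l2_norm g)\<^sup>2 \<le> l2_norm a * l2_norm g" using \<open>(l2_norm g)\<^sup>2 = ?s\<close> by simp
    then have "l2_norm g \<le> l2_norm a"
      using l2_norm_nonneg[of g] l2_norm_nonneg[of a] by (cases "l2_norm g = 0") (auto simp: power2_eq_square)
    then show ?thesis by (simp add: ng)
  qed
  then have \<beta>: "square_summable \<beta>" by (rule square_summableI)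
  \<comment> \<open>Thus \<beta> is the adjoint of multiplication by \<theta> applied to
    \<open>a\<close>. Consequently a - \<theta> \<beta> is orthogonal to every \<theta> g, by the
    isometry.\<close>
  have adj: "l2_inner a (?m g) = l2_inner \<beta> g" if g: "square_summable g" for g
  proof (rule LIMSEQ_unique)
    show "(\<lambda>N. \<Sum>k\<in>nat_box N. \<beta> k * cnj (g k)) \<longlonglongrightarrow> l2_inner \<beta> g"
      unfolding l2_inner_def by (intro sum_nat_box_tendsto has_sum_infsum l2_inner_summable \<beta> g)
    have eq: "l2_inner a (?m g) - (\<Sum>k\<in>nat_box N. \<beta> k * cnj (g k)) = l2_inner a (?m (\<lambda>k. g k - trunc N g k))" for N
    proof -
      note t = l2_norm_trunc_le(1)[OF g, of N]
      have "(\<Sum>k\<in>nat_box N. \<beta> k * cnj (g k)) = (\<Sum>k\<in>nat_box N. \<beta> k * cnj (trunc N g k))"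
        by (intro sum.cong) (auto simp: trunc_def)
      also have "\<dots> = l2_inner a (?m (trunc N g))"
        by (rule fin[symmetric]) (auto simp: trunc_def)
      finally have s: "(\<Sum>k\<in>nat_box N. \<beta> k * cnj (g k)) = l2_inner a (?m (trunc N g))" .
      have "l2_inner (?m g) a = l2_inner (\<lambda>k. ?m (\<lambda>k. g k - trunc N g k) k + ?m (trunc N g) k) a"
        by (simp add: cauchy_prod_diff_right)
      also have "\<dots> = l2_inner (?m (\<lambda>k. g k - trunc N g k)) a + l2_inner (?m (trunc N g)) a"
        by (intro l2_inner_add_left m square_summable_diff g t a)
      finally have "l2_inner a (?m g) = l2_inner a (?m (\<lambda>k. g k - trunc N g k)) + l2_inner a (?m (trunc N g))"
        by (subst (1 2 3) l2_inner_cnj) simp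
      with s show ?thesis by simp
    qed
    have bd: "cmod (l2_inner a (?m g) - (\<Sum>k\<in>nat_box N. \<beta> k * cnj (g k))) \<le> l2_norm a * l2_norm (\<lambda>k. g k - trunc N g k)" for N
    proof -
      have d: "square_summable (\<lambda>k. g k - trunc N g k)" by (intro square_summable_diff g l2_norm_trunc_le)
      have "cmod (l2_inner a (?m (\<lambda>k. g k - trunc N g k))) \<le> l2_norm a * l2_norm (?m (\<lambda>k. g k - trunc N g k))"
        by (intro l2_inner_bound a m d)
      also have "\<dots> \<le> l2_norm a * l2_norm (\<lambda>k. g k - trunc N g k)"
        by (intro mult_left_mono m d l2_norm_nonneg)
      finally show ?thesis by (simp only: eq)
    qed
    have "(\<lambda>N. l2_norm a * l2_norm (\<lambda>k. g k - trunc N g k)) \<longlonglongrightarrow> l2_norm a * 0"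
      by (intro tendsto_intros trunc_tendsto g)
    then have l: "(\<lambda>N. l2_norm a * l2_norm (\<lambda>k. g k - trunc N g k)) \<longlonglongrightarrow> 0" by simp
    have "(\<lambda>N. l2_inner a (?m g) - (\<Sum>k\<in>nat_box N. \<beta> k * cnj (g k))) \<longlonglongrightarrow> 0"
      by (rule Lim_null_comparison[OF always_eventually l]) (use bd in auto)
    then show "(\<lambda>N. \<Sum>k\<in>nat_box N. \<beta> k * cnj (g k)) \<longlonglongrightarrow> l2_inner a (?m g)"
      by (rule Lim_transform2[OF tendsto_const])
  qed
  show ?thesis
  proof
    show "power_series2 \<beta> \<in> hardy2" by (rule hardy2I[OF \<beta>])
    let ?g = "\<lambda>x. f x - \<theta> x * power_series2 \<beta> x"
    have th: "(\<lambda>x. \<theta> x * power_series2 \<beta> x) \<in> hardy2" by (intro \<theta>_mult hardy2I \<beta>)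
    show "?g \<in> K" unfolding mem_K
    proof (intro conjI ballI hardy2_diff assms th)
      fix h assume h: "h \<in> hardy2"
      then obtain c where c: "square_summable c" "h = power_series2 c" by (rule hardy2E)
      have "hinner ?g (\<lambda>x. \<theta> x * h x) = hinner f (\<lambda>x. \<theta> x * h x) - hinner (power_series2 \<beta>) h"
        by (simp add: hinner_diff_left assms th \<theta>_mult h hinner_\<theta> hardy2I \<beta>)
      also have "hinner f (\<lambda>x. \<theta> x * h x) = l2_inner a (?m c)"
        by (simp add: a c \<theta>_mult_power_series2 m)
      finally show "hinner ?g (\<lambda>x. \<theta> x * h x) = 0" by (simp add: adj c \<beta>)
    qed
  qed auto
qed

text \<open>As \<open>hardy_proj\<close> is a definite description, its value is found by exhibiting
  a decomposition. Uniqueness holds because the difference of two candidates lies in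
  \<open>K\<close> and is orthogonal to itself.\<close>

lemma proj_eqI:
  assumes "g \<in> K" "b \<in> hardy2"
  shows "P (\<lambda>x. g x + \<theta> x * b x) = g"
  unfolding hardy_proj_def
proof (rule the_equality)
  show "g \<in> K \<and> (\<forall>h\<in>K. hinner (\<lambda>x. g x + \<theta> x * b x - g x) h = 0)"
    using assms K_orthogonal by simp
  fix g' assume g': "g' \<in> K \<and> (\<forall>h\<in>K. hinner (\<lambda>x. g x + \<theta> x * b x - g' x) h = 0)"
  have d: "(\<lambda>x. g x - g' x) \<in> K" using assms g' by (intro K_diff) auto
  have "hinner (\<lambda>x. (g x - g' x) + \<theta> x * b x) (\<lambda>x. g x - g' x) = 0"
    using g' d by (simp add: algebra_simps)
  then have "hinner (\<lambda>x. g x - g' x) (\<lambda>x. g x - g' x) = 0"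
    using hinner_add_left[OF K_hardy2[OF d] \<theta>_mult[OF assms(2)] K_hardy2[OF d]] K_orthogonal[OF d assms(2)] by simp
  then have "hnorm (\<lambda>x. g x - g' x) = 0"
    using hinner_self[OF K_hardy2[OF d]] by simp
  from hnorm_eq_0[OF K_hardy2[OF d] this] show "g' = g" by auto
qed

text \<open>Elements of the Hardy space vanish outside the bidisk, so an identity on the bidisk is
  enough. The Bezout identities used for resolvents hold only there.\<close>

lemma proj_eqI':
  assumes "g \<in> K" "b \<in> hardy2" "\<And>x. x \<in> bidisk \<Longrightarrow> f x = g x + \<theta> x * b x" "f \<in> hardy2"
  shows "P f = g"
proof -
  have "f x = g x + \<theta> x * b x" for x
    using assms hardy2_outside[OF assms(4)] hardy2_outside[OF K_hardy2[OF assms(1)]] hardy2_outside[OF assms(2)]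
    by (cases "x \<in> bidisk") (simp_all del: mem_bidisk)
  then have "f = (\<lambda>x. g x + \<theta> x * b x)" by auto
  then show ?thesis using proj_eqI[OF assms(1,2)] by simp
qed

lemma proj_decomp:
  assumes "f \<in> hardy2"
  obtains b where "P f \<in> K" "b \<in> hardy2" "f = (\<lambda>x. P f x + \<theta> x * b x)"
  using orthogonal_decomposition[OF assms] proj_eqI by metis

lemma proj_K: "f \<in> hardy2 \<Longrightarrow> P f \<in> K"
  using proj_decomp by blast

lemma proj_norm:
  assumes "f \<in> hardy2"
  shows "hnorm (P f) \<le> hnorm f"
proof -
  obtain b where b: "P f \<in> K" "b \<in> hardy2" "f = (\<lambda>x. P f x + \<theta> x * b x)" using proj_decomp[OF assms] .
  have "hinner f (P f) = hinner (P f) (P f)"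
    using arg_cong[OF b(3), of "\<lambda>u. hinner u (P f)"]
      hinner_add_left[OF K_hardy2[OF b(1)] \<theta>_mult[OF b(2)] K_hardy2[OF b(1)]] K_orthogonal[OF b(1,2)]
    by simp
  then have "(hnorm (P f))\<^sup>2 \<le> hnorm f * hnorm (P f)"
    using hinner_bound[OF assms K_hardy2[OF b(1)]] hinner_self[OF K_hardy2[OF b(1)]]
    by (simp add: norm_power)
  then show ?thesis
    using hnorm_nonneg[OF K_hardy2[OF b(1)]] hnorm_nonneg[OF assms]
    by (cases "hnorm (P f) = 0") (simp_all add: power2_eq_square)
qed

lemma proj_add:
  assumes "f \<in> hardy2" "g \<in> hardy2"
  shows "P (\<lambda>x. f x + g x) = (\<lambda>x. P f x + P g x)"
proof -
  obtain b where b: "P f \<in> K" "b \<in> hardy2" "f = (\<lambda>x. P f x + \<theta> x * b x)" using proj_decomp[OF assms(1)] .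
  obtain c where c: "P g \<in> K" "c \<in> hardy2" "g = (\<lambda>x. P g x + \<theta> x * c x)" using proj_decomp[OF assms(2)] .
  show ?thesis
  proof (rule proj_eqI'[OF K_add[OF b(1) c(1)] hardy2_add[OF b(2) c(2)] _ hardy2_add[OF assms]])
    show "f x + g x = P f x + P g x + \<theta> x * (b x + c x)" for x
      by (rule trans[OF arg_cong2[OF fun_cong[OF b(3), of x] fun_cong[OF c(3), of x], of "(+)"]])
        (simp only: distrib_left add_ac)
  qed
qed

lemma proj_cmult:
  assumes "f \<in> hardy2"
  shows "P (\<lambda>x. c * f x) = (\<lambda>x. c * P f x)"
proof -
  obtain b where b: "P f \<in> K" "b \<in> hardy2" "f = (\<lambda>x. P f x + \<theta> x * b x)" using proj_decomp[OF assms(1)] .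
  have e: "c * f x = c * P f x + \<theta> x * (c * b x)" for x
  proof -
    have "c * f x = c * (P f x + \<theta> x * b x)"
      using fun_cong[OF b(3), of x] by (rule arg_cong)
    also have "\<dots> = c * P f x + \<theta> x * (c * b x)" by (simp only: distrib_left mult.left_commute)
    finally show ?thesis .
  qed
  show ?thesis
    by (rule proj_eqI'[OF K_cmult[OF b(1), of c] hardy2_cmult[OF b(2), of c] e hardy2_cmult[OF assms, of c]])
qed

end

section \<open>Spectrum of the compressed shift\<close>

context inner_fun
begin

abbreviation S :: "(complex \<times> complex \<Rightarrow> complex) \<Rightarrow> complex \<times> complex \<Rightarrow> complex" where
  "S \<equiv> compressed_shift_z \<theta>"

lemma S_eq: "S f = P (\<lambda>x. fst x * f x)"
  by (simp add: compressed_shift_z_def mult_z_def)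

lemma not_in_spectrumE:
  assumes "\<mu> \<notin> op_spectrum K S"
  obtains R C where "0 < C" "\<And>f. f \<in> K \<Longrightarrow> R f \<in> K" "\<And>f. f \<in> K \<Longrightarrow> hnorm (R f) \<le> C * hnorm f"
    "\<And>f. f \<in> K \<Longrightarrow> R (\<lambda>x. S f x - \<mu> * f x) = f" "\<And>f. f \<in> K \<Longrightarrow> (\<lambda>x. S (R f) x - \<mu> * R f x) = f"
proof -
  obtain R where b: "bounded_operator_on K R"
    and R: "\<And>f. f \<in> K \<Longrightarrow> R (\<lambda>x. S f x - \<mu> * f x) = f" "\<And>f. f \<in> K \<Longrightarrow> (\<lambda>x. S (R f) x - \<mu> * R f x) = f"
    using assms unfolding op_spectrum_def by auto
  from b obtain C where C: "\<And>f. f \<in> K \<Longrightarrow> R f \<in> K" "\<And>f. f \<in> K \<Longrightarrow> hnorm (R f) \<le> C * hnorm f"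
    unfolding bounded_operator_on_def by blast
  \<comment> \<open>The constant is enlarged to be positive, since its reciprocal serves as a radius
    later.\<close>
  have "hnorm (R f) \<le> max C 1 * hnorm f" if "f \<in> K" for f
    by (rule order_trans[OF C(2)[OF that] mult_right_mono[OF _ hnorm_nonneg[OF K_hardy2[OF that]]]]) simp
  then show ?thesis using R C(1) by (intro that[of "max C 1" R]) auto
qed

text \<open>The closure is reached directly, with a quantitative form of the openness of the
  resolvent set: an inverse of S - \<nu> bounded by C is incompatible with a zero (\<mu>, w)
  satisfying |\<mu> - \<nu>| < 1/C, because testing against the kernel k gives ||k||^2 \<le> |\<mu>
  - \<nu>| C ||k||^2.\<close>

lemma zeros_in_spectrum: "closure (fst ` {x \<in> bidisk. \<theta> x = 0}) \<subseteq> op_spectrum K S"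
proof
  fix \<nu> assume cl: "\<nu> \<in> closure (fst ` {x \<in> bidisk. \<theta> x = 0})"
  show "\<nu> \<in> op_spectrum K S"
  proof (rule ccontr)
    assume "\<nu> \<notin> op_spectrum K S"
    then obtain R C where C: "0 < C" and R: "\<And>f. f \<in> K \<Longrightarrow> R f \<in> K" "\<And>f. f \<in> K \<Longrightarrow> hnorm (R f) \<le> C * hnorm f"
      "\<And>f. f \<in> K \<Longrightarrow> (\<lambda>x. S (R f) x - \<nu> * R f x) = f"
      by (rule not_in_spectrumE) blast
    have "0 < 1 / C" using C by simp
    with cl obtain y where y: "y \<in> fst ` {x \<in> bidisk. \<theta> x = 0}" "dist y \<nu> < 1 / C"
      unfolding closure_approachable by blast
    then obtain \<mu> w where \<mu>: "cmod \<mu> < 1" "cmod w < 1" "\<theta> (\<mu>, w) = 0" "dist \<mu> \<nu> < 1 / C"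
      by auto
    obtain k where k: "k \<in> hardy2" "0 < hnorm k" "\<And>f. f \<in> hardy2 \<Longrightarrow> hinner f k = f (\<mu>, w)"
      using hardy2_kernel[OF \<mu>(1,2)] by blast
    have kK: "k \<in> K" unfolding mem_K
    proof (intro conjI ballI k(1))
      fix g assume g: "g \<in> hardy2"
      have "hinner (\<lambda>x. \<theta> x * g x) k = 0" using k(3)[OF \<theta>_mult[OF g]] \<mu>(3) by simp
      then show "hinner k (\<lambda>x. \<theta> x * g x) = 0" using hinner_cnj[OF k(1) \<theta>_mult[OF g]] by simp
    qed
    define g where "g = R k"
    have g: "g \<in> K" using R(1)[OF kK] by (simp add: g_def)
    note gh = K_hardy2[OF g]
    have zg: "(\<lambda>x. fst x * g x) \<in> hardy2" by (rule mult_z_hardy2[OF gh])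
    obtain b where b: "S g \<in> K" "b \<in> hardy2" "(\<lambda>x. fst x * g x) = (\<lambda>x. S g x + \<theta> x * b x)"
      using proj_decomp[OF zg] unfolding S_eq by metis
    \<comment> \<open>The projection error is a multiple of \<theta> and vanishes at the chosen
      point, so S acts there as multiplication by \<mu>.\<close>
    have "S g (\<mu>, w) = \<mu> * g (\<mu>, w)"
      using fun_cong[OF b(3), of "(\<mu>, w)"] \<mu>(3) by simp
    moreover have "k (\<mu>, w) = S g (\<mu>, w) - \<nu> * g (\<mu>, w)"
      using fun_cong[OF R(3)[OF kK], of "(\<mu>, w)"] by (simp add: g_def)
    ultimately have "k (\<mu>, w) = (\<mu> - \<nu>) * g (\<mu>, w)" by (simp add: algebra_simps)
    then have "hinner k k = (\<mu> - \<nu>) * hinner g k" using k(3)[OF k(1)] k(3)[OF gh] by simp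
    then have "(hnorm k)\<^sup>2 = cmod (\<mu> - \<nu>) * cmod (hinner g k)"
      using hinner_self[OF k(1)] by (metis abs_of_nonneg norm_mult norm_of_real zero_le_power2)
    also have "\<dots> \<le> cmod (\<mu> - \<nu>) * (C * hnorm k * hnorm k)"
    proof (rule mult_left_mono)
      have "cmod (hinner g k) \<le> hnorm g * hnorm k" by (rule hinner_bound[OF gh k(1)])
      also have "\<dots> \<le> C * hnorm k * hnorm k"
        using R(2)[OF kK] k(2) by (intro mult_right_mono) (auto simp: g_def)
      finally show "cmod (hinner g k) \<le> C * hnorm k * hnorm k" .
    qed simp
    also have "\<dots> = (cmod (\<mu> - \<nu>) * C) * (hnorm k)\<^sup>2" by (simp add: power2_eq_square)
    also have "\<dots> < 1 * (hnorm k)\<^sup>2"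
      using \<mu>(4) C k(2) by (intro mult_strict_right_mono) (auto simp: dist_norm field_simps)
    finally show False by simp
  qed
qed

text \<open>On this part of \<open>K\<close>, which is stable under z, no projection occurs: S is
  plain multiplication by z, so that inverses of S - \<zeta> can be compared with division by z -
  \<zeta>.\<close>

definition invariant_part :: "(complex \<times> complex \<Rightarrow> complex) set" where
  "invariant_part = {f. \<forall>m. (\<lambda>x. fst x ^ m * f x) \<in> K}"

lemma invariant_part_K: "f \<in> invariant_part \<Longrightarrow> f \<in> K"
  unfolding invariant_part_def by (auto dest: spec[of _ 0])

lemma invariant_part_monomial:
  assumes "f \<in> invariant_part"
  shows "(\<lambda>x. c * fst x ^ m * f x) \<in> invariant_part"
  unfolding invariant_part_def
proof (intro CollectI allI)
  fix n
  have "(\<lambda>x. fst x ^ (n + m) * f x) \<in> K" using assms by (simp add: invariant_part_def)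
  from K_cmult[OF this, of c] show "(\<lambda>x. fst x ^ n * (c * fst x ^ m * f x)) \<in> K"
    by (simp add: power_add mult_ac)
qed

lemma invariant_part_add:
  assumes "f \<in> invariant_part" "g \<in> invariant_part"
  shows "(\<lambda>x. f x + g x) \<in> invariant_part"
  using assms K_add by (simp add: invariant_part_def distrib_left)

lemma S_invariant_part: "f \<in> invariant_part \<Longrightarrow> S f = (\<lambda>x. fst x * f x)"
proof -
  assume f: "f \<in> invariant_part"
  have h: "(\<lambda>x. fst x * f x) \<in> K" using invariant_part_K[OF invariant_part_monomial[OF f, of 1 1]] by simp
  have z: "(\<lambda>x. 0) \<in> hardy2" using hardy2_cmult[OF \<theta>_hardy2, of 0] by simp
  show "S f = (\<lambda>x. fst x * f x)" unfolding S_eq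
    using proj_eqI[OF h z] by simp
qed

text \<open>Partial sums of 1 / (1 - cnj \<zeta> z). For |\<zeta>| = 1 the limit is unbounded on the
  disk, whereas the partial sums are polynomials in z and preserve
  \<open>invariant_part\<close>.\<close>

definition geometric_factor :: "complex \<Rightarrow> nat \<Rightarrow> complex \<times> complex \<Rightarrow> complex" where
  "geometric_factor \<zeta> N x = (\<Sum>j<N. (cnj \<zeta> * fst x) ^ j)"

lemma invariant_part_geometric:
  assumes "f \<in> invariant_part"
  shows "(\<lambda>x. geometric_factor \<zeta> N x * f x) \<in> invariant_part"
proof (induction N)
  case 0
  then show ?case using invariant_part_monomial[OF assms, of 0 0] by (simp add: geometric_factor_def)
next
  case (Suc N)
  from invariant_part_add[OF Suc invariant_part_monomial[OF assms, of "cnj \<zeta> ^ N" N]]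
  show ?case by (simp add: geometric_factor_def distrib_right power_mult_distrib)
qed

text \<open>With q_N the geometric factor, (z - \<zeta>) q_N = -\<zeta> (1 - (cnj \<zeta> z)^N).
  Hence q_N^(k+1) f is the inverse applied to -\<zeta> (1 - (cnj \<zeta> z)^N) q_N^k f, whose norm
  is at most twice that of q_N^k f since multiplication by z^N is isometric. Each further power thus
  costs a factor 2C, uniformly in N, and the radius is 1 / (2C).\<close>

lemma invariant_part_vanishes:
  assumes \<zeta>: "cmod \<zeta> = 1" "\<zeta> \<notin> op_spectrum K S" and f: "f \<in> invariant_part"
  shows "\<exists>e>0. \<forall>z w. (z, w) \<in> bidisk \<longrightarrow> cmod (1 - cnj \<zeta> * z) < e \<longrightarrow> f (z, w) = 0"
proof -
  from \<zeta>(2) obtain R C where C: "0 < C" and R: "\<And>f. f \<in> K \<Longrightarrow> R f \<in> K" "\<And>f. f \<in> K \<Longrightarrow> hnorm (R f) \<le> C * hnorm f"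
    "\<And>f. f \<in> K \<Longrightarrow> R (\<lambda>x. S f x - \<zeta> * f x) = f"
    by (rule not_in_spectrumE) blast
  have cz: "\<zeta> * cnj \<zeta> = 1" using \<zeta>(1) by (simp add: complex_norm_square[symmetric])
  let ?q = "geometric_factor \<zeta>"
  have inv: "(\<lambda>x. ?q N x ^ k * f x) \<in> invariant_part" for N k
  proof (induction k)
    case (Suc k)
    from invariant_part_geometric[OF this, of \<zeta> N] show ?case by (simp add: mult_ac)
  qed (simp add: f)
  have bound: "hnorm (\<lambda>x. ?q N x ^ k * f x) \<le> (2 * C) ^ k * hnorm f" for N k
  proof (induction k)
    case (Suc k)
    let ?F = "\<lambda>x. ?q N x ^ k * f x" and ?G = "\<lambda>x. ?q N x ^ Suc k * f x"
    note FK = invariant_part_K[OF inv[of N k]] and GK = invariant_part_K[OF inv[of N "Suc k"]]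
    have m: "(\<lambda>x. cnj \<zeta> ^ N * (fst x ^ N * ?F x)) \<in> K"
      using invariant_part_K[OF invariant_part_monomial[OF inv[of N k], of "cnj \<zeta> ^ N" N]] by (simp add: mult_ac)
    let ?H = "\<lambda>x. - \<zeta> * ?F x + \<zeta> * (cnj \<zeta> ^ N * (fst x ^ N * ?F x))"
    have HK: "?H \<in> K" by (intro K_add K_cmult FK m)
    have "S ?G x - \<zeta> * ?G x = ?H x" for x
    proof -
      have "(fst x - \<zeta>) * ?q N x = - \<zeta> * ((1 - cnj \<zeta> * fst x) * ?q N x)"
        using cz by (simp add: algebra_simps)
      also have "(1 - cnj \<zeta> * fst x) * ?q N x = 1 - (cnj \<zeta> * fst x) ^ N"
        unfolding geometric_factor_def by (rule one_diff_power_eq[symmetric])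
      finally have e: "(fst x - \<zeta>) * ?q N x = - \<zeta> * (1 - (cnj \<zeta> * fst x) ^ N)" .
      have "S ?G x - \<zeta> * ?G x = ((fst x - \<zeta>) * ?q N x) * ?F x"
        unfolding fun_cong[OF S_invariant_part[OF inv[of N "Suc k"]], of x] by (simp add: algebra_simps)
      then show ?thesis unfolding e by (simp add: algebra_simps power_mult_distrib)
    qed
    then have "?G = R ?H" using R(3)[OF GK] by simp
    then have "hnorm ?G \<le> C * hnorm ?H" using R(2)[OF HK] by simp
    also have "\<dots> \<le> C * (hnorm ?F + hnorm ?F)"
    proof (rule mult_left_mono)
      have "hnorm ?H \<le> hnorm (\<lambda>x. - \<zeta> * ?F x) + hnorm (\<lambda>x. \<zeta> * (cnj \<zeta> ^ N * (fst x ^ N * ?F x)))"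
        by (intro hnorm_add_le hardy2_cmult K_hardy2 FK m)
      also have "hnorm (\<lambda>x. - \<zeta> * ?F x) = hnorm ?F"
        by (subst hnorm_cmult[OF K_hardy2[OF FK]]) (simp add: \<zeta>)
      also have "hnorm (\<lambda>x. \<zeta> * (cnj \<zeta> ^ N * (fst x ^ N * ?F x))) = hnorm ?F"
        by (subst hnorm_cmult[OF K_hardy2[OF m]], subst hnorm_cmult[OF mult_monomial(1)[OF K_hardy2[OF FK]]],
            subst mult_monomial(2)[OF K_hardy2[OF FK]]) (simp add: \<zeta> norm_power)
      finally show "hnorm ?H \<le> hnorm ?F + hnorm ?F" .
    qed (use C in simp)
    also have "\<dots> = 2 * C * hnorm ?F" by simp
    also have "\<dots> \<le> 2 * C * ((2 * C) ^ k * hnorm f)"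
      using Suc C by (intro mult_left_mono) auto
    finally show ?case by (simp add: mult_ac)
  qed simp
  have fh: "f \<in> hardy2" by (intro K_hardy2 invariant_part_K f)
  show ?thesis
  proof (intro exI[of _ "1 / (2 * C)"] conjI allI impI)
    fix z w assume zw: "(z, w) \<in> bidisk" and small: "cmod (1 - cnj \<zeta> * z) < 1 / (2 * C)"
    obtain k where k: "k \<in> hardy2" "0 < hnorm k" "\<And>f. f \<in> hardy2 \<Longrightarrow> hinner f k = f (z, w)"
      using hardy2_kernel[of z w] zw by auto
    have lt: "cmod (cnj \<zeta> * z) < 1" using zw \<zeta> by (simp add: norm_mult)
    then have ne: "1 - cnj \<zeta> * z \<noteq> 0" by auto
    let ?y = "1 / (1 - cnj \<zeta> * z)"
    have lim: "(\<lambda>N. ?q N (z, w)) \<longlonglongrightarrow> ?y"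
      using geometric_sums[OF lt] by (simp add: sums_def geometric_factor_def)
    have b: "cmod ?y ^ n * cmod (f (z, w)) \<le> (2 * C) ^ n * (hnorm f * hnorm k)" for n
    proof (rule LIMSEQ_le_const2)
      show "(\<lambda>N. cmod (?q N (z, w)) ^ n * cmod (f (z, w))) \<longlonglongrightarrow> cmod ?y ^ n * cmod (f (z, w))"
        by (intro tendsto_intros lim)
      have "cmod (?q N (z, w)) ^ n * cmod (f (z, w)) \<le> (2 * C) ^ n * (hnorm f * hnorm k)" for N
      proof -
        have h: "(\<lambda>x. ?q N x ^ n * f x) \<in> hardy2" by (intro K_hardy2 invariant_part_K inv)
        have "cmod (?q N (z, w)) ^ n * cmod (f (z, w)) = cmod (hinner (\<lambda>x. ?q N x ^ n * f x) k)"
          using k(3)[OF h] by (simp add: norm_mult norm_power)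
        also have "\<dots> \<le> hnorm (\<lambda>x. ?q N x ^ n * f x) * hnorm k" by (rule hinner_bound[OF h k(1)])
        also have "\<dots> \<le> (2 * C) ^ n * hnorm f * hnorm k"
          using bound k(2) by (intro mult_right_mono) auto
        finally show ?thesis by (simp add: mult.assoc)
      qed
      then show "\<exists>M. \<forall>N\<ge>M. cmod (?q N (z, w)) ^ n * cmod (f (z, w)) \<le> (2 * C) ^ n * (hnorm f * hnorm k)"
        by blast
    qed
    let ?t = "cmod ?y / (2 * C)"
    \<comment> \<open>On the small neighbourhood |?y| exceeds 2C, so the powers of the ratio grow
      without bound while their product with |f(z, w)| stays bounded.\<close>
    have t: "1 < ?t" using small C ne by (simp add: norm_divide field_simps)
    have "?t ^ n * cmod (f (z, w)) \<le> hnorm f * hnorm k" for n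
      using b[of n] C by (simp add: power_divide divide_le_eq mult_ac)
    show "f (z, w) = 0"
    proof (rule ccontr)
      assume "f (z, w) \<noteq> 0"
      then have p: "0 < cmod (f (z, w))" by simp
      obtain n where "hnorm f * hnorm k / cmod (f (z, w)) < ?t ^ n"
        using real_arch_pow[OF t] by blast
      then have "hnorm f * hnorm k < ?t ^ n * cmod (f (z, w))" using p by (simp add: field_simps)
      with \<open>?t ^ n * cmod (f (z, w)) \<le> hnorm f * hnorm k\<close> show False by simp
    qed
  qed (use C in simp)
qed

definition backward_shift :: "nat \<times> nat \<Rightarrow> complex" where
  "backward_shift = (\<lambda>(m, n). coeffs_\<theta> (m, Suc n))"

text \<open>For membership in \<open>K\<close>, pair z^m f with \<theta> g and multiply both by w,
  which is isometric. Then w z^m f = z^m \<theta> - z^m \<theta>(z, 0). The second term has no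
  positive power of w and is orthogonal to w \<theta> g. The first pairs with \<theta> w g as z^m
  pairs with w g, by the isometry, which is again zero.\<close>

lemma backward_shift:
  "square_summable backward_shift"
  "power_series2 backward_shift \<in> invariant_part"
  "cmod z < 1 \<Longrightarrow> cmod w < 1 \<Longrightarrow> w * power_series2 backward_shift (z, w) = \<theta> (z, w) - \<theta> (z, 0)"
proof -
  define a0 where "a0 = (\<lambda>(m, n :: nat). if n = 0 then coeffs_\<theta> (m, n) else 0)"
  have a0: "square_summable a0"
    by (rule l2_norm_mono[OF coeffs_\<theta>(1)]) (auto simp: a0_def)
  have sh: "shift 0 1 backward_shift = (\<lambda>k. coeffs_\<theta> k - a0 k)"
    by (auto simp: shift_def backward_shift_def a0_def fun_eq_iff)
  have "square_summable (\<lambda>k. shift 0 1 backward_shift k)"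
    unfolding sh by (intro square_summable_diff coeffs_\<theta> a0)
  then have "((\<lambda>k. (cmod (shift 0 1 backward_shift k))\<^sup>2)) summable_on ({0..} \<times> {1..})"
    unfolding square_summable_def by (rule summable_on_subset_banach) auto
  moreover have bij: "bij_betw (\<lambda>(m, n). (m, Suc n)) (UNIV :: (nat \<times> nat) set) ({0..} \<times> {1..})"
    by (rule bij_betwI[where g = "\<lambda>(m, n). (m, n - 1)"]) auto
  ultimately show b: "square_summable backward_shift"
    unfolding square_summable_def
    by (subst (asm) summable_on_reindex_bij_betw[OF bij, symmetric])
      (simp add: shift_def backward_shift_def case_prod_unfold)
  note bd = disk_summable_l2[OF b]
  have p0: "power_series2 a0 (z, w) = \<theta> (z, 0)" if "cmod z < 1" "cmod w < 1" for z w
  proof -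
    have "\<theta> (z, 0) = (\<Sum>\<^sub>\<infinity>(m, n). coeffs_\<theta> (m, n) * z ^ m * 0 ^ n)"
      using power_series2_eq[of z 0 coeffs_\<theta>] that by (simp add: coeffs_\<theta>(2))
    also have "\<dots> = (\<Sum>\<^sub>\<infinity>(m, n). a0 (m, n) * z ^ m * w ^ n)"
      by (intro infsum_cong) (auto simp: a0_def power_0_left)
    finally show ?thesis using that by (simp add: power_series2_eq)
  qed
  show "w * power_series2 backward_shift (z, w) = \<theta> (z, w) - \<theta> (z, 0)" if zw: "cmod z < 1" "cmod w < 1" for z w
  proof -
    have "w * power_series2 backward_shift (z, w) = power_series2 (shift 0 1 backward_shift) (z, w)"
      using power_series2_shift[OF bd zw, of 0 1] by simp
    also have "\<dots> = power_series2 (\<lambda>k. coeffs_\<theta> k + -1 * a0 k) (z, w)"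
      unfolding sh by simp
    also have "\<dots> = \<theta> (z, w) - \<theta> (z, 0)"
      unfolding power_series2_add[OF disk_coeffs disk_summable_cmult[OF disk_summable_l2[OF a0]]]
        power_series2_cmult coeffs_\<theta>(2) p0[OF zw] by simp
    finally show ?thesis .
  qed
  show "power_series2 backward_shift \<in> invariant_part"
    unfolding invariant_part_def
  proof (intro CollectI allI)
    fix m
    have eq: "(\<lambda>x. fst x ^ m * power_series2 backward_shift x) = power_series2 (shift m 0 backward_shift)"
      by (rule bidisk_ext) (simp_all add: power_series2_shift[OF bd] power_series2_outside)
    show "(\<lambda>x. fst x ^ m * power_series2 backward_shift x) \<in> K"
      unfolding mem_K
    proof (intro conjI ballI)
      show "(\<lambda>x. fst x ^ m * power_series2 backward_shift x) \<in> hardy2"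
        unfolding eq by (intro hardy2I square_summable_shift b)
      fix g assume "g \<in> hardy2"
      then obtain c where c: "square_summable c" "g = power_series2 c" by (rule hardy2E)
      note mm = inner_function_contraction[OF inner' coeffs_\<theta>(1)]
      let ?M = "cauchy_prod coeffs_\<theta>"
      let ?d = unit_coeffs
      note d = square_summable_unit and dd = disk_summable_l2
      note ds = dd[OF square_summable_shift(1)]
      have Md: "?M (shift m 0 ?d) = shift m 0 coeffs_\<theta>"
      proof (intro power_series2_inj ds disk_summable_cauchy_prod disk_coeffs d coeffs_\<theta>)
        show "power_series2 (?M (shift m 0 ?d)) = power_series2 (shift m 0 coeffs_\<theta>)"
          unfolding power_series2_cauchy_prod[OF disk_coeffs ds[OF d]]
          by (rule bidisk_ext)
            (simp_all add: power_series2_shift[OF dd[OF d]] power_series2_shift[OF disk_coeffs] power_series2_unit power_series2_outside)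
      qed
      have Ms: "shift 0 1 (?M c) = ?M (shift 0 1 c)"
      proof (intro power_series2_inj ds disk_summable_cauchy_prod disk_coeffs c mm)
        show "power_series2 (shift 0 1 (?M c)) = power_series2 (?M (shift 0 1 c))"
          unfolding power_series2_cauchy_prod[OF disk_coeffs ds[OF c(1)]]
          by (rule bidisk_ext)
            (simp_all add: power_series2_shift disk_summable_cauchy_prod disk_coeffs dd[OF c(1)] power_series2_cauchy_prod power_series2_outside)
      qed
      have "hinner (\<lambda>x. fst x ^ m * power_series2 backward_shift x) (\<lambda>x. \<theta> x * g x)
        = l2_inner (shift m 0 backward_shift) (?M c)"
        unfolding eq c(2) \<theta>_mult_power_series2[OF c(1)]
        by (intro hinner_power_series2 square_summable_shift b mm c)
      also have "\<dots> = l2_inner (shift 0 1 (shift m 0 backward_shift)) (shift 0 1 (?M c))"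
        by (rule l2_inner_shift[symmetric]) (intro square_summable_shift b mm c)+
      also have "shift 0 1 (shift m 0 backward_shift) = (\<lambda>k. shift m 0 coeffs_\<theta> k + -1 * shift m 0 a0 k)"
        by (auto simp: shift_def backward_shift_def a0_def fun_eq_iff)
      also have "l2_inner \<dots> (shift 0 1 (?M c)) = l2_inner (shift m 0 coeffs_\<theta>) (shift 0 1 (?M c))
         + -1 * l2_inner (shift m 0 a0) (shift 0 1 (?M c))"
        unfolding l2_inner_cmult_left[symmetric]
        by (rule l2_inner_add_left) (intro square_summable_cmult square_summable_shift coeffs_\<theta> a0 mm c)+
      also have "l2_inner (shift m 0 a0) (shift 0 1 (?M c)) = 0"
        unfolding l2_inner_def by (rule infsum_0) (auto simp: shift_def a0_def)
      also have "l2_inner (shift m 0 coeffs_\<theta>) (shift 0 1 (?M c)) = l2_inner (shift m 0 ?d) (shift 0 1 c)"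
        unfolding Md[symmetric] Ms by (intro l2_inner_cauchy_prod[OF inner' coeffs_\<theta>(1)] square_summable_shift d c)
      also have "\<dots> = 0"
        unfolding l2_inner_def by (rule infsum_0) (auto simp: shift_def unit_coeffs_def split: if_splits)
      finally show "hinner (\<lambda>x. fst x ^ m * power_series2 backward_shift x) (\<lambda>x. \<theta> x * g x) = 0" by simp
    qed
  qed
qed

lemma circle_in_spectrum:
  assumes "\<not> depends_only_on_z \<theta>"
  shows "sphere 0 1 \<subseteq> op_spectrum K S"
proof
  fix \<zeta> :: complex assume "\<zeta> \<in> sphere 0 1"
  then have \<zeta>: "cmod \<zeta> = 1" by simp
  show "\<zeta> \<in> op_spectrum K S"
  proof (rule ccontr)
    assume "\<zeta> \<notin> op_spectrum K S"
    from invariant_part_vanishes[OF \<zeta> this backward_shift(2)] obtain e where e: "0 < e"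
      and v: "\<And>z w. (z, w) \<in> bidisk \<Longrightarrow> cmod (1 - cnj \<zeta> * z) < e \<Longrightarrow> power_series2 backward_shift (z, w) = 0"
      by blast
    have "power_series2 backward_shift (z, w) = 0" if zw: "cmod z < 1" "cmod w < 1" for z w
    proof -
      let ?f = "\<lambda>z. power_series2 backward_shift (z, w)"
      let ?U = "ball 0 1 \<inter> ball \<zeta> e"
      have hol: "?f holomorphic_on ball 0 1"
        by (rule holomorphic_section_z[OF disk_summable_l2[OF backward_shift(1)] zw(2)])
      have "\<zeta> \<in> closure (ball 0 1)" using \<zeta> by simp
      then have ne: "?U \<noteq> {}"
        using e by (metis centre_in_ball disjoint_iff open_Int_closure_eq_empty open_ball inf_commute)
      have "?f u = 0" if "u \<in> ?U" for u
      proof (rule v)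
        have "1 - cnj \<zeta> * u = cnj \<zeta> * (\<zeta> - u)"
          using \<zeta> complex_norm_square[of \<zeta>] by (simp add: right_diff_distrib mult.commute)
        then show "cmod (1 - cnj \<zeta> * u) < e" using that \<zeta> by (simp add: norm_mult dist_norm)
      qed (use that zw in auto)
      then show ?thesis
        using analytic_continuation_open[of ?U "ball 0 1" ?f "\<lambda>_. 0" z] hol ne zw by auto
    qed
    then have "\<theta> (z, w) = \<theta> (z, 0)" if "cmod z < 1" "cmod w < 1" for z w
      using backward_shift(3)[OF that] that by simp
    then have "\<forall>z w. (z, w) \<in> bidisk \<longrightarrow> \<theta> (z, w) = (\<lambda>z. \<theta> (z, 0)) z" unfolding mem_bidisk by blast
    then have "depends_only_on_z \<theta>" unfolding depends_only_on_z_def by (rule exI[of _ "\<lambda>z. \<theta> (z, 0)"])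
    with assms show False by simp
  qed
qed

text \<open>The range of multiplication by \<theta> is stable under A, B and z. Every error made by
  an inner projection is therefore still a multiple of \<theta> after further multiplications and is
  removed by the last projection; modulo such multiples the identity says that A inverts z -
  \<nu>.\<close>

lemma resolvent_of_bezout:
  assumes A: "\<And>f. f \<in> hardy2 \<Longrightarrow> (\<lambda>x. A x * f x) \<in> hardy2" "\<And>f. f \<in> hardy2 \<Longrightarrow> hnorm (\<lambda>x. A x * f x) \<le> C * hnorm f"
    and B: "\<And>f. f \<in> hardy2 \<Longrightarrow> (\<lambda>x. B x * f x) \<in> hardy2"
    and bez: "\<And>x. x \<in> bidisk \<Longrightarrow> (fst x - \<nu>) * A x + \<theta> x * B x = 1"
  shows "\<nu> \<notin> op_spectrum K S"
proof -
  define R where "R f = P (\<lambda>x. A x * f x)" for f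
  have RK: "R f \<in> K" if "f \<in> K" for f
    unfolding R_def by (intro proj_K A K_hardy2 that)
  have "bounded_operator_on K R"
    unfolding bounded_operator_on_def
  proof (intro conjI ballI allI RK exI[of _ C])
    fix f g assume f: "f \<in> K" and g: "g \<in> K"
    show "R (\<lambda>x. f x + g x) = (\<lambda>x. R f x + R g x)"
      unfolding R_def distrib_left by (intro proj_add A K_hardy2 f g)
  next
    fix c f assume f: "f \<in> K"
    show "R (\<lambda>x. c * f x) = (\<lambda>x. c * R f x)"
      unfolding R_def using proj_cmult[OF A(1)[OF K_hardy2[OF f]], of c] by (simp add: mult.left_commute)
  next
    fix f assume f: "f \<in> K"
    show "hnorm (R f) \<le> C * hnorm f"
      unfolding R_def by (rule order_trans[OF proj_norm[OF A(1)] A(2)]) (intro K_hardy2 f)+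
  qed
  moreover have "R (\<lambda>x. S f x - \<nu> * f x) = f" if f: "f \<in> K" for f
  proof -
    note fh = K_hardy2[OF f]
    define s where "s = S f"
    obtain b where b: "s \<in> K" "b \<in> hardy2" "(\<lambda>x. fst x * f x) = (\<lambda>x. s x + \<theta> x * b x)"
      using proj_decomp[OF mult_z_hardy2[OF fh]] unfolding S_eq s_def by metis
    show ?thesis unfolding R_def s_def[symmetric]
    proof (rule proj_eqI'[OF f])
      \<comment> \<open>The cofactor of \<theta> has two sources: -B f from the Bezout identity and
        -A b from the projection error in \<open>S f\<close>.\<close>
      show "(\<lambda>x. - 1 * (B x * f x) + - 1 * (A x * b x)) \<in> hardy2"
        by (intro hardy2_add hardy2_cmult A B fh b)
      show "(\<lambda>x. A x * (s x - \<nu> * f x)) \<in> hardy2"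
        by (intro A(1) hardy2_diff hardy2_cmult fh K_hardy2 b)
      fix x assume x: "x \<in> bidisk"
      have "s x = fst x * f x - \<theta> x * b x" using fun_cong[OF b(3), of x] by simp
      then have "A x * (s x - \<nu> * f x) = A x * ((fst x * f x - \<theta> x * b x) - \<nu> * f x)"
        by (simp only:)
      also have "\<dots> = ((fst x - \<nu>) * A x) * f x - \<theta> x * (A x * b x)"
        by (simp add: algebra_simps)
      also have "(fst x - \<nu>) * A x = 1 - \<theta> x * B x" using bez[OF x] by (simp add: algebra_simps)
      finally show "A x * (s x - \<nu> * f x) = f x + \<theta> x * (- 1 * (B x * f x) + - 1 * (A x * b x))"
        by (simp add: algebra_simps)
    qed
  qed
  moreover have "(\<lambda>x. S (R f) x - \<nu> * R f x) = f" if f: "f \<in> K" for f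
  proof -
    note fh = K_hardy2[OF f]
    define r where "r = R f"
    obtain b where b: "r \<in> K" "b \<in> hardy2" "(\<lambda>x. A x * f x) = (\<lambda>x. r x + \<theta> x * b x)"
      using proj_decomp[OF A(1)[OF fh]] unfolding R_def r_def by metis
    have "S r = (\<lambda>x. f x + \<nu> * r x)" unfolding S_eq
    proof (rule proj_eqI')
      show "(\<lambda>x. f x + \<nu> * r x) \<in> K" by (intro K_add K_cmult f b)
      \<comment> \<open>Here -B f comes from the Bezout identity and -(z - \<nu>) b from the
        projection error in \<open>R f\<close>.\<close>
      show "(\<lambda>x. - 1 * (B x * f x) + - 1 * (fst x * b x - \<nu> * b x)) \<in> hardy2"
        by (intro hardy2_add hardy2_cmult hardy2_diff mult_z_hardy2 B fh b)
      show "(\<lambda>x. fst x * r x) \<in> hardy2" by (intro mult_z_hardy2 K_hardy2 b)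
      fix x assume x: "x \<in> bidisk"
      have "r x = A x * f x - \<theta> x * b x" using fun_cong[OF b(3), of x] by simp
      then have "fst x * r x - \<nu> * r x = fst x * (A x * f x - \<theta> x * b x) - \<nu> * (A x * f x - \<theta> x * b x)"
        by (simp only:)
      also have "\<dots> = ((fst x - \<nu>) * A x) * f x - \<theta> x * (fst x * b x - \<nu> * b x)"
        by (simp add: algebra_simps)
      also have "(fst x - \<nu>) * A x = 1 - \<theta> x * B x" using bez[OF x] by (simp add: algebra_simps)
      finally have "fst x * r x - \<nu> * r x = (1 - \<theta> x * B x) * f x - \<theta> x * (fst x * b x - \<nu> * b x)" .
      then have "fst x * r x = \<nu> * r x + ((1 - \<theta> x * B x) * f x - \<theta> x * (fst x * b x - \<nu> * b x))"
        by (simp add: diff_eq_eq add.commute)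
      also have "\<dots> = f x + \<nu> * r x + \<theta> x * (- 1 * (B x * f x) + - 1 * (fst x * b x - \<nu> * b x))"
        by (simp add: algebra_simps)
      finally show "fst x * r x = f x + \<nu> * r x + \<theta> x * (- 1 * (B x * f x) + - 1 * (fst x * b x - \<nu> * b x))" .
    qed
    then show ?thesis by (simp add: r_def)
  qed
  ultimately show ?thesis unfolding op_spectrum_def by blast
qed

end

section \<open>Polynomials in two variables\<close>

lemma poly2_pCons: "poly2 (pCons c p) (z, w) = poly c z + w * poly2 p (z, w)"
  by (simp add: poly2_def)

lemma poly2_0 [simp]: "poly2 0 x = 0"
  by (simp add: poly2_def case_prod_unfold)

lemma poly2_mult: "poly2 (p * q) x = poly2 p x * poly2 q x"
  by (simp add: poly2_def case_prod_unfold)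

lemma poly2_add: "poly2 (p + q) x = poly2 p x + poly2 q x"
  by (simp add: poly2_def case_prod_unfold)

lemma poly2_diff: "poly2 (p - q) x = poly2 p x - poly2 q x"
  by (simp add: poly2_def case_prod_unfold)

lemma poly2_const [simp]: "poly2 [:c:] (z, w) = poly c z"
  by (simp add: poly2_def)

lemma continuous_on_poly2 [continuous_intros]: "continuous_on A f \<Longrightarrow> continuous_on A (\<lambda>x. poly2 p (f x))"
proof (induction p)
  case (pCons c p)
  have "poly2 (pCons c p) (f x) = poly c (fst (f x)) + snd (f x) * poly2 p (f x)" for x
    by (cases "f x") (simp add: poly2_pCons)
  with pCons show ?case by (auto intro!: continuous_intros)
qed simp

lemma poly2_section: "poly2 p (z, w) = poly (map_poly (\<lambda>c. poly c z) p) w"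
  by (induction p) (simp_all add: poly2_pCons map_poly_pCons)

lemma holomorphic_on_poly: "poly p holomorphic_on A"
  unfolding holomorphic_on_def field_differentiable_def
  using has_field_derivative_at_within[OF poly_DERIV] by blast

lemma holomorphic_on_poly2_z: "(\<lambda>z. poly2 p (z, w)) holomorphic_on A"
  using holomorphic_on_poly[of "poly p [:w:]" A] by (simp add: poly2_def)

lemma holomorphic_on_poly2_w: "(\<lambda>w. poly2 p (z, w)) holomorphic_on A"
  unfolding poly2_section by (rule holomorphic_on_poly)

section \<open>Vanishing on lines and common factors\<close>

lemma poly2_eq_0_z:
  assumes "infinite {z. poly2 p (z, w) = 0}"
  shows "poly p [:w:] = 0"
  using assms poly_roots_finite[of "poly p [:w:]"] by (auto simp: poly2_def)

lemma poly2_eq_0: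
  assumes "infinite V" "\<And>w. w \<in> V \<Longrightarrow> infinite {z. poly2 p (z, w) = 0}"
  shows "p = 0"
proof (rule ccontr)
  assume "p \<noteq> 0"
  then have "finite {x. poly p x = 0}" by (rule poly_roots_finite)
  moreover have "(\<lambda>w. [:w:]) ` V \<subseteq> {x. poly p x = 0}"
    using assms(2) poly2_eq_0_z by auto
  ultimately have "finite ((\<lambda>w. [:w:]) ` V)" by (rule rev_finite_subset)
  then have "finite V" by (rule finite_imageD) (auto simp: inj_on_def)
  with assms(1) show False by simp
qed

text \<open>Infinitely many zeros on a coordinate line produce the linear equation of the line as a
  factor. In the outer variable this factor has degree 1 for a line of fixed w, and it is a constant
  polynomial for a line of fixed z. In neither case is it a unit, so coprime polynomials cannot
  share such a line.\<close>

lemma dvd_of_vanishing_z: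
  assumes "infinite {z. poly2 p (z, w) = 0}"
  shows "[:- [:w:], 1:] dvd p"
  using poly2_eq_0_z[OF assms] by (simp add: poly_eq_0_iff_dvd)

lemma dvd_of_vanishing_w:
  assumes "infinite {w. poly2 p (z, w) = 0}"
  shows "[:[:- z, 1:]:] dvd p"
proof -
  have "map_poly (\<lambda>c. poly c z) p = 0"
    using assms poly_roots_finite[of "map_poly (\<lambda>c. poly c z) p"] by (auto simp: poly2_section)
  then have "poly (coeff p n) z = 0" for n
    using coeff_map_poly[of "\<lambda>c. poly c z" p n] by simp
  then show ?thesis by (simp add: const_poly_dvd_iff poly_eq_0_iff_dvd)
qed

lemma not_coprime_of_vanishing_z:
  assumes "infinite {z. poly2 p (z, w) = 0}" "infinite {z. poly2 q (z, w) = 0}"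
  shows "\<not> coprime p q"
proof
  assume "coprime p q"
  then have "is_unit [:- [:w:], 1:]"
    using dvd_of_vanishing_z assms by (meson coprime_common_divisor)
  then show False by (auto simp: is_unit_poly_iff)
qed

lemma not_coprime_of_vanishing_w:
  assumes "infinite {w. poly2 p (z, w) = 0}" "infinite {w. poly2 q (z, w) = 0}"
  shows "\<not> coprime p q"
proof
  assume "coprime p q"
  then have "is_unit [:[:- z, 1:]:]"
    using dvd_of_vanishing_w assms by (meson coprime_common_divisor)
  then show False by (auto simp: is_unit_poly_iff)
qed

section \<open>Lipschitz estimates on the closed bidisk\<close>

lemma poly_lipschitz:
  fixes c :: "complex poly"
  obtains L where "0 \<le> L" "\<And>z z'. cmod z \<le> 1 \<Longrightarrow> cmod z' \<le> 1 \<Longrightarrow> cmod (poly c z - poly c z') \<le> L * cmod (z - z')"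
    "\<And>z. cmod z \<le> 1 \<Longrightarrow> cmod (poly c z) \<le> L"
proof -
  have "\<exists>L\<ge>0. (\<forall>z z'. cmod z \<le> 1 \<longrightarrow> cmod z' \<le> 1 \<longrightarrow> cmod (poly c z - poly c z') \<le> L * cmod (z - z')) \<and>
    (\<forall>z. cmod z \<le> 1 \<longrightarrow> cmod (poly c z) \<le> L)"
  proof (induction c)
    case (pCons a c)
    then obtain L where L: "0 \<le> L" "\<And>z z'. cmod z \<le> 1 \<Longrightarrow> cmod z' \<le> 1 \<Longrightarrow> cmod (poly c z - poly c z') \<le> L * cmod (z - z')"
      "\<And>z. cmod z \<le> 1 \<Longrightarrow> cmod (poly c z) \<le> L" by blast
    show ?case
    proof (intro exI[of _ "cmod a + 2 * L"] conjI allI impI)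
      fix z z' :: complex assume z: "cmod z \<le> 1" "cmod z' \<le> 1"
      have "poly (pCons a c) z - poly (pCons a c) z' = z * (poly c z - poly c z') + (z - z') * poly c z'"
        by (simp add: algebra_simps)
      also have "cmod \<dots> \<le> cmod z * cmod (poly c z - poly c z') + cmod (z - z') * cmod (poly c z')"
        by (metis norm_mult norm_triangle_ineq)
      also have "\<dots> \<le> 1 * (L * cmod (z - z')) + cmod (z - z') * L"
        using z L by (intro add_mono mult_mono) auto
      also have "\<dots> \<le> (cmod a + 2 * L) * cmod (z - z')" by (simp add: algebra_simps)
      finally show "cmod (poly (pCons a c) z - poly (pCons a c) z') \<le> (cmod a + 2 * L) * cmod (z - z')" .
    next
      fix z :: complex assume z: "cmod z \<le> 1"
      have "cmod (poly (pCons a c) z) \<le> cmod a + cmod z * cmod (poly c z)"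
        by (simp add: norm_mult[symmetric] norm_triangle_ineq)
      also have "\<dots> \<le> cmod a + 1 * L" using z L by (intro add_mono mult_mono) auto
      finally show "cmod (poly (pCons a c) z) \<le> cmod a + 2 * L" using L by simp
    qed (use L in simp)
  qed (auto intro!: exI[of _ 0])
  then show ?thesis using that by blast
qed

text \<open>The supremum bound is carried along with the Lipschitz bound because the induction on
  the polynomial multiplies by a variable, and the product rule needs both.\<close>

definition lipschitz_bound :: "complex poly poly \<Rightarrow> real \<Rightarrow> bool" where
  "lipschitz_bound p L \<longleftrightarrow> 0 \<le> L \<and>
    (\<forall>z z' w w'. cmod z \<le> 1 \<longrightarrow> cmod z' \<le> 1 \<longrightarrow> cmod w \<le> 1 \<longrightarrow> cmod w' \<le> 1 \<longrightarrow>
      cmod (poly2 p (z, w) - poly2 p (z', w')) \<le> L * (cmod (z - z') + cmod (w - w'))) \<and>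
    (\<forall>z w. cmod z \<le> 1 \<longrightarrow> cmod w \<le> 1 \<longrightarrow> cmod (poly2 p (z, w)) \<le> L)"

lemma lipschitz_boundD:
  assumes "lipschitz_bound p L"
  shows "0 \<le> L"
    "\<lbrakk>cmod z \<le> 1; cmod z' \<le> 1; cmod w \<le> 1; cmod w' \<le> 1\<rbrakk>
        \<Longrightarrow> cmod (poly2 p (z, w) - poly2 p (z', w')) \<le> L * (cmod (z - z') + cmod (w - w'))"
    "cmod z \<le> 1 \<Longrightarrow> cmod w \<le> 1 \<Longrightarrow> cmod (poly2 p (z, w)) \<le> L"
  using assms unfolding lipschitz_bound_def by blast+

lemma poly2_lipschitz: obtains L where "lipschitz_bound p L"
proof -
  have "\<exists>L. lipschitz_bound p L"
  proof (induction p)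
    case (pCons c p)
    then obtain L' where "lipschitz_bound p L'" by blast
    note L = lipschitz_boundD[OF this]
    let ?L = L'
    obtain M where M: "0 \<le> M" "\<And>z z'. cmod z \<le> 1 \<Longrightarrow> cmod z' \<le> 1 \<Longrightarrow> cmod (poly c z - poly c z') \<le> M * cmod (z - z')"
      "\<And>z. cmod z \<le> 1 \<Longrightarrow> cmod (poly c z) \<le> M" using poly_lipschitz[of c] by blast
    show ?case unfolding lipschitz_bound_def
    proof (intro exI[of _ "M + 2 * ?L"] conjI allI impI)
      fix z z' w w' :: complex
      assume z: "cmod z \<le> 1" "cmod z' \<le> 1" "cmod w \<le> 1" "cmod w' \<le> 1"
      let ?d = "cmod (z - z') + cmod (w - w')"
      have "poly2 (pCons c p) (z, w) - poly2 (pCons c p) (z', w')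
         = (poly c z - poly c z') + (w * (poly2 p (z, w) - poly2 p (z', w')) + (w - w') * poly2 p (z', w'))"
        by (simp add: poly2_pCons algebra_simps)
      also have "cmod \<dots> \<le> cmod (poly c z - poly c z') + (cmod w * cmod (poly2 p (z, w) - poly2 p (z', w')) + cmod (w - w') * cmod (poly2 p (z', w')))"
        by (metis norm_mult norm_triangle_le add_left_mono norm_triangle_ineq)
      also have "\<dots> \<le> M * ?d + (1 * (?L * ?d) + ?d * ?L)"
        using z L M by (intro add_mono mult_mono order_trans[OF M(2)[OF z(1,2)]] mult_left_mono) auto
      also have "\<dots> = (M + 2 * ?L) * ?d" by (simp add: algebra_simps)
      finally show "cmod (poly2 (pCons c p) (z, w) - poly2 (pCons c p) (z', w')) \<le> (M + 2 * ?L) * ?d" .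
    next
      fix z w :: complex assume z: "cmod z \<le> 1" "cmod w \<le> 1"
      have "cmod (poly2 (pCons c p) (z, w)) \<le> cmod (poly c z) + cmod w * cmod (poly2 p (z, w))"
        unfolding poly2_pCons norm_mult[symmetric] by (rule norm_triangle_ineq)
      also have "\<dots> \<le> M + 1 * ?L" using z L M by (intro add_mono mult_mono) auto
      finally show "cmod (poly2 (pCons c p) (z, w)) \<le> M + 2 * ?L" using L(1) by simp
    qed (use L(1) M in simp)
  qed (auto intro!: exI[of _ 0] simp: lipschitz_bound_def)
  then show ?thesis using that by blast
qed

text \<open>Elimination of \<open>w\<close>: by Gauss's lemma an element of minimal degree of the ideal generated by
  two coprime polynomials has degree \<open>0\<close>.\<close>

lemma coprime_eliminate_w:
  fixes p q :: "complex poly poly"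
  assumes "coprime p q" "p \<noteq> 0"
  obtains d where "d \<noteq> 0" "\<And>z w. poly2 p (z, w) = 0 \<Longrightarrow> poly2 q (z, w) = 0 \<Longrightarrow> poly d z = 0"
proof -
  define I where "I = {a * p + b * q | a b. True}"
  have pI: "p \<in> I" unfolding I_def by (intro CollectI exI[of _ 1] exI[of _ 0]) simp
  have qI: "q \<in> I" unfolding I_def by (intro CollectI exI[of _ 0] exI[of _ 1]) simp
  have sm: "smult c f - g * h \<in> I" if fI: "f \<in> I" and gI: "g \<in> I" for c f g h
  proof -
    obtain a b where "f = a * p + b * q" using fI unfolding I_def by blast
    moreover obtain a' b' where "g = a' * p + b' * q" using gI unfolding I_def by blast
    ultimately have "smult c f - g * h = (smult c a - a' * h) * p + (smult c b - b' * h) * q"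
      by (simp add: algebra_simps smult_add_right)
    then show ?thesis unfolding I_def by blast
  qed
  obtain e where e: "e \<in> I" "e \<noteq> 0" "\<And>f. f \<in> I \<Longrightarrow> f \<noteq> 0 \<Longrightarrow> degree e \<le> degree f"
    using exists_least_iff[of "\<lambda>n. \<exists>f\<in>I. f \<noteq> 0 \<and> degree f = n"] pI assms(2)
    by (metis not_less)
  have dvd: "primitive_part e dvd f" if f: "f \<in> I" for f
  proof -
    \<comment> \<open>Pseudo-division, since the coefficients in z form a ring that is not a field;
      the price is the factor c. Minimality of the degree of e then makes the remainder
      vanish.\<close>
    obtain s r where sr: "pseudo_divmod f e = (s, r)" by force
    define c where "c = lead_coeff e ^ (Suc (degree f) - degree e)"
    have c: "c \<noteq> 0" using e(2) by (simp add: c_def)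
    have eq: "smult c f = e * s + r" and r: "r = 0 \<or> degree r < degree e"
      using pseudo_divmod[OF e(2) sr] by (auto simp: c_def)
    have "r = smult c f - e * s" using eq by simp
    then have "r \<in> I" using sm[OF f e(1)] by simp
    with r e(3) have "r = 0" using not_le by blast
    with eq have "e dvd smult c f" by simp
    then have "primitive_part e dvd smult c f"
      by (metis content_times_primitive_part dvd_trans dvd_smult dvd_refl)
    then have "fract_poly (primitive_part e) dvd smult (to_fract c) (fract_poly f)"
      using fract_poly_dvd by (metis fract_poly_smult)
    then have "fract_poly (primitive_part e) dvd fract_poly f"
      using c by (simp add: dvd_smult_iff)
    then show ?thesis by (rule fract_poly_dvdD) (simp add: e)
  qed
  have "is_unit (primitive_part e)"
    using dvd[OF pI] dvd[OF qI] assms(1) by (meson coprime_common_divisor)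
  then obtain c where "primitive_part e = [:c:]" unfolding is_unit_poly_iff by blast
  then have "degree (primitive_part e) = 0" by (simp only: degree_pCons_0)
  then have "degree e = 0" by (simp only: degree_primitive_part)
  then obtain d where d: "e = [:d:]" by (rule degree_eq_zeroE)
  show ?thesis
  proof
    show "d \<noteq> 0" using e(2) d by auto
    fix z w assume "poly2 p (z, w) = 0" "poly2 q (z, w) = 0"
    moreover obtain a b where "e = a * p + b * q" using e(1) unfolding I_def by blast
    ultimately have "poly2 e (z, w) = 0" by (simp add: poly2_add poly2_mult)
    then show "poly d z = 0" by (simp add: d)
  qed
qed

section \<open>Power series for the resolvent\<close>

lemma has_sum_embed:
  fixes f :: "nat \<times> nat \<Rightarrow> 'b :: {comm_monoid_add, t2_space}"
  assumes "inj e" "((\<lambda>n. f (e n)) has_sum s) UNIV" "\<And>k. k \<notin> range e \<Longrightarrow> f k = 0"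
  shows "(f has_sum s) UNIV"
proof -
  have "(f has_sum s) (range e)"
    using assms(1,2) has_sum_reindex[of e UNIV f s] by (simp add: o_def)
  then show ?thesis
    by (rule has_sum_cong_neutral[THEN iffD1, rotated -1]) (use assms(3) in auto)
qed

text \<open>The geometric series in z / \<nu>, placed on the axis n = 0. For |\<nu>| = 1 the
  coefficients have constant modulus along that axis, which is why only \<open>disk_summable\<close>
  is claimed.\<close>

lemma power_series2_inverse_linear:
  assumes \<nu>: "1 \<le> cmod \<nu>"
  obtains \<alpha> where "disk_summable \<alpha>" "\<And>z w. cmod z < 1 \<Longrightarrow> cmod w < 1 \<Longrightarrow> power_series2 \<alpha> (z, w) = 1 / (z - \<nu>)"
proof
  define \<alpha> where "\<alpha> = (\<lambda>(m, n :: nat). if n = 0 then - ((1 / \<nu>) ^ Suc m) else 0)"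
  have "cmod (\<alpha> k) \<le> 1" for k
  proof -
    have "cmod ((1 / \<nu>) ^ Suc (fst k)) \<le> 1"
      unfolding norm_power by (rule power_le_one) (use \<nu> in \<open>auto simp: norm_divide divide_le_eq\<close>)
    then show ?thesis by (simp add: \<alpha>_def case_prod_unfold)
  qed
  then show "disk_summable \<alpha>" by (rule disk_summable_of_bounded)
  fix z w :: complex assume z: "cmod z < 1" "cmod w < 1"
  have \<nu>0: "\<nu> \<noteq> 0" and zn: "z \<noteq> \<nu>" using \<nu> z by auto
  have lt: "cmod (z / \<nu>) < 1" using z(1) \<nu> \<nu>0 by (simp add: norm_divide divide_less_eq)
  have "(\<lambda>n. norm ((z / \<nu>) ^ n)) sums (1 / (1 - cmod (z / \<nu>)))"
    using geometric_sums[of "cmod (z / \<nu>)"] lt by (simp add: norm_power)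
  then have "((\<lambda>n. (z / \<nu>) ^ n) has_sum (1 / (1 - z / \<nu>))) UNIV"
    using geometric_sums[OF lt] by (intro norm_summable_imp_has_sum) (auto simp: sums_iff)
  from has_sum_cmult_right[OF this, of "- 1 / \<nu>"]
  have "((\<lambda>n. - 1 / \<nu> * (z / \<nu>) ^ n) has_sum (1 / (z - \<nu>))) UNIV"
    by (rule back_subst[of "\<lambda>s. (_ has_sum s) UNIV"]) (use \<nu>0 zn in \<open>simp add: field_simps\<close>)
  then show "power_series2 \<alpha> (z, w) = 1 / (z - \<nu>)"
    by (intro power_series2I z has_sum_embed[where e = "\<lambda>m. (m, 0)"])
      (auto simp: \<alpha>_def inj_on_def image_iff power_divide)
qed

lemma power_series2_holomorphic_w:
  assumes g: "g holomorphic_on ball 0 1"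
  obtains \<beta> where "disk_summable \<beta>" "\<And>z w. cmod z < 1 \<Longrightarrow> cmod w < 1 \<Longrightarrow> power_series2 \<beta> (z, w) = g w"
proof
  define b where "b n = (deriv ^^ n) g 0 / fact n" for n
  define \<beta> where "\<beta> = (\<lambda>(m :: nat, n). if m = 0 then b n else 0)"
  have sums: "(\<lambda>n. b n * w ^ n) sums g w" if "cmod w < 1" for w
    using holomorphic_power_series[OF g, of w] that by (simp add: b_def)
  have abs: "summable (\<lambda>n. norm (b n * w ^ n))" if "cmod w < 1" for w
  proof (rule powser_insidea)
    \<comment> \<open>The midpoint between |w| and 1: convergence there gives absolute convergence
      at w.\<close>
    let ?r = "of_real ((cmod w + 1) / 2) :: complex"
    show "summable (\<lambda>n. b n * ?r ^ n)" by (rule sums_summable[OF sums]) (use that in simp)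
    show "norm w < norm ?r" using that norm_ge_zero[of w] unfolding norm_of_real by (simp add: field_simps)
  qed
  have inj: "inj (\<lambda>n. (0 :: nat, n :: nat))" by (simp add: inj_on_def)
  show "disk_summable \<beta>" unfolding disk_summable_def
  proof (intro allI impI)
    fix r :: real assume r: "0 \<le> r \<and> r < 1"
    have "summable (\<lambda>n. cmod (b n) * r ^ n)"
      using abs[of "of_real r"] r by (simp add: norm_mult norm_power)
    then have "(\<lambda>n. cmod (b n) * r ^ n) summable_on UNIV"
      using r by (intro summable_nonneg_imp_summable_on) auto
    then obtain s where "((\<lambda>n. cmod (b n) * r ^ n) has_sum s) UNIV" by (auto simp: summable_on_def)
    then have "((\<lambda>(m, n). cmod (\<beta> (m, n)) * r ^ (m + n)) has_sum s) UNIV"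
      by (intro has_sum_embed[OF inj]) (auto simp: \<beta>_def image_iff)
    then show "(\<lambda>(m, n). cmod (\<beta> (m, n)) * r ^ (m + n)) summable_on UNIV"
      by (rule has_sum_imp_summable)
  qed
  fix z w :: complex assume zw: "cmod z < 1" "cmod w < 1"
  have "((\<lambda>n. b n * w ^ n) has_sum g w) UNIV"
    using abs[OF zw(2)] sums[OF zw(2)] by (rule norm_summable_imp_has_sum)
  then show "power_series2 \<beta> (z, w) = g w"
    by (intro power_series2I zw has_sum_embed[OF inj]) (auto simp: \<beta>_def image_iff)
qed

text \<open>Synthetic division with infinitely many steps. Comparing coefficients in (z - \<nu>)
  \<alpha> = c gives the recursion \<alpha>(m - 1, n) - \<nu> \<alpha>(m, n) = c(m, n), which the
  tails defining \<alpha> satisfy for m \<ge> 1. At m = 0 it says that the sum of c(j, n) \<nu>^j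
  over j is zero, which is the vanishing on the line z = \<nu>.\<close>

lemma power_series2_divide_linear:
  assumes c: "square_summable c" and \<nu>: "cmod \<nu> < 1"
    and v: "\<And>w. cmod w < 1 \<Longrightarrow> power_series2 c (\<nu>, w) = 0"
  obtains \<alpha> where "disk_summable \<alpha>"
    "\<And>z w. cmod z < 1 \<Longrightarrow> cmod w < 1 \<Longrightarrow> (z - \<nu>) * power_series2 \<alpha> (z, w) = power_series2 c (z, w)"
proof -
  define \<alpha> where "\<alpha> = (\<lambda>(m, n). \<Sum>\<^sub>\<infinity>j. c (m + j + 1, n) * \<nu> ^ j)"
  have geo: "((\<lambda>j. M * cmod \<nu> ^ j) has_sum M / (1 - cmod \<nu>)) UNIV" for M :: real
  proof -
    have g: "(\<lambda>j. cmod \<nu> ^ j) sums (1 / (1 - cmod \<nu>))" using \<nu> by (intro geometric_sums) simp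
    have "((\<lambda>j. cmod \<nu> ^ j) has_sum (1 / (1 - cmod \<nu>))) UNIV"
      using g by (intro sums_nonneg_imp_has_sum) auto
    from has_sum_cmult_right[OF this, of M] show ?thesis by simp
  qed
  have abs: "(\<lambda>j. cmod (c (m + j, n) * \<nu> ^ j)) summable_on UNIV" for m n
    by (rule summable_on_comparison_test[OF has_sum_imp_summable[OF geo[of "l2_norm c"]]])
      (auto simp: norm_mult norm_power intro!: mult_right_mono cmod_le_l2_norm c)
  have sm: "(\<lambda>j. c (m + j, n) * \<nu> ^ j) summable_on UNIV" for m n
    using abs by - (rule abs_summable_summable)
  have "cmod (\<alpha> k) \<le> l2_norm c / (1 - cmod \<nu>)" for k
  proof -
    obtain m n where k: "k = (m, n)" by force
    have a: "(\<lambda>j. cmod (c (m + j + 1, n) * \<nu> ^ j)) summable_on UNIV" using abs[of "m + 1" n] by simp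
    have "cmod (\<alpha> k) \<le> (\<Sum>\<^sub>\<infinity>j. cmod (c (m + j + 1, n) * \<nu> ^ j))"
      unfolding \<alpha>_def k prod.case by (rule norm_infsum_bound[OF a])
    also have "\<dots> \<le> (\<Sum>\<^sub>\<infinity>j. l2_norm c * cmod \<nu> ^ j)"
      by (rule infsum_mono[OF a has_sum_imp_summable[OF geo]])
        (auto simp: norm_mult norm_power intro!: mult_right_mono cmod_le_l2_norm c)
    also have "\<dots> = l2_norm c / (1 - cmod \<nu>)" by (rule infsumI[OF geo])
    finally show ?thesis .
  qed
  then have \<alpha>: "disk_summable \<alpha>" by (rule disk_summable_of_bounded)
  have rec: "(\<Sum>\<^sub>\<infinity>j. c (m + j, n) * \<nu> ^ j) = c (m, n) + \<nu> * \<alpha> (m, n)" for m n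
  proof -
    have bij: "bij_betw Suc UNIV {1..}" by (rule bij_betwI[where g = "\<lambda>n. n - 1"]) auto
    have "(\<Sum>\<^sub>\<infinity>j. c (m + j, n) * \<nu> ^ j) = (\<Sum>\<^sub>\<infinity>j\<in>{0} \<union> {1..}. c (m + j, n) * \<nu> ^ j)"
      by (rule arg_cong[of _ _ "infsum _"]) auto
    also have "\<dots> = c (m, n) + (\<Sum>\<^sub>\<infinity>j\<in>{1..}. c (m + j, n) * \<nu> ^ j)"
      by (subst infsum_Un_disjoint) (auto intro: summable_on_subset_banach[OF sm])
    also have "(\<Sum>\<^sub>\<infinity>j\<in>{1..}. c (m + j, n) * \<nu> ^ j) = (\<Sum>\<^sub>\<infinity>j. c (m + Suc j, n) * \<nu> ^ Suc j)"
      by (rule infsum_reindex_bij_betw[OF bij, symmetric])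
    also have "\<dots> = (\<Sum>\<^sub>\<infinity>j. \<nu> * (c (m + j + 1, n) * \<nu> ^ j))" by (simp add: mult_ac)
    also have "\<dots> = \<nu> * \<alpha> (m, n)" by (simp add: \<alpha>_def infsum_cmult_right')
    finally show ?thesis .
  qed
  have edge: "c (0, n) + \<nu> * \<alpha> (0, n) = 0" for n
  proof -
    \<comment> \<open>The restriction to z = \<nu> is a series in w alone. It is regarded as a
      series in two variables, constant in z, so that \<open>power_series2_zero_imp\<close> yields
      the vanishing of its coefficients.\<close>
    define e where "e = (\<lambda>(m :: nat, n). if m = 0 then \<Sum>\<^sub>\<infinity>j. c (j, n) * \<nu> ^ j else 0)"
    have eb: "cmod (e k) \<le> l2_norm c / (1 - cmod \<nu>)" for k
    proof -
      obtain m n where k: "k = (m, n)" by force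
      have "cmod (\<Sum>\<^sub>\<infinity>j. c (j, n) * \<nu> ^ j) \<le> (\<Sum>\<^sub>\<infinity>j. cmod (c (j, n) * \<nu> ^ j))"
        using abs[of 0 n] by (intro norm_infsum_bound) simp
      also have "\<dots> \<le> (\<Sum>\<^sub>\<infinity>j. l2_norm c * cmod \<nu> ^ j)"
        by (rule infsum_mono[OF abs[of 0 n, simplified] has_sum_imp_summable[OF geo]])
          (auto simp: norm_mult norm_power intro!: mult_right_mono cmod_le_l2_norm c)
      also have "\<dots> = l2_norm c / (1 - cmod \<nu>)" by (rule infsumI[OF geo])
      finally show ?thesis using \<nu> l2_norm_nonneg[of c] by (auto simp: e_def k)
    qed
    have "power_series2 e x = 0" if xb: "x \<in> bidisk" for x
    proof -
      obtain z w where x: "x = (z, w)" and zw: "cmod z < 1" "cmod w < 1" using xb by (cases x) auto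
      let ?f = "\<lambda>(n, m). c (m, n) * \<nu> ^ m * w ^ n"
      have h: "((\<lambda>(m, n). c (m, n) * \<nu> ^ m * w ^ n) has_sum 0) UNIV"
        using power_series2_has_sum[OF disk_summable_l2[OF c] \<nu> zw(2)] v[OF zw(2)] by simp
      have bij: "bij_betw prod.swap UNIV (UNIV :: (nat \<times> nat) set)" by simp
      have h2: "(?f has_sum 0) (SIGMA n:UNIV. UNIV)"
        using h by (subst (asm) has_sum_reindex_bij_betw[OF bij, symmetric]) (simp add: case_prod_unfold prod.swap_def)
      have "((\<lambda>n. (\<Sum>\<^sub>\<infinity>j. c (j, n) * \<nu> ^ j) * w ^ n) has_sum 0) UNIV"
        by (rule has_sum_SigmaD[OF h2])
          (use has_sum_cmult_left[OF has_sum_infsum[OF sm[of 0, simplified]]] in simp)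
      then have "((\<lambda>(m, n). e (m, n) * z ^ m * w ^ n) has_sum 0) UNIV"
        by (intro has_sum_embed[where e = "\<lambda>n. (0, n)"]) (auto simp: e_def inj_on_def image_iff)
      then show ?thesis unfolding x by (rule power_series2I[OF zw])
    qed
    from power_series2_zero_imp[OF disk_summable_of_bounded[OF eb] this, of "(0, n)"]
    have "(\<Sum>\<^sub>\<infinity>j. c (j, n) * \<nu> ^ j) = 0" by (simp add: e_def)
    then show ?thesis using rec[of 0 n] by simp
  qed
  have "c = (\<lambda>k. shift 1 0 \<alpha> k + - \<nu> * \<alpha> k)"
  proof
    fix k :: "nat \<times> nat" obtain m n where k: "k = (m, n)" by force
    show "c k = shift 1 0 \<alpha> k + - \<nu> * \<alpha> k"
    proof (cases m)
      case 0
      then show ?thesis using edge[of n] by (simp add: k shift_def add_eq_0_iff)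
    next
      case (Suc l)
      have "\<alpha> (l, n) = c (m, n) + \<nu> * \<alpha> (m, n)" using rec[of m n] by (simp add: \<alpha>_def Suc)
      then show ?thesis by (simp add: k shift_def Suc)
    qed
  qed
  moreover have "disk_summable (shift 1 0 \<alpha>)"
    by (rule disk_summable_of_bounded[of _ "l2_norm c / (1 - cmod \<nu>)"])
      (use \<open>\<And>k. cmod (\<alpha> k) \<le> l2_norm c / (1 - cmod \<nu>)\<close> \<nu> l2_norm_nonneg[of c] in \<open>auto simp: shift_def\<close>)
  ultimately have "power_series2 c (z, w) = (z - \<nu>) * power_series2 \<alpha> (z, w)" if "cmod z < 1" "cmod w < 1" for z w
    using power_series2_add[OF _ disk_summable_cmult[OF \<alpha>], of "shift 1 0 \<alpha>" "- \<nu>"]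
      power_series2_shift[OF \<alpha> that, of 1 0]
    by (simp only: power_series2_cmult) (simp add: algebra_simps)
  then show ?thesis using \<alpha> by (intro that[of \<alpha>]) auto
qed

text \<open>The Bezout identity with B = 0 and A = 1 / (z - \<nu>), which is bounded by 1 / (|\<nu>|
  - 1) on the bidisk.\<close>

lemma (in inner_fun) resolvent_outside_disk:
  assumes "1 < cmod \<nu>"
  shows "\<nu> \<notin> op_spectrum K S"
proof -
  obtain \<alpha> where \<alpha>: "disk_summable \<alpha>" "\<And>z w. cmod z < 1 \<Longrightarrow> cmod w < 1 \<Longrightarrow> power_series2 \<alpha> (z, w) = 1 / (z - \<nu>)"
    by (rule power_series2_inverse_linear[OF less_imp_le[OF assms]]) blast
  have b: "cmod (power_series2 \<alpha> (z, w)) \<le> 1 / (cmod \<nu> - 1)" if "0 < r" "r < 1" "cmod z = r" "cmod w = r" for z w r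
  proof -
    have "cmod \<nu> - 1 \<le> cmod (z - \<nu>)" using norm_triangle_ineq2[of \<nu> z] that by (simp add: norm_minus_commute)
    then show ?thesis using that assms \<alpha>(2)[of z w] by (simp add: norm_divide frac_le)
  qed
  have C: "0 \<le> 1 / (cmod \<nu> - 1)" using assms by simp
  note m = hardy2_multiplier[OF \<alpha>(1) zero_less_one b C]
  show ?thesis
  proof (rule resolvent_of_bezout[where A = "power_series2 \<alpha>" and B = "\<lambda>_. 0" and C = "1 / (cmod \<nu> - 1)"])
    show "(\<lambda>x. 0 * f x) \<in> hardy2" if "f \<in> hardy2" for f by (rule hardy2_cmult[OF that])
    fix x assume "x \<in> bidisk"
    then show "(fst x - \<nu>) * power_series2 \<alpha> x + \<theta> x * 0 = 1"
      using \<alpha>(2) assms by (cases x) auto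
  qed (rule m; assumption)+
qed

section \<open>Rational inner functions\<close>

lemma infinite_complex_ball: "0 < e \<Longrightarrow> infinite (ball (x :: complex) e)"
  using finite_imp_not_open[of "ball x e"] by auto

lemma infinite_unit_circle: "infinite (sphere (0 :: complex) 1)"
proof
  assume "finite (sphere (0 :: complex) 1)"
  moreover have "connected (sphere (0 :: complex) 1)" by (rule connected_sphere) simp
  ultimately have "sphere (0 :: complex) 1 = {} \<or> (\<exists>a. sphere (0 :: complex) 1 = {a})"
    by (simp only: connected_finite_iff_sing)
  moreover have "1 \<in> sphere (0 :: complex) 1" "-1 \<in> sphere (0 :: complex) 1" by simp_all
  ultimately have "(1 :: complex) = -1" by (metis empty_iff singletonD)
  then show False by simp
qed

lemma holomorphic_zero_off_finite:
  assumes f: "f holomorphic_on ball 0 1" and F: "finite F" and z: "cmod z < 1"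
    and v: "\<And>u. cmod u < 1 \<Longrightarrow> u \<notin> F \<Longrightarrow> f u = 0"
  shows "f z = 0"
proof (rule analytic_continuation_open[of "ball 0 1 - F" "ball 0 1" f "\<lambda>_. 0" z])
  show "open (ball 0 1 - F)" using F by (intro open_Diff finite_imp_closed) auto
  show "ball 0 1 - F \<noteq> {}"
    using infinite_complex_ball[of 1 0] F by (metis Diff_eq_empty_iff finite_subset zero_less_one)
qed (use f z v in auto)

text \<open>The contrapositive of Hurwitz's theorem: a limit of zero-free functions that has a zero
  is constant, hence zero. An explicit error bound on the ball replaces locally uniform convergence,
  in the form supplied by Lipschitz estimates.\<close>

lemma hurwitz_ball:
  assumes "0 < e" and F: "\<And>n. F n holomorphic_on ball a e" and g: "g holomorphic_on ball a e"
    and d: "\<And>n x. x \<in> ball a e \<Longrightarrow> cmod (F n x - g x) \<le> d n" "d \<longlonglongrightarrow> 0"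
    and nz: "\<And>n x. x \<in> ball a e \<Longrightarrow> F n x \<noteq> 0" and a: "g a = 0" and x: "x \<in> ball a e"
  shows "g x = 0"
proof -
  have "g constant_on ball a e"
  proof (rule ccontr)
    assume nc: "\<not> g constant_on ball a e"
    have "g a \<noteq> 0"
    proof (rule Hurwitz_no_zeros[OF open_ball connected_ball F g _ nc nz])
      fix K assume K: "K \<subseteq> ball a e"
      show "uniform_limit K F g sequentially"
      proof (rule uniform_limitI)
        fix \<epsilon> :: real assume "0 < \<epsilon>"
        with d(2) have "\<forall>\<^sub>F n in sequentially. d n < \<epsilon>" by (rule order_tendstoD)
        then show "\<forall>\<^sub>F n in sequentially. \<forall>x\<in>K. dist (F n x) (g x) < \<epsilon>"
        proof (rule eventually_mono, intro ballI)
          fix n x assume "d n < \<epsilon>" "x \<in> K"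
          then show "dist (F n x) (g x) < \<epsilon>"
            using d(1)[of x n] K unfolding dist_norm by (meson le_less_trans subsetD)
        qed
      qed
    qed (use assms in auto)
    with a show False by simp
  qed
  then obtain y where y: "\<And>x. x \<in> ball a e \<Longrightarrow> g x = y" by (auto simp: constant_on_def)
  from y[of a] y[of x] x a \<open>0 < e\<close> show ?thesis by auto
qed

lemma closure_bidisk: "closure bidisk = cball 0 1 \<times> cball 0 1"
  by (simp add: bidisk_def closure_Times)

locale rational_inner_fun = inner_fun +
  fixes q p :: "complex poly poly"
  assumes reduced: "reduced_fraction \<theta> q p"
begin

section \<open>Numerator and denominator on the closed bidisk\<close>

lemma p_nonzero: "p \<noteq> 0" and coprime_p_q: "coprime p q"
  using reduced by (auto simp: reduced_fraction_def)

text \<open>The fraction is given only where p is nonzero. Analytic continuation in z covers each w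
  for which p(., w) is not the zero polynomial; the finitely many remaining w are reached by
  continuation in w.\<close>

lemma \<theta>_mult_p:
  assumes "x \<in> bidisk"
  shows "\<theta> x * poly2 p x = poly2 q x"
proof -
  have off: "\<theta> x * poly2 p x = poly2 q x" if "x \<in> bidisk" "poly2 p x \<noteq> 0" for x
    using reduced that by (simp add: reduced_fraction_def)
  have generic: "\<theta> (z, w) * poly2 p (z, w) = poly2 q (z, w)" if zw: "cmod z < 1" "cmod w < 1" "poly p [:w:] \<noteq> 0" for z w
  proof -
    let ?f = "\<lambda>z. \<theta> (z, w) * poly2 p (z, w) - poly2 q (z, w)"
    have "?f z = 0"
    proof (rule holomorphic_zero_off_finite[where f = ?f and z = z])
      show "?f holomorphic_on ball 0 1"
        using holomorphic_section_z[OF disk_coeffs zw(2)] unfolding coeffs_\<theta>(2)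
        by (intro holomorphic_on_diff holomorphic_on_mult holomorphic_on_poly2_z)
      show "finite {z. poly (poly p [:w:]) z = 0}" by (rule poly_roots_finite[OF zw(3)])
    qed (use zw off in \<open>auto simp: poly2_def\<close>)
    then show ?thesis by simp
  qed
  obtain z w where x: "x = (z, w)" by force
  with assms have zw: "cmod z < 1" "cmod w < 1" by auto
  let ?f = "\<lambda>w. \<theta> (z, w) * poly2 p (z, w) - poly2 q (z, w)"
  have "?f w = 0"
  proof (rule holomorphic_zero_off_finite[where f = ?f and z = w])
    show "?f holomorphic_on ball 0 1"
      using holomorphic_section_w[OF disk_coeffs zw(1)] unfolding coeffs_\<theta>(2)
      by (intro holomorphic_on_diff holomorphic_on_mult holomorphic_on_poly2_w)
    have "finite {x. poly p x = 0}" by (rule poly_roots_finite[OF p_nonzero])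
    then have "finite ((\<lambda>w. [:w:]) -` {x. poly p x = 0})"
      by (rule finite_vimageI) (simp add: inj_on_def)
    then show "finite {w. poly p [:w:] = 0}" by (simp add: vimage_def)
  qed (use zw generic in auto)
  then show ?thesis by (simp add: x)
qed

text \<open>Radial limits in the product identity give the equality almost everywhere, without
  dividing at possible boundary zeros of p. Both sides are continuous, so the exceptional set in the
  open square is open; being null, it is empty, and the closure supplies the edges.\<close>

lemma modulus_on_torus:
  assumes "cmod z = 1" "cmod w = 1"
  shows "cmod (poly2 p (z, w)) = cmod (poly2 q (z, w))"
proof -
  let ?e = "\<lambda>x. (cis (fst x), cis (snd x))"
  define G where "G = {x :: real \<times> real. cmod (poly2 p (?e x)) = cmod (poly2 q (?e x))}"
  define Q where "Q = {0<..<2 * pi} \<times> {0<..<2 * pi}"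
  have cl: "closed G" unfolding G_def
    by (intro closed_Collect_eq continuous_intros)
  have point: "cmod (poly2 p (cis s, cis t)) = cmod (poly2 q (cis s, cis t))"
    if "((\<lambda>r. \<theta> (of_real r * cis s, of_real r * cis t)) \<longlongrightarrow> l) (at_left (1::real))" "cmod l = 1" for s t l
  proof -
    have r: "((\<lambda>r. poly2 f (of_real r * cis s, of_real r * cis t)) \<longlongrightarrow> poly2 f (of_real 1 * cis s, of_real 1 * cis t)) (at_left (1::real))" for f
    proof -
      have "continuous_on UNIV (\<lambda>r::real. poly2 f (of_real r * cis s, of_real r * cis t))"
        by (intro continuous_intros)
      then have "isCont (\<lambda>r::real. poly2 f (of_real r * cis s, of_real r * cis t)) 1"
        by (simp add: continuous_on_eq_continuous_at)
      then show ?thesis unfolding isCont_def by (rule tendsto_mono[OF at_le, rotated]) simp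
    qed
    have "((\<lambda>r. \<theta> (of_real r * cis s, of_real r * cis t) * poly2 p (of_real r * cis s, of_real r * cis t))
       \<longlongrightarrow> l * poly2 p (of_real 1 * cis s, of_real 1 * cis t)) (at_left (1::real))"
      by (intro tendsto_mult that(1) r)
    moreover have "\<forall>\<^sub>F r in at_left (1::real). \<theta> (of_real r * cis s, of_real r * cis t) * poly2 p (of_real r * cis s, of_real r * cis t)
        = poly2 q (of_real r * cis s, of_real r * cis t)"
      by (rule eventually_at_leftI[of 0]) (auto intro!: \<theta>_mult_p simp: norm_mult)
    ultimately have "((\<lambda>r. poly2 q (of_real r * cis s, of_real r * cis t)) \<longlongrightarrow> l * poly2 p (of_real 1 * cis s, of_real 1 * cis t)) (at_left (1::real))"
      by (rule Lim_transform_eventually)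
    then have "l * poly2 p (of_real 1 * cis s, of_real 1 * cis t) = poly2 q (of_real 1 * cis s, of_real 1 * cis t)"
      by (rule tendsto_unique[OF trivial_limit_at_left_real _ r])
    then have "cmod l * cmod (poly2 p (cis s, cis t)) = cmod (poly2 q (cis s, cis t))"
      by (simp flip: norm_mult)
    then show ?thesis using that(2) by simp
  qed
  have "AE x in torus. x \<in> G"
    using inner_function_radial_limit[OF inner] by eventually_elim (use point in \<open>auto simp: G_def\<close>)
  then have "AE x in lborel. x \<in> {0..2 * pi} \<times> {0..2 * pi} \<longrightarrow> x \<in> G"
    unfolding torus_def by (subst (asm) AE_restrict_space_iff) auto
  then have AE: "AE x in lborel. x \<in> Q \<longrightarrow> x \<in> G"
    by eventually_elim (auto simp: Q_def)
  have "Q - G = {}"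
  proof (rule ccontr)
    assume ne: "Q - G \<noteq> {}"
    have op: "open (Q - G)" unfolding Q_def using cl by (intro open_Diff open_Times) auto
    from AE obtain N where N: "{x. \<not> (x \<in> Q \<longrightarrow> x \<in> G)} \<subseteq> N" "N \<in> null_sets lborel"
      by (auto simp: eventually_ae_filter)
    have "Q - G \<in> null_sets lborel"
      by (rule null_sets_subset[OF N(2)]) (use N(1) op in auto)
    then have "Q - G \<in> null_sets lebesgue" by (rule null_sets_completionI)
    then have "negligible (Q - G)" by (simp add: negligible_iff_null_sets)
    with open_not_negligible[OF op ne] show False by simp
  qed
  then have "closure Q \<subseteq> G" using cl by (intro closure_minimal) auto
  then have sub: "{0..2 * pi} \<times> {0..2 * pi} \<subseteq> G"
    unfolding Q_def closure_Times by simp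
  have arg: "\<exists>s\<in>{0..2 * pi}. cis s = u" if "cmod u = 1" for u
  proof -
    have "u = cis (Arg2pi u)" using Arg2pi_eq[of u] that by (simp add: cis_conv_exp)
    then show ?thesis using Arg2pi_ge_0[of u] Arg2pi_lt_2pi[of u] by (intro bexI[of _ "Arg2pi u"]) auto
  qed
  obtain s where s: "s \<in> {0..2 * pi}" "cis s = z" using arg[OF assms(1)] by blast
  obtain t where t: "t \<in> {0..2 * pi}" "cis t = w" using arg[OF assms(2)] by blast
  have "(s, t) \<in> G" using sub s t by blast
  then show ?thesis using s t by (simp add: G_def)
qed

text \<open>Turns lower bounds for the numerator into lower bounds for the denominator, which is
  what controls the quotient \<theta> near a line z = \<nu> on which q has no zeros.\<close>

lemma q_le_p:
  assumes "cmod z \<le> 1" "cmod w \<le> 1"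
  shows "cmod (poly2 q (z, w)) \<le> cmod (poly2 p (z, w))"
proof -
  have "closure bidisk \<subseteq> {x. cmod (poly2 q x) \<le> cmod (poly2 p x)}"
  proof (rule closure_minimal)
    show "closed {x. cmod (poly2 q x) \<le> cmod (poly2 p x)}"
      by (intro closed_Collect_le continuous_intros)
    show "bidisk \<subseteq> {x. cmod (poly2 q x) \<le> cmod (poly2 p x)}"
    proof clarsimp
      fix z w :: complex assume zw: "cmod z < 1" "cmod w < 1"
      have "cmod (poly2 q (z, w)) = cmod (\<theta> (z, w)) * cmod (poly2 p (z, w))"
        using \<theta>_mult_p[of "(z, w)"] zw by (simp flip: norm_mult)
      then show "cmod (poly2 q (z, w)) \<le> cmod (poly2 p (z, w))"
        using \<theta>_le_1[of "(z, w)"] by (simp add: mult_left_le_one_le)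
    qed
  qed
  then have "(z, w) \<in> {x. cmod (poly2 q x) \<le> cmod (poly2 p x)}"
    by (rule subsetD) (simp add: closure_bidisk assms)
  then show ?thesis by simp
qed

text \<open>With g(w) = p(\<nu>, w) / q(\<nu>, w), the multiplier A is (1 - g \<theta>) / (z -
  \<nu>). For |\<nu>| < 1 the numerator vanishes on z = \<nu> and is divided coefficientwise; for
  |\<nu>| = 1 it is multiplied by the series of 1 / (z - \<nu>). Boundedness of A is trivial away
  from \<nu> and follows from Lipschitz estimates near \<nu>.\<close>

lemma resolvent_rational:
  assumes \<nu>: "cmod \<nu> \<le> 1" and nz: "\<And>w. cmod w \<le> 1 \<Longrightarrow> poly2 q (\<nu>, w) \<noteq> 0"
  shows "\<nu> \<notin> op_spectrum K S"
proof -
  have "continuous_on (cball 0 1) (\<lambda>w. cmod (poly2 q (\<nu>, w)))" by (intro continuous_intros)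
  then obtain w0 where w0: "w0 \<in> cball 0 1" "\<And>w. w \<in> cball 0 1 \<Longrightarrow> cmod (poly2 q (\<nu>, w0)) \<le> cmod (poly2 q (\<nu>, w))"
    using continuous_attains_inf[of "cball (0 :: complex) 1" "\<lambda>w. cmod (poly2 q (\<nu>, w))"] by auto
  define \<delta> where "\<delta> = cmod (poly2 q (\<nu>, w0))"
  have \<delta>: "0 < \<delta>" "\<And>w. cmod w \<le> 1 \<Longrightarrow> \<delta> \<le> cmod (poly2 q (\<nu>, w))"
    using w0 nz by (auto simp: \<delta>_def)
  obtain L where "lipschitz_bound q L" using poly2_lipschitz by blast
  note L = lipschitz_boundD[OF this]
  obtain H where "lipschitz_bound p H" using poly2_lipschitz by blast
  note H = lipschitz_boundD[OF this]
  define g where "g w = poly2 p (\<nu>, w) / poly2 q (\<nu>, w)" for w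
  define M where "M = H / \<delta>"
  have M: "0 \<le> M" using H \<delta> by (simp add: M_def)
  have g: "cmod (g w) \<le> M" if "cmod w < 1" for w
    unfolding g_def M_def norm_divide using \<delta> H \<nu> that by (intro frac_le) auto
  have "g holomorphic_on ball 0 1" unfolding g_def
    using nz by (intro holomorphic_on_divide holomorphic_on_poly2_w) auto
  then obtain \<beta> where \<beta>: "disk_summable \<beta>" "\<And>z w. cmod z < 1 \<Longrightarrow> cmod w < 1 \<Longrightarrow> power_series2 \<beta> (z, w) = g w"
    by (rule power_series2_holomorphic_w) blast
  let ?B = "power_series2 \<beta>"
  have bB: "cmod (?B (z, w)) \<le> M" if "0 < r" "r < 1" "cmod z = r" "cmod w = r" for z w r
    using that g \<beta>(2) by simp
  note Bm = hardy2_multiplier[OF \<beta>(1) zero_less_one bB M]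
  \<comment> \<open>The constant 1 must be cut off outside the bidisk to belong to
    \<open>hardy2\<close>.\<close>
  let ?u = "power_series2 unit_coeffs"
  define F where "F = (\<lambda>x. ?u x - ?B x * \<theta> x)"
  have "F \<in> hardy2" unfolding F_def by (intro hardy2_diff hardy2I square_summable_unit Bm(1) \<theta>_hardy2)
  then obtain c where c: "square_summable c" "F = power_series2 c" by (rule hardy2E)
  have F: "F (z, w) = 1 - g w * \<theta> (z, w)" if "cmod z < 1" "cmod w < 1" for z w
    using that power_series2_unit[of "(z, w)"] \<beta>(2) by (simp add: F_def)
  obtain \<alpha> where \<alpha>: "disk_summable \<alpha>"
    "\<And>z w. cmod z < 1 \<Longrightarrow> cmod w < 1 \<Longrightarrow> (z - \<nu>) * power_series2 \<alpha> (z, w) = F (z, w)"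
  proof (cases "cmod \<nu> < 1")
    case True
    have "power_series2 c (\<nu>, w) = 0" if w: "cmod w < 1" for w
    proof -
      have "g w * \<theta> (\<nu>, w) = 1"
        using \<theta>_mult_p[of "(\<nu>, w)"] nz[of w] True w by (simp add: g_def field_simps)
      then show ?thesis using F[OF True w] by (simp add: c)
    qed
    from power_series2_divide_linear[OF c(1) True this] show ?thesis using that unfolding c(2) by blast
  next
    case False
    then have n1: "1 \<le> cmod \<nu>" by simp
    obtain \<alpha>\<^sub>0 where a0: "disk_summable \<alpha>\<^sub>0" "\<And>z w. cmod z < 1 \<Longrightarrow> cmod w < 1 \<Longrightarrow> power_series2 \<alpha>\<^sub>0 (z, w) = 1 / (z - \<nu>)"
      by (rule power_series2_inverse_linear[OF n1]) blast
    note cd = disk_summable_l2[OF c(1)]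
    show ?thesis
    proof (rule that[OF disk_summable_cauchy_prod[OF a0(1) cd]])
      fix z w :: complex assume zw: "cmod z < 1" "cmod w < 1"
      then have "z \<noteq> \<nu>" using n1 by auto
      then show "(z - \<nu>) * power_series2 (cauchy_prod \<alpha>\<^sub>0 c) (z, w) = F (z, w)"
        using a0(2)[OF zw] by (simp add: power_series2_cauchy_prod[OF a0(1) cd] c(2))
    qed
  qed
  \<comment> \<open>Within distance \<epsilon> of \<nu> the Lipschitz bound lets |q| drop by at most
    \<delta>/2, hence |p| \<ge> \<delta>/2 as well; L + 1 avoids a zero denominator. In C the two
    entries are the bounds far from and near to \<nu>.\<close>
  define \<epsilon> where "\<epsilon> = \<delta> / (2 * (L + 1))"
  have \<epsilon>: "0 < \<epsilon>" using \<delta> L by (simp add: \<epsilon>_def)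
  define C where "C = max ((1 + M) / \<epsilon>) (2 * H * L / (\<delta> / 2 * \<delta>))"
  have C0: "0 \<le> C" using M \<epsilon> by (simp add: C_def le_max_iff_disj)
  have bA: "cmod (power_series2 \<alpha> (z, w)) \<le> C" if z: "cmod z < 1" "cmod w < 1" "z \<noteq> \<nu>" for z w
  proof -
    have d0: "0 < cmod (z - \<nu>)" using z by simp
    have eq: "cmod (power_series2 \<alpha> (z, w)) = cmod (F (z, w)) / cmod (z - \<nu>)"
    proof -
      have "cmod (z - \<nu>) * cmod (power_series2 \<alpha> (z, w)) = cmod (F (z, w))"
        using \<alpha>(2)[OF z(1,2)] by (metis norm_mult)
      then show ?thesis using d0 by (simp only: nonzero_eq_divide_eq[OF less_imp_neq[OF d0, symmetric]] mult.commute)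
    qed
    show ?thesis
    proof (cases "\<epsilon> \<le> cmod (z - \<nu>)")
      case True
      have "cmod (F (z, w)) \<le> 1 + cmod (g w) * cmod (\<theta> (z, w))"
        using norm_triangle_ineq4[of 1 "g w * \<theta> (z, w)"] by (simp add: F[OF z(1,2)] norm_mult)
      also have "\<dots> \<le> 1 + M * 1"
        using g[OF z(2)] \<theta>_le_1 M by (intro add_left_mono mult_mono) auto
      finally have "cmod (F (z, w)) / cmod (z - \<nu>) \<le> (1 + M) / \<epsilon>"
        using True \<epsilon> M by (intro frac_le) auto
      then show ?thesis by (simp add: eq C_def)
    next
      case False
      note le = less_imp_le[OF z(1)] less_imp_le[OF z(2)]
      have "L * cmod (z - \<nu>) \<le> L * \<epsilon>" using False L by (intro mult_left_mono) auto
      also have "\<dots> \<le> \<delta> / 2" using L \<delta> by (simp add: \<epsilon>_def field_simps)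
      finally have "cmod (poly2 q (\<nu>, w)) - cmod (poly2 q (z, w)) \<le> \<delta> / 2"
        using L(2)[OF \<nu> le(1) le(2) le(2)] norm_triangle_ineq2[of "poly2 q (\<nu>, w)" "poly2 q (z, w)"]
        by (simp add: norm_minus_commute)
      then have "\<delta> / 2 \<le> cmod (poly2 q (z, w))" using \<delta>(2)[OF le(2)] by simp
      then have pb: "\<delta> / 2 \<le> cmod (poly2 p (z, w))" using q_le_p[OF le] by linarith
      then have p0: "poly2 p (z, w) \<noteq> 0" using \<delta>(1) by auto
      have q0: "poly2 q (\<nu>, w) \<noteq> 0" using nz[OF le(2)] .
      \<comment> \<open>This is p(z, w) q(\<nu>, w) - p(\<nu>, w) q(z, w) with p(\<nu>, w) q(\<nu>,
        w) inserted, so that each summand contains a difference of order |z - \<nu>|, cancelling the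
        denominator of A.\<close>
      let ?N = "(poly2 p (z, w) - poly2 p (\<nu>, w)) * poly2 q (\<nu>, w) + poly2 p (\<nu>, w) * (poly2 q (\<nu>, w) - poly2 q (z, w))"
      have "\<theta> (z, w) = poly2 q (z, w) / poly2 p (z, w)"
        using \<theta>_mult_p[of "(z, w)"] z p0 by (simp add: eq_divide_eq)
      then have "F (z, w) = ?N / (poly2 p (z, w) * poly2 q (\<nu>, w))"
        using p0 q0 by (simp add: F[OF z(1,2)] g_def field_simps)
      then have "cmod (F (z, w)) = cmod ?N / (cmod (poly2 p (z, w)) * cmod (poly2 q (\<nu>, w)))"
        by (simp add: norm_divide norm_mult)
      also have "\<dots> \<le> (2 * H * L * cmod (z - \<nu>)) / (\<delta> / 2 * \<delta>)"
      proof (rule frac_le)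
        have "cmod ?N \<le> cmod (poly2 p (z, w) - poly2 p (\<nu>, w)) * cmod (poly2 q (\<nu>, w)) + cmod (poly2 p (\<nu>, w)) * cmod (poly2 q (\<nu>, w) - poly2 q (z, w))"
          by (metis norm_mult norm_triangle_ineq)
        also have "\<dots> \<le> (H * cmod (z - \<nu>)) * L + H * (L * cmod (z - \<nu>))"
          using H(2)[OF le(1) \<nu> le(2) le(2)] L(2)[OF \<nu> le(1) le(2) le(2)] H L \<nu> le
          by (intro add_mono mult_mono) (auto simp: norm_minus_commute)
        finally show "cmod ?N \<le> 2 * H * L * cmod (z - \<nu>)" by (simp add: algebra_simps)
        show "\<delta> / 2 * \<delta> \<le> cmod (poly2 p (z, w)) * cmod (poly2 q (\<nu>, w))"
          using pb \<delta>(2)[OF le(2)] \<delta>(1) by (intro mult_mono) auto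
      qed (use H L \<delta> in auto)
      finally have "cmod (F (z, w)) / cmod (z - \<nu>) \<le> 2 * H * L / (\<delta> / 2 * \<delta>)"
        using d0 by (simp add: field_simps)
      then show ?thesis by (simp add: eq C_def)
    qed
  qed
  \<comment> \<open>Guarantees z \<noteq> \<nu> on the tori in question: their radius exceeds
    |\<nu>| when \<nu> is inside the disk and is smaller than |\<nu>| when \<nu> is on the
    circle.\<close>
  define r0 where "r0 = (if cmod \<nu> < 1 then cmod \<nu> else 0)"
  have r0: "r0 < 1" by (simp add: r0_def)
  have bA': "cmod (power_series2 \<alpha> (z, w)) \<le> C" if "r0 < r" "r < 1" "cmod z = r" "cmod w = r" for z w r
    using that by (intro bA) (auto simp: r0_def split: if_splits)
  note Am = hardy2_multiplier[OF \<alpha>(1) r0 bA' C0]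
  show ?thesis
  proof (rule resolvent_of_bezout[where A = "power_series2 \<alpha>" and B = ?B and C = C])
    fix x assume xb: "x \<in> bidisk"
    obtain z w where x: "x = (z, w)" by force
    have zw: "cmod z < 1" "cmod w < 1" using xb by (auto simp: x)
    show "(fst x - \<nu>) * power_series2 \<alpha> x + \<theta> x * ?B x = 1"
      using \<alpha>(2)[OF zw] F[OF zw] \<beta>(2)[OF zw] by (simp add: x)
  qed (rule Am Bm; assumption)+
qed

text \<open>Common zeros of \<open>p\<close> and \<open>q\<close> have isolated first coordinates, whereas by Hurwitz's theorem
  the zeros of \<open>p\<close> do not.\<close>

lemma \<theta>_zero_of_q_zero:
  assumes zw: "cmod \<nu> < 1" "cmod w0 < 1" and q0: "poly2 q (\<nu>, w0) = 0"
  shows "\<theta> (\<nu>, w0) = 0"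
proof (rule ccontr)
  assume "\<theta> (\<nu>, w0) \<noteq> 0"
  then have p0: "poly2 p (\<nu>, w0) = 0" using \<theta>_mult_p[of "(\<nu>, w0)"] zw q0 by simp
  obtain d where d: "d \<noteq> 0" "\<And>z w. poly2 p (z, w) = 0 \<Longrightarrow> poly2 q (z, w) = 0 \<Longrightarrow> poly d z = 0"
    using coprime_eliminate_w[OF coprime_p_q p_nonzero] by blast
  have "finite ({z. poly d z = 0} - {\<nu>})" using poly_roots_finite[OF d(1)] by simp
  then obtain \<epsilon> where \<epsilon>: "0 < \<epsilon>" "\<And>z. z \<in> {z. poly d z = 0} - {\<nu>} \<Longrightarrow> \<epsilon> \<le> dist \<nu> z"
    using finite_set_avoid[of "{z. poly d z = 0} - {\<nu>}" \<nu>] by auto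
  obtain H where "lipschitz_bound p H" using poly2_lipschitz by blast
  note H = lipschitz_boundD[OF this]
  define \<eta> where "\<eta> = min \<epsilon> (1 - cmod \<nu>)"
  have \<eta>: "0 < \<eta>" using \<epsilon> zw by (simp add: \<eta>_def)
  \<comment> \<open>A sequence tending to \<nu> inside the disk whose members are not roots of d.
    The offset 2 makes all distances to \<nu> strictly smaller than \<eta>.\<close>
  define z where "z n = \<nu> + of_real (\<eta> / real (n + 2))" for n :: nat
  have zn: "cmod (z n) < 1" "z n \<noteq> \<nu>" "dist \<nu> (z n) < \<epsilon>" "cmod (z n - \<nu>) = \<eta> / real (n + 2)" for n
  proof -
    have "\<eta> * 1 < \<eta> * real (n + 2)" using \<eta> by (intro mult_strict_left_mono) auto
    then have lt: "\<eta> / real (n + 2) < \<eta>" by (simp add: divide_less_eq)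
    have "z n - \<nu> = of_real (\<eta> / real (n + 2))" by (simp add: z_def)
    then show e: "cmod (z n - \<nu>) = \<eta> / real (n + 2)" using \<eta> by (simp only: norm_of_real) simp
    show "dist \<nu> (z n) < \<epsilon>" using e lt by (simp add: dist_norm norm_minus_commute \<eta>_def)
    have "cmod (z n) \<le> cmod \<nu> + cmod (z n - \<nu>)" by (metis add.commute diff_add_cancel norm_triangle_ineq)
    then show "cmod (z n) < 1" using e lt by (simp add: \<eta>_def)
    have "0 < cmod (z n - \<nu>)" unfolding e using \<eta> by simp
    then show "z n \<noteq> \<nu>" by auto
  qed
  let ?e = "1 - cmod w0"
  have in_disk: "cmod w < 1" if "w \<in> ball w0 ?e" for w
    using that norm_triangle_ineq2[of w w0] by (simp add: dist_norm norm_minus_commute)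
  have zero: "poly2 p (\<nu>, w) = 0" if w: "w \<in> ball w0 ?e" for w
  proof (rule hurwitz_ball[where F = "\<lambda>n w. poly2 p (z n, w)" and d = "\<lambda>n. H * (\<eta> / real (n + 2))" and a = w0 and e = ?e and g = "\<lambda>w. poly2 p (\<nu>, w)" and x = w])
    show "poly2 p (z n, w) \<noteq> 0" if w: "w \<in> ball w0 ?e" for n w
    proof
      assume 0: "poly2 p (z n, w) = 0"
      then have "poly2 q (z n, w) = 0" using \<theta>_mult_p[of "(z n, w)"] zn in_disk[OF w] by simp
      with 0 d have "poly d (z n) = 0" by blast
      then have "\<epsilon> \<le> dist \<nu> (z n)" using \<epsilon>(2) zn(2) by simp
      with zn(3)[of n] show False by simp
    qed
    show "cmod (poly2 p (z n, w) - poly2 p (\<nu>, w)) \<le> H * (\<eta> / real (n + 2))" if w: "w \<in> ball w0 ?e" for n w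
      using H(2)[of "z n" \<nu> w w] zn[of n] zw in_disk[OF w] by simp
    show "(\<lambda>n. H * (\<eta> / real (n + 2))) \<longlonglongrightarrow> 0" by real_asymp
  qed (use w p0 zw in \<open>auto intro: holomorphic_on_poly2_w\<close>)
  \<comment> \<open>Vanishing of p on a piece of the line z = \<nu> passes to q through the product
    identity, which makes z - \<nu> a common factor.\<close>
  then have "poly2 q (\<nu>, w) = 0" if w: "w \<in> ball w0 ?e" for w
    using \<theta>_mult_p[of "(\<nu>, w)"] zw in_disk[OF w] w by simp
  with zero have "ball w0 ?e \<subseteq> {w. poly2 p (\<nu>, w) = 0}" "ball w0 ?e \<subseteq> {w. poly2 q (\<nu>, w) = 0}" by auto
  then have "infinite {w. poly2 p (\<nu>, w) = 0}" "infinite {w. poly2 q (\<nu>, w) = 0}"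
    using infinite_complex_ball[of ?e w0] zw finite_subset by (metis diff_gt_0_iff_gt)+
  from not_coprime_of_vanishing_w[OF this] coprime_p_q show False by simp
qed

text \<open>If no zero of \<theta> had its first coordinate near \<nu>, the functions q(., r w0)
  with r < 1 would be zero-free near \<nu>. As r tends to 1, Hurwitz's theorem in z would force q(.,
  w0) to vanish identically; equality of moduli on the torus would make p vanish on the same line,
  contrary to coprimality.\<close>

lemma spectrum_boundary_w:
  assumes zw: "cmod \<nu> < 1" "cmod w0 = 1" and q0: "poly2 q (\<nu>, w0) = 0"
  shows "\<nu> \<in> closure (fst ` {x \<in> bidisk. \<theta> x = 0})"
proof (rule ccontr)
  assume "\<nu> \<notin> closure (fst ` {x \<in> bidisk. \<theta> x = 0})"
  then obtain \<epsilon> where \<epsilon>: "0 < \<epsilon>" "\<And>y. y \<in> fst ` {x \<in> bidisk. \<theta> x = 0} \<Longrightarrow> \<epsilon> \<le> dist y \<nu>"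
    unfolding closure_approachable by (meson not_less)
  obtain L where "lipschitz_bound q L" using poly2_lipschitz by blast
  note L = lipschitz_boundD[OF this]
  define \<eta> where "\<eta> = min \<epsilon> (1 - cmod \<nu>)"
  have \<eta>: "0 < \<eta>" using \<epsilon> zw by (simp add: \<eta>_def)
  have in_disk: "cmod z < 1" "dist z \<nu> < \<epsilon>" if "z \<in> ball \<nu> \<eta>" for z
    using that norm_triangle_ineq2[of z \<nu>] by (auto simp: dist_norm norm_minus_commute \<eta>_def)
  let ?w = "\<lambda>n. of_real (radius n) * w0"
  have wn: "cmod (?w n) < 1" "cmod (?w n - w0) = 1 - radius n" for n
  proof -
    show "cmod (?w n) < 1" using radius[of n] zw by (simp add: norm_mult)
    have "?w n - w0 = of_real (radius n - 1) * w0" by (simp add: algebra_simps)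
    then show "cmod (?w n - w0) = 1 - radius n" using radius[of n] zw by (simp add: norm_mult del: of_real_diff)
  qed
  have zero: "poly2 q (z, w0) = 0" if z: "z \<in> ball \<nu> \<eta>" for z
  proof (rule hurwitz_ball[where F = "\<lambda>n z. poly2 q (z, ?w n)" and d = "\<lambda>n. L * (1 - radius n)" and a = \<nu> and e = \<eta> and g = "\<lambda>z. poly2 q (z, w0)" and x = z])
    show "poly2 q (z, ?w n) \<noteq> 0" if z: "z \<in> ball \<nu> \<eta>" for n z
    proof
      assume "poly2 q (z, ?w n) = 0"
      then have "\<theta> (z, ?w n) = 0" by (rule \<theta>_zero_of_q_zero[OF in_disk(1)[OF z] wn(1)])
      then have "(z, ?w n) \<in> {x \<in> bidisk. \<theta> x = 0}" using in_disk(1)[OF z] wn(1)[of n] by simp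
      then have "z \<in> fst ` {x \<in> bidisk. \<theta> x = 0}" by force
      with \<epsilon>(2) in_disk(2)[OF z] show False by fastforce
    qed
    show "cmod (poly2 q (z, ?w n) - poly2 q (z, w0)) \<le> L * (1 - radius n)" if z: "z \<in> ball \<nu> \<eta>" for n z
      using L(2)[of z z "?w n" w0] in_disk(1)[OF z] wn[of n] zw by simp
    have "(\<lambda>n. L * (1 - radius n)) \<longlonglongrightarrow> L * (1 - 1)" by (intro tendsto_intros radius_tendsto)
    then show "(\<lambda>n. L * (1 - radius n)) \<longlonglongrightarrow> 0" by simp
  qed (use \<eta> q0 z in \<open>auto intro: holomorphic_on_poly2_z\<close>)
  then have "ball \<nu> \<eta> \<subseteq> {z. poly2 q (z, w0) = 0}" by auto
  then have iq: "infinite {z. poly2 q (z, w0) = 0}"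
    using infinite_complex_ball[OF \<eta>] finite_subset by blast
  \<comment> \<open>Vanishing near \<nu> has to be spread over the whole line, because |p| = |q| is
    available only where |z| = 1.\<close>
  then have "poly q [:w0:] = 0" by (rule poly2_eq_0_z)
  then have "poly2 q (z, w0) = 0" for z by (simp add: poly2_def)
  then have "sphere 0 1 \<subseteq> {z. poly2 p (z, w0) = 0}"
    using modulus_on_torus[OF _ zw(2)] by auto
  then have "infinite {z. poly2 p (z, w0) = 0}"
    using infinite_unit_circle finite_subset by blast
  from not_coprime_of_vanishing_z[OF this iq] coprime_p_q show False by simp
qed

text \<open>Handles the functions excluded in \<open>circle_in_spectrum\<close>. Independence of w
  gives p(z, w) q(z, 0) = q(z, w) p(z, 0), and coprimality then removes w from both polynomials. A
  zero of q over the circle would be a zero of p as well, and both would vanish on the whole line z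
  = \<nu>.\<close>

lemma depends_only_on_z_no_boundary_zero:
  assumes dep: "depends_only_on_z \<theta>" and zw: "cmod \<nu> = 1" "cmod w0 \<le> 1" and q0: "poly2 q (\<nu>, w0) = 0"
  shows False
proof -
  obtain g where g: "\<And>z w. (z, w) \<in> bidisk \<Longrightarrow> \<theta> (z, w) = g z"
    using dep unfolding depends_only_on_z_def by blast
  have "p * [:poly q 0:] - q * [:poly p 0:] = 0"
  proof (rule poly2_eq_0)
    show "infinite (ball (0 :: complex) 1)" by (rule infinite_complex_ball) simp
    fix w :: complex assume w: "w \<in> ball 0 1"
    have "poly2 (p * [:poly q 0:] - q * [:poly p 0:]) (z, w) = 0" if z: "cmod z < 1" for z
    proof -
      have e: "poly (poly f 0) z = poly2 f (z, 0)" for f by (simp add: poly2_def)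
      have "poly2 q (z, w) = g z * poly2 p (z, w)" "poly2 q (z, 0) = g z * poly2 p (z, 0)"
        using \<theta>_mult_p[of "(z, w)"] \<theta>_mult_p[of "(z, 0)"] g[of z w] g[of z 0] z w by auto
      then show ?thesis unfolding poly2_diff poly2_mult poly2_const e by simp
    qed
    then have "ball 0 1 \<subseteq> {z. poly2 (p * [:poly q 0:] - q * [:poly p 0:]) (z, w) = 0}" by auto
    then show "infinite {z. poly2 (p * [:poly q 0:] - q * [:poly p 0:]) (z, w) = 0}"
      using infinite_complex_ball[of 1 0] finite_subset by (metis zero_less_one)
  qed
  then have eq: "p * [:poly q 0:] = q * [:poly p 0:]" by simp
  have qn: "q \<noteq> 0"
  proof
    assume "q = 0"
    then have "poly2 p (z, w) = 0" if "cmod z = 1" "cmod w = 1" for z w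
      using modulus_on_torus[OF that] by simp
    then have "sphere 0 1 \<subseteq> {z. poly2 p (z, w) = 0}" if "w \<in> sphere 0 1" for w
      using that by auto
    then have "infinite {z. poly2 p (z, w) = 0}" if "w \<in> sphere 0 1" for w
      using infinite_unit_circle finite_subset that by blast
    from poly2_eq_0[OF infinite_unit_circle this] p_nonzero show False by simp
  qed
  have p00: "poly p 0 \<noteq> 0"
  proof
    assume p00: "poly p 0 = 0"
    with eq p_nonzero have "poly q 0 = 0" by simp
    with p00 have "{z. poly2 p (z, 0) = 0} = UNIV" "{z. poly2 q (z, 0) = 0} = UNIV"
      by (auto simp: poly2_def)
    then have "\<not> coprime p q"
      by (intro not_coprime_of_vanishing_z[where w = 0]) (simp_all add: infinite_UNIV_char_0)
    with coprime_p_q show False by simp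
  qed
  have q00: "poly q 0 \<noteq> 0"
  proof
    assume "poly q 0 = 0"
    with eq qn p00 show False by simp
  qed
  \<comment> \<open>Being coprime to q, p divides p(z, 0), which has degree 0 in w; the same
    argument applies to q.\<close>
  have "p dvd q * [:poly p 0:]" using eq by (metis dvd_triv_left)
  then have "p dvd [:poly p 0:]" by (simp only: coprime_dvd_mult_right_iff[OF coprime_p_q])
  then have "degree p \<le> degree [:poly p 0:]" using p00 by (intro dvd_imp_degree_le) auto
  then obtain p0 where p: "p = [:p0:]" by (auto elim: degree_eq_zeroE)
  have "q dvd p * [:poly q 0:]" using eq by (metis dvd_triv_left)
  then have "q dvd [:poly q 0:]"
    by (simp only: coprime_dvd_mult_right_iff[OF coprime_commute[THEN iffD1, OF coprime_p_q]])
  then have "degree q \<le> degree [:poly q 0:]" using q00 by (intro dvd_imp_degree_le) auto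
  then obtain r where q: "q = [:r:]" by (auto elim: degree_eq_zeroE)
  have r: "poly r \<nu> = 0" using q0 by (simp add: q)
  then have "poly p0 \<nu> = 0" using modulus_on_torus[OF zw(1), of 1] by (simp add: p q)
  with r have "{w. poly2 p (\<nu>, w) = 0} = UNIV" "{w. poly2 q (\<nu>, w) = 0} = UNIV"
    by (auto simp: p q)
  then have "\<not> coprime p q"
    by (intro not_coprime_of_vanishing_w[where z = \<nu>]) (simp_all add: infinite_UNIV_char_0)
  with coprime_p_q show False by simp
qed

lemma spectrum_eq: "op_spectrum K S = fst ` (zero_set2 q \<inter> closure bidisk)"
proof (intro equalityI subsetI)
  fix \<nu> assume s: "\<nu> \<in> op_spectrum K S"
  then have n: "cmod \<nu> \<le> 1" using resolvent_outside_disk not_less by blast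
  with s resolvent_rational obtain w where "cmod w \<le> 1" "poly2 q (\<nu>, w) = 0" by blast
  with n have "(\<nu>, w) \<in> zero_set2 q \<inter> closure bidisk" by (simp add: zero_set2_def closure_bidisk)
  then show "\<nu> \<in> fst ` (zero_set2 q \<inter> closure bidisk)" by force
next
  fix \<nu> assume "\<nu> \<in> fst ` (zero_set2 q \<inter> closure bidisk)"
  then obtain w where w: "poly2 q (\<nu>, w) = 0" "cmod \<nu> \<le> 1" "cmod w \<le> 1"
    by (auto simp: zero_set2_def closure_bidisk)
  consider "cmod \<nu> = 1" | "cmod \<nu> < 1" "cmod w = 1" | "cmod \<nu> < 1" "cmod w < 1"
    using w by linarith
  then show "\<nu> \<in> op_spectrum K S"
  proof cases
    \<comment> \<open>Either \<theta> depends on w and the whole circle lies in the spectrum, or no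
      such zero of q exists.\<close>
    case 1
    then have "\<nu> \<in> sphere 0 1" by simp
    then show ?thesis
      using depends_only_on_z_no_boundary_zero[OF _ 1 w(3,1)] circle_in_spectrum by blast
  next
    case 2
    then show ?thesis using spectrum_boundary_w[OF 2 w(1)] zeros_in_spectrum by blast
  next
    case 3
    then have "(\<nu>, w) \<in> {x \<in> bidisk. \<theta> x = 0}" using \<theta>_zero_of_q_zero[OF 3 w(1)] by simp
    then have "\<nu> \<in> fst ` {x \<in> bidisk. \<theta> x = 0}" by (rule image_eqI[rotated]) simp
    then have "\<nu> \<in> closure (fst ` {x \<in> bidisk. \<theta> x = 0})" by (rule subsetD[OF closure_subset])
    then show ?thesis using zeros_in_spectrum by blast
  qed
qed

end

theorem theorem2p4:
  fixes \<theta> :: "complex \<times> complex \<Rightarrow> complex"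
  assumes "inner_function \<theta>"
  shows "(\<not> depends_only_on_z \<theta> \<longrightarrow>
            closure (fst ` {x \<in> bidisk. \<theta> x = 0}) \<union> sphere 0 1
              \<subseteq> op_spectrum (model_space \<theta>) (compressed_shift_z \<theta>)) \<and>
         (\<forall>q p :: complex poly poly. reduced_fraction \<theta> q p \<longrightarrow>
            op_spectrum (model_space \<theta>) (compressed_shift_z \<theta>)
              = fst ` (zero_set2 q \<inter> closure bidisk))"
proof -
  interpret inner_fun \<theta> by standard (rule assms)
  have "op_spectrum (model_space \<theta>) (compressed_shift_z \<theta>) = fst ` (zero_set2 q \<inter> closure bidisk)"
    if "reduced_fraction \<theta> q p" for q p :: "complex poly poly"
  proof -
    interpret rational_inner_fun \<theta> q p by standard (rule that)
    show ?thesis by (rule spectrum_eq)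
  qed
  then show ?thesis using zeros_in_spectrum circle_in_spectrum by blast
qed

end
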